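(* Let $K$ be a field of characteristic zero and let a Poisson algebra $\mathcal{A}=S^{-1}(P_n/I)$ be a regular domain of essentially finite type over $K$, where $I=(f_1,\ldots,f_m)$ is a prime but not maximal ideal of $P_n=K[x_1,\ldots,x_n]$. Let $r$ be the rank of the Jacobian matrix of $\mathcal{A}$ and $d$ the rank of the matrix $\mathcal{C}_{\mathcal{A}}=(\{x_i,x_j\})$. Then the following statements are equivalent: (1) $\mathrm{Der}_K(\mathcal{A})=\mathcal{A}\mathcal{H}_{\mathcal{A}}$. (2) $d=n-r$ and $\mathfrak{c}_{\mathcal{A},d}=\mathcal{A}$. (3) For each $\mathbf{i}\in\mathbb{I}_r$ and $\mathbf{j}\in\mathbb{J}_r$, $\Delta(\mathbf{i},\mathbf{j})^{n-r}\in\mathfrak{m}_{\mathbf{j}}$, where $\mathfrak{m}_{\mathbf{j}}$ is the ideal of $\mathcal{A}$ generated by all the $(n-r)\times(n-r)$ minors of the $n\times(n-r)$ matrix $\mathcal{C}_{\mathcal{A},\mathbf{j}}$. (4) For each $\mathbf{i}\in\mathbb{I}_r$ and $\mathbf{j}\in\mathbb{J}_r$, $\Delta(\mathbf{i},\mathbf{j})^k\in\mathfrak{c}_{\mathcal{A},n-r}$ for some $k\ge1$.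
   Context: A Poisson algebra over $K$ is a commutative associative (unital) $K$-algebra with a $K$-bilinear Lie bracket $\{\cdot,\cdot\}$ satisfying $\{a,xy\}=\{a,x\}y+x\{a,y\}$. An algebra of essentially finite type is a localization of an affine commutative algebra. $\mathcal{H}_{\mathcal{A}}=\{\{a,\cdot\}\mid a\in\mathcal{A}\}\subseteq\mathrm{Der}_K(\mathcal{A})$ is the set of Hamiltonian derivations and $\mathcal{A}\mathcal{H}_{\mathcal{A}}$ is the $\mathcal{A}$-submodule of $\mathrm{Der}_K(\mathcal{A})$ it generates. Ranks are taken over the field of fractions of $\mathcal{A}$. The Jacobian matrix is $\big(\frac{\partial f_i}{\partial x_j}\big)$. For $\mathbf{i}=(i_1<\cdots<i_r)$ in $\{1,\ldots,m\}$ and $\mathbf{j}=(j_1<\cdots<j_r)$ in $\{1,\ldots,n\}$, $\Delta(\mathbf{i},\mathbf{j})=\det\big(\frac{\partial f_{i_\nu}}{\partial x_{j_\mu}}\big)_{\nu,\mu=1}^r\in\mathcal{A}$. $\mathbb{I}_r$ (resp. $\mathbb{J}_r$) is the set of all $\mathbf{i}$ (resp. $\mathbf{j}$) such that $\Delta(\mathbf{i},\mathbf{j}')\ne0$ for some $\mathbf{j}'$ (resp. $\Delta(\mathbf{i}',\mathbf{j})\neq0$ for some $\mathbf{i}'$). $\mathfrak{c}_{\mathcal{A},s}$ is the ideal of $\mathcal{A}$ generated by all the $s\times s$ minors of the $n\times n$ matrix $\mathcal{C}_{\mathcal{A}}=(\{x_i,x_j\})$. For $\mathbf{j}=(j_1,\ldots,j_r)\in\mathbb{J}_r$,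 $\mathcal{C}_{\mathcal{A},\mathbf{j}}$ is the $n\times(n-r)$ matrix obtained from $\mathcal{C}_{\mathcal{A}}$ by deleting the columns with indices $j_1,\ldots,j_r$. *)

theory Defs
  imports
    "HOL-Library.Poly_Mapping"
    "HOL-Library.Extended_Nat"
    "HOL-Library.Function_Algebras"
    "HOL-Computational_Algebra.Fraction_Field"
    "HOL-Algebra.QuotRing"
    "HOL-Algebra.Ring_Divisibility"
    "Jordan_Normal_Form.Determinant"
    "Jordan_Normal_Form.DL_Rank"
    "Jordan_Normal_Form.DL_Submatrix"
begin

section \<open>Poisson algebras and derivations\<close>

locale K_algebra = Vector_Spaces.vector_space scale
  for scale :: "'k::field \<Rightarrow> 'a::comm_ring_1 \<Rightarrow> 'a" +
  assumes scale_mult_left: "scale c (x * y) = scale c x * y"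

definition derivations :: "('k::field \<Rightarrow> 'a::comm_ring_1 \<Rightarrow> 'a) \<Rightarrow> ('a \<Rightarrow> 'a) set" where
  "derivations scale =
     {D. Vector_Spaces.linear scale scale D \<and> (\<forall>x y. D (x * y) = D x * y + x * D y)}"

locale poisson_algebra = K_algebra scale
  for scale :: "'k::field \<Rightarrow> 'a::comm_ring_1 \<Rightarrow> 'a" +
  fixes br :: "'a \<Rightarrow> 'a \<Rightarrow> 'a"
  assumes linear_left: "Vector_Spaces.linear scale scale (\<lambda>a. br a b)"
    and linear_right: "Vector_Spaces.linear scale scale (br a)"
    and alternating: "br a a = 0"
    and jacobi: "br a (br b c) + br b (br c a) + br c (br a b) = 0"
    and leibniz: "br a (x * y) = br a x * y + x * br a y"

definition hamiltonian_derivations :: "('a \<Rightarrow> 'a \<Rightarrow> 'a) \<Rightarrow> ('a \<Rightarrow> 'a) set" where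
  "hamiltonian_derivations br = range br"

definition fun_scale :: "'a::comm_ring_1 \<Rightarrow> ('a \<Rightarrow> 'a) \<Rightarrow> 'a \<Rightarrow> 'a" where
  "fun_scale a D = (\<lambda>x. a * D x)"

text \<open>Functions form a module over the ring under pointwise operations, so that
  \<^term>\<open>Modules.module.span fun_scale\<close> is the submodule generated by a set of functions.\<close>

lemma module_fun_scale: "Modules.module fun_scale"
  by unfold_locales (auto simp: fun_scale_def fun_eq_iff algebra_simps)

section \<open>Localization and regularity\<close>

text \<open>The ring \<open>A\<close>, together with \<open>\<phi>\<close>, is the ring of fractions of \<open>R\<close> with respect to the
  multiplicative set \<open>S\<close> (up to the unique isomorphism over \<open>R\<close>).\<close>

definition is_localization ::
    "('r, 'c) ring_scheme \<Rightarrow> 'r set \<Rightarrow> ('a, 'd) ring_scheme \<Rightarrow> ('r \<Rightarrow> 'a) \<Rightarrow> bool" where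
  "is_localization R S A \<phi> \<longleftrightarrow>
     submonoid S R \<and> \<phi> \<in> Ring.ring_hom R A \<and>
     (\<forall>s\<in>S. \<phi> s \<in> Units A) \<and>
     (\<forall>a\<in>carrier A. \<exists>p\<in>carrier R. \<exists>s\<in>S. a \<otimes>\<^bsub>A\<^esub> \<phi> s = \<phi> p) \<and>
     (\<forall>p\<in>carrier R. \<phi> p = \<zero>\<^bsub>A\<^esub> \<longleftrightarrow> (\<exists>s\<in>S. s \<otimes>\<^bsub>R\<^esub> p = \<zero>\<^bsub>R\<^esub>))"

definition krull_dim :: "('a, 'b) ring_scheme \<Rightarrow> enat" where
  "krull_dim R =
     (SUP ps \<in> {ps. ps \<noteq> [] \<and> (\<forall>p\<in>set ps. primeideal p R) \<and> sorted_wrt (\<subset>) ps}.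
        enat (length ps - 1))"

definition regular_local_ring :: "('a, 'b) ring_scheme \<Rightarrow> bool" where
  "regular_local_ring R \<longleftrightarrow>
     cring R \<and> noetherian_ring R \<and>
     (\<exists>\<mm>. {M. maximalideal M R} = {\<mm>} \<and>
          (\<exists>X\<subseteq>carrier R. finite X \<and> \<mm> = Idl\<^bsub>R\<^esub> X \<and> enat (card X) = krull_dim R))"

text \<open>The localization of a domain at a prime ideal, as a subring of the field of fractions.\<close>

definition localization_at :: "'a::idom set \<Rightarrow> 'a fract ring" where
  "localization_at p = class_ring\<lparr>carrier := {Fract a s | a s. s \<notin> p}\<rparr>"

definition regular_domain :: "'a::idom itself \<Rightarrow> bool" where
  "regular_domain _ \<longleftrightarrow>
     noetherian_ring (class_ring :: 'a ring) \<and>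
     (\<forall>p::'a set. primeideal p class_ring \<longrightarrow> regular_local_ring (localization_at p))"

section \<open>Polynomials\<close>

text \<open>A polynomial maps monomials (exponent vectors of finite support) to coefficients. The
  variables are numbered from 0, so the polynomial ring in \<open>n\<close> variables uses \<open>0, \<dots>, n - 1\<close>.\<close>

type_synonym 'k mpoly = "(nat \<Rightarrow>\<^sub>0 nat) \<Rightarrow>\<^sub>0 'k"

definition poly_ring :: "nat \<Rightarrow> 'k::comm_ring_1 mpoly ring" where
  "poly_ring n =
     class_ring\<lparr>carrier := {p. \<forall>t\<in>Poly_Mapping.keys p. Poly_Mapping.keys t \<subseteq> {..<n}}\<rparr>"

definition pconst :: "'k::comm_ring_1 \<Rightarrow> 'k mpoly" where
  "pconst c = Poly_Mapping.single 0 c"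

definition pvar :: "nat \<Rightarrow> 'k::comm_ring_1 mpoly" where
  "pvar j = Poly_Mapping.single (Poly_Mapping.single j 1) 1"

definition pdiff :: "nat \<Rightarrow> 'k::comm_ring_1 mpoly \<Rightarrow> 'k mpoly" where
  "pdiff j p = (\<Sum>t\<in>Poly_Mapping.keys p.
     Poly_Mapping.single (t - Poly_Mapping.single j 1)
       (of_nat (Poly_Mapping.lookup t j) * Poly_Mapping.lookup p t))"

section \<open>Matrices, ranks and minors\<close>

definition jacobian_matrix ::
    "nat \<Rightarrow> nat \<Rightarrow> 'k::comm_ring_1 mpoly set \<Rightarrow> ('k mpoly set \<Rightarrow> 'a) \<Rightarrow> (nat \<Rightarrow> 'k mpoly) \<Rightarrow> 'a mat" where
  "jacobian_matrix m n I \<phi> f = mat m n (\<lambda>(i, j). \<phi> (I +>\<^bsub>poly_ring n\<^esub> pdiff j (f i)))"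

definition poisson_matrix :: "nat \<Rightarrow> ('a \<Rightarrow> 'a \<Rightarrow> 'a) \<Rightarrow> (nat \<Rightarrow> 'a) \<Rightarrow> 'a mat" where
  "poisson_matrix n br x = mat n n (\<lambda>(i, j). br (x i) (x j))"

definition frac_rank :: "'a::idom mat \<Rightarrow> nat" where
  "frac_rank M = vec_space.rank (dim_row M) (map_mat (\<lambda>a. Fract a 1) M)"

text \<open>A strictly increasing tuple of length \<open>s\<close> with entries below \<open>k\<close> is encoded by the set of
  its entries.\<close>

definition index_sets :: "nat \<Rightarrow> nat \<Rightarrow> nat set set" where
  "index_sets k s = {i. i \<subseteq> {..<k} \<and> card i = s}"

definition minor :: "'a::comm_ring_1 mat \<Rightarrow> nat set \<Rightarrow> nat set \<Rightarrow> 'a" where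
  "minor M i j = det (submatrix M i j)"

definition nonzero_minor_rows :: "nat \<Rightarrow> 'a::comm_ring_1 mat \<Rightarrow> nat set set" where
  "nonzero_minor_rows s M =
     {i \<in> index_sets (dim_row M) s. \<exists>j\<in>index_sets (dim_col M) s. minor M i j \<noteq> 0}"

definition nonzero_minor_cols :: "nat \<Rightarrow> 'a::comm_ring_1 mat \<Rightarrow> nat set set" where
  "nonzero_minor_cols s M =
     {j \<in> index_sets (dim_col M) s. \<exists>i\<in>index_sets (dim_row M) s. minor M i j \<noteq> 0}"

definition minor_ideal :: "nat \<Rightarrow> 'a::comm_ring_1 mat \<Rightarrow> 'a set" where
  "minor_ideal s M =
     Idl\<^bsub>class_ring\<^esub> {minor M i j | i j. i \<in> index_sets (dim_row M) s \<and> j \<in> index_sets (dim_col M) s}"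

definition delete_cols :: "'a mat \<Rightarrow> nat set \<Rightarrow> 'a mat" where
  "delete_cols M j = submatrix M UNIV (- j)"

end

theory Submission
  imports Defs "Jordan_Normal_Form.DL_Rank_Submatrix"
begin

text \<open>Sending a derivation \<open>D\<close> to the vector of the \<open>D x\<^sub>t\<close> identifies \<open>Der\<^sub>K(A)\<close> with the kernel of the
  Jacobian matrix and the module generated by the Hamiltonian derivations with the row space of the
  matrix of brackets, so the first condition says that the two coincide.

  If they coincide, then the Cramer vectors attached to an \<open>r\<close>-minor \<open>\<Delta>\<close> of the Jacobian matrix are
  combinations of the rows of the matrix of brackets, which gives the third condition and hence the
  fourth. By the Jacobian criterion the \<open>r\<close>-minors of the Jacobian matrix generate the unit
  ideal, so the fourth condition implies the second. If the minors of size \<open>n - r\<close> of the matrix of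
  brackets generate the unit ideal, bordering them by a vector of the kernel shows that the vector
  lies in the row space.

  For the Jacobian criterion the rank of a set of vectors modulo a prime \<open>p\<close> is read off from the
  minors outside \<open>p\<close>, so no residue fields are needed. In characteristic zero the gradients of the
  polynomials that vanish modulo \<open>p\<close> have rank \<open>n\<close> minus the transcendence degree modulo \<open>p\<close>. Thus
  transcendence bases modulo \<open>p\<close> are equinumerous, and their size drops strictly along chains of
  primes, which bounds the dimension of \<open>A\<^sub>q\<close>. If the maximal ideal of \<open>A\<^sub>q\<close> has as many generators as
  the dimension of \<open>A\<^sub>q\<close>, then their gradients account for too little of the rank modulo \<open>q\<close>, and the
  rows of the Jacobian matrix must have rank at least \<open>r\<close> modulo \<open>q\<close>.\<close>

section \<open>Determinants modulo a prime ideal\<close>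

text \<open>Conditions (2) to (4) speak of minors only, so (1) has to be turned into a statement on
  vectors. A kernel vector extends to a derivation because two gradients of one element differ by a
  combination of rows of the Jacobian matrix. The bracket of any element with a coordinate expands
  in its first argument, so the brackets of the coordinates suffice.

  Regularity enters in the step from (4) to (2). Let t(p) be the size of a transcendence basis
  modulo p; then t(0) = n - r. The gradients of the polynomials vanishing modulo q have rank n -
  t(q), and chains of primes give that the local ring at q has dimension at most t(0) - t(q). If its
  maximal ideal has that many generators, they carry at most n - r - t(q) of the rank, so at least r
  is left for the rows of the Jacobian matrix.

  The rank n - t(p) comes from two bounds: relations of minimal degree have gradients in triangular
  form with nonvanishing diagonal, and pseudo-division by these relations shows that no further
  gradient raises the rank.\<close>

definition is_ideal :: "'a::comm_ring_1 set \<Rightarrow> bool" where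
  "is_ideal Q \<longleftrightarrow> 0 \<in> Q \<and> (\<forall>a\<in>Q. \<forall>b\<in>Q. a + b \<in> Q) \<and> (\<forall>a. \<forall>b\<in>Q. a * b \<in> Q)"

definition is_prime :: "'a::comm_ring_1 set \<Rightarrow> bool" where
  "is_prime p \<longleftrightarrow> is_ideal p \<and> 1 \<notin> p \<and> (\<forall>a b. a * b \<in> p \<longrightarrow> a \<in> p \<or> b \<in> p)"

lemma is_prime_ideal: "is_prime p \<Longrightarrow> is_ideal p"
  by (simp add: is_prime_def)

lemma ideal_zero: "is_ideal Q \<Longrightarrow> 0 \<in> Q"
  and ideal_add: "is_ideal Q \<Longrightarrow> a \<in> Q \<Longrightarrow> b \<in> Q \<Longrightarrow> a + b \<in> Q"
  and ideal_mult_left: "is_ideal Q \<Longrightarrow> b \<in> Q \<Longrightarrow> a * b \<in> Q"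
  by (auto simp: is_ideal_def)

lemma ideal_mult_right: "is_ideal Q \<Longrightarrow> b \<in> Q \<Longrightarrow> b * a \<in> Q"
  by (metis ideal_mult_left mult.commute)

lemma ideal_uminus: "is_ideal Q \<Longrightarrow> a \<in> Q \<Longrightarrow> - a \<in> Q"
  using ideal_mult_left[of Q a "-1"] by simp

lemma ideal_diff: "is_ideal Q \<Longrightarrow> a \<in> Q \<Longrightarrow> b \<in> Q \<Longrightarrow> a - b \<in> Q"
  using ideal_add[of Q a "- b"] ideal_uminus by auto

lemma ideal_sum: "is_ideal Q \<Longrightarrow> (\<And>i. i \<in> X \<Longrightarrow> g i \<in> Q) \<Longrightarrow> sum g X \<in> Q"
  by (induction X rule: infinite_finite_induct) (auto intro: ideal_zero ideal_add)

lemma ideal_add_iff: "is_ideal Q \<Longrightarrow> b \<in> Q \<Longrightarrow> a + b \<in> Q \<longleftrightarrow> a \<in> Q"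
  using ideal_add[of Q a b] ideal_diff[of Q "a + b" b] by auto

lemma prime_mult: "is_prime p \<Longrightarrow> a * b \<in> p \<longleftrightarrow> a \<in> p \<or> b \<in> p"
  by (auto simp: is_prime_def intro: ideal_mult_left ideal_mult_right)

lemma prime_one: "is_prime p \<Longrightarrow> 1 \<notin> p"
  by (simp add: is_prime_def)

lemma prime_zero: "is_prime p \<Longrightarrow> 0 \<in> p"
  by (simp add: is_prime_def is_ideal_def)

lemma prime_prod: "finite X \<Longrightarrow> is_prime p \<Longrightarrow> prod g X \<in> p \<longleftrightarrow> (\<exists>i\<in>X. g i \<in> p)"
  by (induction X rule: finite_induct) (auto simp: prime_mult prime_one)

lemma prime_power: "is_prime p \<Longrightarrow> a ^ k \<in> p \<Longrightarrow> a \<in> p"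
  by (induction k) (auto simp: prime_mult prime_one)

lemma is_prime_zero: "is_prime ({0} :: 'a::idom set)"
  by (auto simp: is_prime_def is_ideal_def)

text \<open>Rows are functions and columns are given by an index map, so replacing a row is a
  function update and deleting one is composition with \<open>insert_index\<close>. The map
  \<open>c\<close> may repeat indices or be unsorted; only the comparison with \<open>minor\<close>
  sorts it.\<close>

definition gdet :: "nat \<Rightarrow> (nat \<Rightarrow> nat \<Rightarrow> 'a::comm_ring_1) \<Rightarrow> (nat \<Rightarrow> nat) \<Rightarrow> 'a" where
  "gdet k u c = det (mat k k (\<lambda>(i, l). u i (c l)))"

lemma gdet_cong:
  "(\<And>i l. i < k \<Longrightarrow> l < k \<Longrightarrow> u i (c l) = u' i (c' l)) \<Longrightarrow> gdet k u c = gdet k u' c'"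
  unfolding gdet_def by (rule arg_cong[of _ _ det]) (auto intro!: eq_matI)

lemma gdet_0 [simp]: "gdet 0 u c = 1"
  by (simp add: gdet_def)

lemma mat_delete_gdet:
  "det (mat_delete (mat (Suc k) (Suc k) (\<lambda>(i, l). u i (c l))) i j) =
   gdet k (u \<circ> insert_index i) (c \<circ> insert_index j)"
  unfolding gdet_def mat_delete_def
  by (rule arg_cong[of _ _ det]) (auto intro!: eq_matI simp: insert_index_def)

lemma gdet_expand_row:
  assumes "i < Suc k"
  shows "gdet (Suc k) u c =
    (\<Sum>j<Suc k. u i (c j) * ((-1)^(i + j) * gdet k (u \<circ> insert_index i) (c \<circ> insert_index j)))"
proof -
  let ?A = "mat (Suc k) (Suc k) (\<lambda>(i, l). u i (c l))"
  have "gdet (Suc k) u c = (\<Sum>j<Suc k. ?A $$ (i, j) * cofactor ?A i j)"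
    unfolding gdet_def by (rule laplace_expansion_row) (use assms in auto)
  then show ?thesis
    using assms by (simp add: cofactor_def mat_delete_gdet del: sum.lessThan_Suc)
qed

lemma gdet_expand_column:
  assumes "j < Suc k"
  shows "gdet (Suc k) u c =
    (\<Sum>i<Suc k. u i (c j) * ((-1)^(i + j) * gdet k (u \<circ> insert_index i) (c \<circ> insert_index j)))"
proof -
  let ?A = "mat (Suc k) (Suc k) (\<lambda>(i, l). u i (c l))"
  have "gdet (Suc k) u c = (\<Sum>i<Suc k. ?A $$ (i, j) * cofactor ?A i j)"
    unfolding gdet_def by (rule laplace_expansion_column) (use assms in auto)
  then show ?thesis
    using assms by (simp add: cofactor_def mat_delete_gdet del: sum.lessThan_Suc)
qed

lemma gdet_equal_rows:
  assumes "i < k" "j < k" "i \<noteq> j" "\<And>l. l < k \<Longrightarrow> u i (c l) = u j (c l)"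
  shows "gdet k u c = 0"
  unfolding gdet_def by (rule det_identical_rows[of _ k i j]) (use assms in \<open>auto intro!: eq_vecI\<close>)

lemma gdet_equal_columns:
  assumes "i < k" "j < k" "i \<noteq> j" "c i = c j"
  shows "gdet k u c = 0"
  unfolding gdet_def by (rule det_identical_columns[of _ k i j]) (use assms in \<open>auto intro!: eq_vecI\<close>)

lemma gdet_lower_triangular:
  assumes "\<And>i j. i < j \<Longrightarrow> j < k \<Longrightarrow> u i (c j) = 0"
  shows "gdet k u c = (\<Prod>i<k. u i (c i))"
proof -
  have "gdet k u c = prod_list (diag_mat (mat k k (\<lambda>(i, l). u i (c l))))"
    unfolding gdet_def by (rule det_lower_triangular[where n = k]) (use assms in auto)
  also have "\<dots> = (\<Prod>i<k. u i (c i))"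
    by (simp add: diag_mat_def prod.list_conv_set_nth atLeast0LessThan)
  finally show ?thesis .
qed

lemma gdet_permute_rows:
  assumes "\<sigma> permutes {0..<k}"
  shows "gdet k (u \<circ> \<sigma>) c = signof \<sigma> * gdet k u c"
proof -
  have "\<sigma> i < k" if "i < k" for i
    using permutes_in_image[OF assms, of i] that by auto
  then have "mat k k (\<lambda>(i, l). (u \<circ> \<sigma>) i (c l)) = mat k k (\<lambda>(i, l). mat k k (\<lambda>(i, l). u i (c l)) $$ (\<sigma> i, l))"
    by (auto intro!: eq_matI)
  then show ?thesis
    unfolding gdet_def using det_permute_rows[OF _ assms, of "mat k k (\<lambda>(i, l). u i (c l))"] by simp
qed

lemma gdet_transpose: "gdet k (\<lambda>i t. M (a i) t) c = gdet k (\<lambda>j t. M t (c j)) a"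
proof -
  have "transpose_mat (mat k k (\<lambda>(i, l). M (a i) (c l))) = mat k k (\<lambda>(j, i). M (a i) (c j))"
    by (auto intro!: eq_matI)
  then show ?thesis
    unfolding gdet_def by (metis det_transpose mat_carrier)
qed

text \<open>Cofactors of row \<open>i\<close> collected by column value: \<open>c\<close> may take
  the value \<open>t\<close> at several positions, so the coefficient of coordinate \<open>t\<close>
  is a sum over these.\<close>

definition row_lin :: "nat \<Rightarrow> (nat \<Rightarrow> nat \<Rightarrow> 'a::comm_ring_1) \<Rightarrow> (nat \<Rightarrow> nat) \<Rightarrow> nat \<Rightarrow> nat \<Rightarrow> 'a" where
  "row_lin k u c i t = (\<Sum>j<Suc k. if c j = t
     then (-1)^(i + j) * gdet k (u \<circ> insert_index i) (c \<circ> insert_index j) else 0)"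

lemma gdet_row_lin:
  assumes "i < Suc k" "\<And>j. j < Suc k \<Longrightarrow> c j < n"
  shows "gdet (Suc k) (u(i := v)) c = (\<Sum>t<n. row_lin k u c i t * v t)"
proof -
  let ?w = "\<lambda>j. (-1)^(i + j) * gdet k (u \<circ> insert_index i) (c \<circ> insert_index j)"
  have [simp]: "u(i := v) \<circ> insert_index i = u \<circ> insert_index i"
    by (auto simp: insert_index_def fun_eq_iff)
  have "gdet (Suc k) (u(i := v)) c = (\<Sum>j<Suc k. v (c j) * ?w j)"
    by (subst gdet_expand_row[OF assms(1)]) (simp del: sum.lessThan_Suc)
  also have "\<dots> = (\<Sum>j<Suc k. \<Sum>t<n. if c j = t then ?w j * v t else 0)"
    by (rule sum.cong) (use assms(2) in \<open>auto simp: sum.delta' mult.commute\<close>)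
  also have "\<dots> = (\<Sum>t<n. \<Sum>j<Suc k. if c j = t then ?w j * v t else 0)"
    by (rule sum.swap)
  also have "\<dots> = (\<Sum>t<n. row_lin k u c i t * v t)"
    unfolding row_lin_def sum_distrib_right
    by (intro sum.cong refl) (auto simp del: sum.lessThan_Suc)
  finally show ?thesis .
qed

text \<open>The vectors annihilated modulo \<open>Q\<close> by every linear form that annihilates \<open>W\<close> modulo \<open>Q\<close>.
  Over a prime \<open>Q\<close> this is the saturated span of \<open>W\<close>, and it is closed under division by
  elements outside \<open>Q\<close>.\<close>

definition bipolar :: "'a::comm_ring_1 set \<Rightarrow> nat \<Rightarrow> (nat \<Rightarrow> 'a) set \<Rightarrow> (nat \<Rightarrow> 'a) set" where
  "bipolar Q n W =
     {v. \<forall>h. (\<forall>w\<in>W. (\<Sum>t<n. h t * w t) \<in> Q) \<longrightarrow> (\<Sum>t<n. h t * v t) \<in> Q}"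

text \<open>A determinant is a linear form in each of its rows, so rows from \<open>W\<close> may be
  exchanged for rows from the bipolar one at a time. Besides primes, \<open>Q\<close> will also be
  an ideal of minors.\<close>

lemma gdet_bipolar:
  assumes c: "\<And>l. l < k \<Longrightarrow> c l < n"
    and W: "\<And>u. (\<And>i. i < k \<Longrightarrow> u i \<in> W) \<Longrightarrow> gdet k u c \<in> Q"
    and v: "\<And>i. i < k \<Longrightarrow> v i \<in> bipolar Q n W"
  shows "gdet k v c \<in> Q"
proof -
  \<comment> \<open>The first \<open>s\<close> rows are already exchanged, the remaining ones still
    come from \<open>W\<close>.\<close>
  have "gdet k u c \<in> Q"
    if "s \<le> k" "\<And>i. i < s \<Longrightarrow> u i \<in> bipolar Q n W" "\<And>i. s \<le> i \<Longrightarrow> i < k \<Longrightarrow> u i \<in> W" for s u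
    using that
  proof (induction s arbitrary: u)
    case 0
    then show ?case by (intro W) auto
  next
    case (Suc s)
    then obtain k' where k': "k = Suc k'"
      by (cases k) auto
    have *: "gdet k (u(s := w)) c = (\<Sum>t<n. row_lin k' u c s t * w t)" for w
      unfolding k' by (rule gdet_row_lin) (use Suc.prems k' c in auto)
    have "\<forall>w\<in>W. (\<Sum>t<n. row_lin k' u c s t * w t) \<in> Q"
    proof
      fix w assume "w \<in> W"
      then show "(\<Sum>t<n. row_lin k' u c s t * w t) \<in> Q"
        unfolding *[symmetric] by (intro Suc.IH) (use Suc.prems in auto)
    qed
    moreover have "u s \<in> bipolar Q n W"
      using Suc.prems by auto
    ultimately have "(\<Sum>t<n. row_lin k' u c s t * u s t) \<in> Q"
      unfolding bipolar_def by blast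
    then show ?case
      unfolding *[symmetric] by simp
  qed
  from this[of k v] show ?thesis
    using v by auto
qed

text \<open>For a prime \<open>p\<close> this means rank at least \<open>k\<close> over the field of
  fractions of the quotient by \<open>p\<close>.\<close>

definition has_minor :: "'a::comm_ring_1 set \<Rightarrow> nat \<Rightarrow> (nat \<Rightarrow> 'a) set \<Rightarrow> nat \<Rightarrow> bool" where
  "has_minor p n U k \<longleftrightarrow>
     (\<exists>u c. (\<forall>i<k. u i \<in> U) \<and> (\<forall>l<k. c l < n) \<and> gdet k u c \<notin> p)"

lemma has_minorE:
  assumes "has_minor p n U k"
  obtains u c where "\<forall>i<k. u i \<in> U" "\<forall>l<k. c l < n" "gdet k u c \<notin> p"
  using assms unfolding has_minor_def by blast

lemma has_minor_mono: "has_minor p n U k \<Longrightarrow> U \<subseteq> W \<Longrightarrow> has_minor p n W k"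
  unfolding has_minor_def by blast

lemma has_minor_0: "has_minor p n U 0 \<longleftrightarrow> 1 \<notin> p"
  by (auto simp: has_minor_def)

text \<open>Contrapositive of \<open>gdet_bipolar\<close>: if all minors of size \<open>k\<close> of
  \<open>W\<close> lie in \<open>p\<close>, so do those of its saturated span.\<close>

lemma has_minor_bipolar:
  assumes "has_minor p n U k" "U \<subseteq> bipolar p n W"
  shows "has_minor p n W k"
proof (rule ccontr)
  assume *: "\<not> has_minor p n W k"
  obtain u c where u: "\<forall>i<k. u i \<in> U" "\<forall>l<k. c l < n" "gdet k u c \<notin> p"
    using assms(1) by (auto simp: has_minor_def)
  moreover have "gdet k u c \<in> p"
  proof (rule gdet_bipolar[of _ _ n W])
    show "gdet k w c \<in> p" if "\<And>i. i < k \<Longrightarrow> w i \<in> W" for w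
      using * u(2) that unfolding has_minor_def by blast
  qed (use u assms(2) in auto)
  ultimately show False by simp
qed

text \<open>Equal rows make the determinant vanish, so \<open>w\<close> occupies at most one row; in
  the expansion along that row some cofactor lies outside \<open>p\<close>.\<close>

lemma has_minor_drop_vector:
  assumes p: "is_ideal p" and "has_minor p n (insert w U) (Suc k)"
  shows "has_minor p n U k"
proof -
  obtain u c where u: "\<forall>i<Suc k. u i \<in> insert w U" "\<forall>l<Suc k. c l < n" "gdet (Suc k) u c \<notin> p"
    using assms(2) by (auto simp: has_minor_def)
  \<comment> \<open>The row occupied by \<open>w\<close>, or row 0 if \<open>w\<close> does not
    occur; in the latter case any row may be deleted.\<close>
  define i where "i = (if \<exists>i<Suc k. u i = w then SOME i. i < Suc k \<and> u i = w else 0)"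
  have i: "i < Suc k" "\<And>j. j < Suc k \<Longrightarrow> u j = w \<Longrightarrow> u i = w"
    unfolding i_def by (auto intro: someI2)
  have "j = i" if "j < Suc k" "u j = w" for j
  proof (rule ccontr)
    assume "j \<noteq> i"
    then have "gdet (Suc k) u c = 0"
      by (intro gdet_equal_rows[of j "Suc k" i]) (use i that in auto)
    then show False using u(3) p ideal_zero by auto
  qed
  then have U: "u j \<in> U" if "j < Suc k" "j \<noteq> i" for j
    using u(1) that by blast
  obtain j where j: "j < Suc k" "gdet k (u \<circ> insert_index i) (c \<circ> insert_index j) \<notin> p"
  proof (rule ccontr)
    assume "\<not> thesis"
    then have "gdet (Suc k) u c \<in> p"
      unfolding gdet_expand_row[OF i(1)] using that
      by (intro ideal_sum ideal_mult_left p) auto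
    then show False using u(3) by auto
  qed
  show ?thesis
    unfolding has_minor_def
  proof (intro exI conjI allI impI)
    fix l assume "l < k"
    then show "(u \<circ> insert_index i) l \<in> U"
      using U by (auto simp: insert_index_def)
    show "(c \<circ> insert_index j) l < n"
      using u(2) \<open>l < k\<close> by (auto simp: insert_index_def)
  qed (rule j(2))
qed

lemma has_minor_le:
  assumes "is_ideal p" "has_minor p n U k" "l \<le> k"
  shows "has_minor p n U l"
  using assms(3,2)
proof (induction rule: inc_induct)
  case (step m)
  have "has_minor p n U m" if "has_minor p n U (Suc m)"
    by (rule has_minor_drop_vector[OF assms(1), of n undefined]) (rule has_minor_mono[OF that], auto)
  then show ?case using step by auto
qed auto

lemma has_minor_drop:
  assumes "is_ideal p" "finite W" "has_minor p n (W \<union> U) k"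
  shows "has_minor p n U (k - card W)"
  using assms(2,3)
proof (induction W arbitrary: k rule: finite_induct)
  case (insert w W)
  have "has_minor p n (W \<union> U) (k - 1)"
  proof (cases k)
    case 0
    then show ?thesis
      using insert.prems by (simp add: has_minor_0)
  next
    case (Suc k')
    then show ?thesis
      using has_minor_drop_vector[OF assms(1), of n w "W \<union> U" k'] insert.prems by simp
  qed
  from insert.IH[OF this] insert.hyps show ?case by simp
qed auto

lemma has_minor_card_le:
  assumes "is_prime p" "finite W" "has_minor p n W k"
  shows "k \<le> card W"
proof (rule ccontr)
  assume "\<not> k \<le> card W"
  then have "has_minor p n {} (Suc 0)"
    using has_minor_drop[of p W n "{}" k] assms is_prime_ideal[OF assms(1)]
      has_minor_le[of p n "{}" "k - card W" "Suc 0"] by simp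
  then show False by (auto simp: has_minor_def)
qed

section \<open>Minors and ranks of matrices\<close>

lemma class_ring_ring: "ring (class_ring :: 'a::ring_1 ring)"
  by (rule class_ring.ring_axioms)

lemma class_ring_ideal_iff: "ideal Q (class_ring :: 'a::comm_ring_1 ring) \<longleftrightarrow> is_ideal Q"
proof
  assume "ideal Q (class_ring :: 'a ring)"
  then interpret ideal Q "class_ring :: 'a ring" .
  show "is_ideal Q"
    using zero_closed a_closed I_l_closed by (auto simp: is_ideal_def)
next
  assume Q: "is_ideal Q"
  show "ideal Q (class_ring :: 'a ring)"
  proof (rule idealI)
    show "subgroup Q (add_monoid (class_ring :: 'a ring))"
    proof (rule subgroup.intro)
      fix a assume "a \<in> Q"
      then have "- a \<in> Q" by (rule ideal_uminus[OF Q])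
      moreover have "inv\<^bsub>add_monoid class_ring\<^esub> a = - a"
        unfolding a_inv_def[symmetric] by (simp add: class_ring_simps)
      ultimately show "inv\<^bsub>add_monoid class_ring\<^esub> a \<in> Q" by simp
    qed (use Q ideal_add ideal_zero in auto)
  qed (use Q ideal_mult_left ideal_mult_right class_ring_ring in auto)
qed

lemma genideal_class_ring_is_ideal: "is_ideal (Idl\<^bsub>class_ring\<^esub> (X :: 'a::comm_ring_1 set))"
  using ring.genideal_ideal[OF class_ring_ring, of X] by (simp add: class_ring_ideal_iff)

lemma genideal_class_ring_subset: "is_ideal Q \<Longrightarrow> X \<subseteq> Q \<Longrightarrow> Idl\<^bsub>class_ring\<^esub> X \<subseteq> Q"
  using ring.genideal_minimal[OF class_ring_ring, of Q X] by (simp add: class_ring_ideal_iff)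

lemma genideal_class_ring_incl: "X \<subseteq> Idl\<^bsub>class_ring\<^esub> (X :: 'a::comm_ring_1 set)"
  using ring.genideal_self[OF class_ring_ring, of X] by simp

definition row_fun :: "'a mat \<Rightarrow> nat \<Rightarrow> nat \<Rightarrow> 'a" where
  "row_fun M i = (\<lambda>t. M $$ (i, t))"

section \<open>Index sets and index tuples\<close>

lemma pick_index_set:
  assumes "i \<in> index_sets m k" "a < k"
  shows "pick i a \<in> i" "pick i a < m"
  using assms pick_in_set_le[of a i] by (auto simp: index_sets_def)

lemma pick_inj_on: "inj_on (pick i) {..<card i}"
  by (rule linorder_inj_onI) (auto dest: pick_mono_le)

lemma pick_image: "finite i \<Longrightarrow> pick i ` {..<card i} = i"
  by (rule card_subset_eq) (auto simp: card_image pick_inj_on pick_in_set_le)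

lemma index_set_card:
  assumes "i \<in> index_sets m k"
  shows "card {a. a < m \<and> a \<in> i} = k"
proof -
  have "{a. a < m \<and> a \<in> i} = i" using assms by (auto simp: index_sets_def)
  then show ?thesis using assms by (simp add: index_sets_def)
qed

lemma minor_eq_gdet:
  assumes "i \<in> index_sets (dim_row M) k" "j \<in> index_sets (dim_col M) k"
  shows "minor M i j = gdet k (\<lambda>a. row_fun M (pick i a)) (pick j)"
  unfolding minor_def gdet_def submatrix_def index_set_card[OF assms(1)] index_set_card[OF assms(2)]
  by (simp add: row_fun_def)

lemma sort_index:
  assumes "inj_on a {..<k}" "\<And>s. s < k \<Longrightarrow> a s < m"
  obtains i \<sigma> where "i \<in> index_sets m k" "\<sigma> permutes {0..<k}" "\<And>s. s < k \<Longrightarrow> a s = pick i (\<sigma> s)"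
proof -
  define i where "i = a ` {..<k}"
  have card: "card i = k" and fin: "finite i"
    by (auto simp: i_def card_image assms(1))
  have bij: "bij_betw (pick i) {..<k} i"
    using pick_inj_on[of i] pick_image[OF fin] by (simp add: bij_betw_def card)
  define g where "g = the_inv_into {..<k} (pick i)"
  have g: "bij_betw g i {..<k}"
    unfolding g_def by (rule bij_betw_the_inv_into[OF bij])
  have "bij_betw a {..<k} i"
    using assms(1) by (simp add: i_def bij_betw_def)
  then have ga: "bij_betw (g \<circ> a) {..<k} {..<k}"
    by (rule bij_betw_trans) (rule g)
  define \<sigma> where "\<sigma> s = (if s < k then g (a s) else s)" for s
  have "bij_betw \<sigma> {..<k} {..<k}"
    using ga by (rule bij_betw_cong[THEN iffD1, rotated]) (auto simp: \<sigma>_def)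
  then have "\<sigma> permutes {..<k}"
    by (rule bij_imp_permutes) (auto simp: \<sigma>_def)
  moreover have "a s = pick i (\<sigma> s)" if "s < k" for s
    using that f_the_inv_into_f_bij_betw[OF bij, of "a s"] by (simp add: \<sigma>_def g_def i_def)
  moreover have "i \<in> index_sets m k"
    using card assms(2) by (auto simp: index_sets_def i_def)
  ultimately show thesis using that by (simp add: atLeast0LessThan)
qed

lemma gdet_not_inj_columns: "\<not> inj_on c {..<k} \<Longrightarrow> gdet k u c = 0"
  unfolding inj_on_def by (auto intro: gdet_equal_columns)

lemma gdet_not_inj_rows: "\<not> inj_on a {..<k} \<Longrightarrow> gdet k (\<lambda>i. U (a i)) c = 0"
  unfolding inj_on_def by (auto intro: gdet_equal_rows)

text \<open>Sorting the rows and the columns only changes the sign.\<close>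

lemma gdet_eq_minor:
  fixes M :: "'a::comm_ring_1 mat"
  assumes a: "\<And>s. s < k \<Longrightarrow> a s < dim_row M" and c: "\<And>s. s < k \<Longrightarrow> c s < dim_col M"
    and nz: "gdet k (\<lambda>s. row_fun M (a s)) c \<noteq> 0"
  obtains i j \<epsilon> where "i \<in> index_sets (dim_row M) k" "j \<in> index_sets (dim_col M) k"
    "gdet k (\<lambda>s. row_fun M (a s)) c = \<epsilon> * minor M i j"
proof -
  have "inj_on a {..<k}"
    using nz gdet_not_inj_rows[of a k "row_fun M"] by blast
  from sort_index[OF this a] obtain i \<sigma> where i: "i \<in> index_sets (dim_row M) k"
    "\<sigma> permutes {0..<k}" "\<And>s. s < k \<Longrightarrow> a s = pick i (\<sigma> s)" by blast
  have "inj_on c {..<k}"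
    using nz gdet_not_inj_columns by blast
  from sort_index[OF this c] obtain j \<tau> where j: "j \<in> index_sets (dim_col M) k"
    "\<tau> permutes {0..<k}" "\<And>s. s < k \<Longrightarrow> c s = pick j (\<tau> s)" by blast
  have "gdet k (\<lambda>s. row_fun M (a s)) c = gdet k ((\<lambda>s. row_fun M (pick i s)) \<circ> \<sigma>) c"
    by (rule gdet_cong) (simp add: i(3))
  also have "\<dots> = signof \<sigma> * gdet k (\<lambda>s. row_fun M (pick i s)) c"
    by (rule gdet_permute_rows[OF i(2)])
  also have "gdet k (\<lambda>s. row_fun M (pick i s)) c = gdet k (\<lambda>l t. row_fun M t (c l)) (pick i)"
    by (rule gdet_transpose)
  also have "\<dots> = gdet k ((\<lambda>l t. row_fun M t (pick j l)) \<circ> \<tau>) (pick i)"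
    by (rule gdet_cong) (simp add: j(3))
  also have "\<dots> = signof \<tau> * gdet k (\<lambda>l t. row_fun M t (pick j l)) (pick i)"
    by (rule gdet_permute_rows[OF j(2)])
  also have "gdet k (\<lambda>l t. row_fun M t (pick j l)) (pick i) = minor M i j"
    unfolding minor_eq_gdet[OF i(1) j(1)] by (rule gdet_transpose[symmetric])
  finally have "gdet k (\<lambda>s. row_fun M (a s)) c = (signof \<sigma> * signof \<tau>) * minor M i j"
    unfolding mult.assoc .
  with i(1) j(1) show thesis by (rule that)
qed

lemma is_ideal_minor_ideal: "is_ideal (minor_ideal k M)"
  unfolding minor_ideal_def by (rule genideal_class_ring_is_ideal)

lemma minor_in_minor_ideal:
  "i \<in> index_sets (dim_row M) k \<Longrightarrow> j \<in> index_sets (dim_col M) k \<Longrightarrow> minor M i j \<in> minor_ideal k M"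
  unfolding minor_ideal_def by (rule subsetD[OF genideal_class_ring_incl]) auto

text \<open>Repeated indices give zero and unsorted ones only a sign, so arbitrary tuples do not
  leave the ideal. With \<open>minor_ideal_subset\<close> this lets later arguments ignore sorted
  index sets.\<close>

lemma gdet_in_minor_ideal:
  assumes "\<And>s. s < k \<Longrightarrow> a s < dim_row M" "\<And>s. s < k \<Longrightarrow> c s < dim_col M"
  shows "gdet k (\<lambda>s. row_fun M (a s)) c \<in> minor_ideal k M"
proof (cases "gdet k (\<lambda>s. row_fun M (a s)) c = 0")
  case True
  then show ?thesis using ideal_zero[OF is_ideal_minor_ideal] by simp
next
  case False
  then obtain i j \<epsilon> where "i \<in> index_sets (dim_row M) k" "j \<in> index_sets (dim_col M) k"
    "gdet k (\<lambda>s. row_fun M (a s)) c = \<epsilon> * minor M i j"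
    using gdet_eq_minor[of k a M c] assms by blast
  then show ?thesis
    by (simp add: ideal_mult_left is_ideal_minor_ideal minor_in_minor_ideal)
qed

lemma minor_ideal_subset:
  assumes "is_ideal Q"
    and "\<And>a c. (\<And>s. s < k \<Longrightarrow> a s < dim_row M) \<Longrightarrow> (\<And>s. s < k \<Longrightarrow> c s < dim_col M) \<Longrightarrow>
      gdet k (\<lambda>s. row_fun M (a s)) c \<in> Q"
  shows "minor_ideal k M \<subseteq> Q"
  unfolding minor_ideal_def
proof (rule genideal_class_ring_subset[OF assms(1)], clarify)
  fix i j assume "i \<in> index_sets (dim_row M) k" "j \<in> index_sets (dim_col M) k"
  then show "minor M i j \<in> Q"
    by (simp add: minor_eq_gdet assms(2) pick_index_set(2))
qed

section \<open>Nonzero minors and the rank of a matrix\<close>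

abbreviation row_set :: "'a mat \<Rightarrow> (nat \<Rightarrow> 'a) set" where
  "row_set M \<equiv> row_fun M ` {..<dim_row M}"

lemma has_minor_row_set:
  "has_minor p (dim_col M) (row_set M) k \<longleftrightarrow>
     (\<exists>a c. (\<forall>s<k. a s < dim_row M) \<and> (\<forall>s<k. c s < dim_col M) \<and> gdet k (\<lambda>s. row_fun M (a s)) c \<notin> p)"
proof
  assume "has_minor p (dim_col M) (row_set M) k"
  then obtain u c where u: "\<forall>s<k. u s \<in> row_set M" "\<forall>s<k. c s < dim_col M" "gdet k u c \<notin> p"
    by (auto simp: has_minor_def)
  have "\<forall>s. \<exists>a. s < k \<longrightarrow> a < dim_row M \<and> u s = row_fun M a"
    using u(1) by blast
  then obtain a where a: "\<And>s. s < k \<Longrightarrow> a s < dim_row M \<and> u s = row_fun M (a s)" by metis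
  then have "gdet k u c = gdet k (\<lambda>s. row_fun M (a s)) c"
    by (intro gdet_cong) auto
  then show "\<exists>a c. (\<forall>s<k. a s < dim_row M) \<and> (\<forall>s<k. c s < dim_col M) \<and> gdet k (\<lambda>s. row_fun M (a s)) c \<notin> p"
    using a u by auto
next
  assume "\<exists>a c. (\<forall>s<k. a s < dim_row M) \<and> (\<forall>s<k. c s < dim_col M) \<and> gdet k (\<lambda>s. row_fun M (a s)) c \<notin> p"
  then obtain a c where "\<forall>s<k. a s < dim_row M" "\<forall>s<k. c s < dim_col M"
    "gdet k (\<lambda>s. row_fun M (a s)) c \<notin> p" by blast
  then show "has_minor p (dim_col M) (row_set M) k"
    unfolding has_minor_def by (intro exI[of _ "\<lambda>s. row_fun M (a s)"] exI[of _ c]) auto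
qed

lemma has_minor_row_set_minor:
  assumes p: "is_ideal p" and "has_minor p (dim_col M) (row_set M) k"
  obtains i j where "i \<in> index_sets (dim_row M) k" "j \<in> index_sets (dim_col M) k" "minor M i j \<notin> p"
proof -
  obtain a c where a: "\<forall>s<k. a s < dim_row M" "\<forall>s<k. c s < dim_col M" "gdet k (\<lambda>s. row_fun M (a s)) c \<notin> p"
    using assms(2) unfolding has_minor_row_set by blast
  then have "gdet k (\<lambda>s. row_fun M (a s)) c \<noteq> 0"
    using ideal_zero[OF p] by auto
  then obtain i j \<epsilon> where ij: "i \<in> index_sets (dim_row M) k" "j \<in> index_sets (dim_col M) k"
    "gdet k (\<lambda>s. row_fun M (a s)) c = \<epsilon> * minor M i j"
    using gdet_eq_minor[of k a M c] a by blast
  then have "minor M i j \<notin> p"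
    using a(3) ideal_mult_left[OF p] by auto
  with ij that show thesis by blast
qed

text \<open>Cramer's rule: expanding the minor of \<open>k + 1\<close> rows along its last row, which is left free,
  gives a linear form in that row.\<close>

lemma cramer_vector:
  fixes u :: "nat \<Rightarrow> nat \<Rightarrow> 'a::comm_ring_1"
  assumes c: "\<And>s. s < k \<Longrightarrow> c s < n" and l: "l < n" "l \<notin> c ` {..<k}"
  defines "h \<equiv> row_lin k u (c(k := l)) k"
  shows "(\<Sum>t<n. h t * v t) = gdet (Suc k) (u(k := v)) (c(k := l))"
    and "h l = gdet k u c"
    and "\<And>t. t \<noteq> l \<Longrightarrow> t \<notin> c ` {..<k} \<Longrightarrow> h t = 0"
proof -
  show "(\<Sum>t<n. h t * v t) = gdet (Suc k) (u(k := v)) (c(k := l))"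
    unfolding h_def by (rule gdet_row_lin[symmetric]) (use c l in auto)
  have "c j \<noteq> l" if "j < k" for j
    using l(2) that by auto
  then have "h l = (-1)^(k + k) * gdet k (u \<circ> insert_index k) (c(k := l) \<circ> insert_index k)"
    unfolding h_def row_lin_def by (simp add: sum.neutral)
  also have "\<dots> = gdet k (u \<circ> insert_index k) (c(k := l) \<circ> insert_index k)"
    by (simp add: mult_2[symmetric])
  also have "\<dots> = gdet k u c"
    by (rule gdet_cong) (auto simp: insert_index_def)
  finally show "h l = gdet k u c" .
  show "h t = 0" if "t \<noteq> l" "t \<notin> c ` {..<k}" for t
    unfolding h_def row_lin_def by (rule sum.neutral) (use that in \<open>auto simp: less_Suc_eq\<close>)
qed

text \<open>The rank counts a maximal independent set of columns. Were the largest nonzero minor on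
  these columns smaller, a Cramer vector would be a nontrivial relation between them.\<close>

lemma (in vec_space) has_minor_rank:
  assumes A: "A \<in> carrier_mat n nc"
  shows "has_minor {0} nc (row_set A) (rank A)"
proof -
  obtain S where S: "maximal S (\<lambda>T. T \<subseteq> set (cols A) \<and> lin_indpt T)"
    using maximal_exists_superset[of "set (cols A)" "\<lambda>T. T \<subseteq> set (cols A) \<and> lin_indpt T" "{}"]
    by (auto simp: finite_lin_indpt2)
  define R where "R = card S"
  have rank: "rank A = R"
    unfolding R_def by (rule rank_card_indpt[OF A S])
  have S': "S \<subseteq> set (cols A)" "lin_indpt S"
    using S by (auto simp: maximal_def)
  then have "finite S" using finite_subset by blast
  then obtain vs where vs: "set vs = S" "distinct vs" using finite_distinct_list by blast
  then have len: "length vs = R" by (simp add: R_def distinct_card[symmetric])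
  have "\<exists>c. c < nc \<and> vs ! s = col A c" if "s < R" for s
  proof -
    have "vs ! s \<in> set (cols A)" using S'(1) vs(1) len that nth_mem by blast
    then show ?thesis using A by (auto simp: cols_def)
  qed
  then obtain c where c: "\<And>s. s < R \<Longrightarrow> c s < nc \<and> vs ! s = col A (c s)" by metis
  define B where "B = mat_of_cols n vs"
  have Bc: "B \<in> carrier_mat n R" using mat_of_cols_carrier(1)[of n vs] by (simp add: B_def len)
  have "set vs \<subseteq> carrier_vec n" using S'(1) vs(1) A cols_dim[of A] by auto
  then have cols: "cols B = vs" by (simp add: B_def)
  have B_eq: "row_fun B i s = row_fun A i (c s)" if "i < n" "s < R" for i s
    using that c[OF that(2)] A by (simp add: B_def row_fun_def mat_of_cols_index len)
  have ex: "\<exists>k. has_minor {0} R (row_set B) k"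
    by (rule exI[of _ 0]) (simp add: has_minor_0)
  have bound: "k \<le> R" if hm: "has_minor {0} R (row_set B) k" for k
  proof -
    obtain u cc where "\<forall>i<k. u i \<in> row_set B" and cc: "\<forall>l<k. cc l < R" and "gdet k u cc \<notin> {0}"
      by (rule has_minorE[OF hm])
    then have "inj_on cc {..<k}"
      using gdet_not_inj_columns[of cc k u] by auto
    moreover have "cc ` {..<k} \<subseteq> {..<R}"
      using cc by auto
    ultimately show ?thesis using card_inj_on_le[of cc "{..<k}" "{..<R}"] by simp
  qed
  define k where "k = (GREATEST k. has_minor {0} R (row_set B) k)"
  have k: "has_minor {0} R (row_set B) k" "\<And>k'. has_minor {0} R (row_set B) k' \<Longrightarrow> k' \<le> k"
  proof -
    show "has_minor {0} R (row_set B) k"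
      unfolding k_def by (rule GreatestI_ex_nat[OF ex bound])
    show "k' \<le> k" if "has_minor {0} R (row_set B) k'" for k'
      unfolding k_def by (rule Greatest_le_nat[where b = R]) (fact that, rule bound)
  qed
  have "k = R"
  proof (rule ccontr)
    assume "k \<noteq> R"
    with bound[OF k(1)] have "k < R" by simp
    obtain u cc where u: "\<forall>i<k. u i \<in> row_set B" "\<forall>l<k. cc l < R" and "gdet k u cc \<notin> {0}"
      by (rule has_minorE[OF k(1)])
    then have u0: "gdet k u cc \<noteq> 0" by simp
    have "\<not> {..<R} \<subseteq> cc ` {..<k}"
    proof
      assume "{..<R} \<subseteq> cc ` {..<k}"
      then have "R \<le> card (cc ` {..<k})" using card_mono[of "cc ` {..<k}" "{..<R}"] by simp
      also have "\<dots> \<le> k" using card_image_le[of "{..<k}" cc] by simp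
      finally show False using \<open>k < R\<close> by simp
    qed
    then obtain l where l: "l < R" "l \<notin> cc ` {..<k}" by auto
    \<comment> \<open>The entry of \<open>h\<close> at the missed column \<open>l\<close> is the
      nonzero minor, while its product with a row is a minor of size \<open>k + 1\<close> and
      vanishes by maximality.\<close>
    define h where "h = row_lin k u (cc(k := l)) k"
    have h: "(\<Sum>t<R. h t * v t) = gdet (Suc k) (u(k := v)) (cc(k := l))" "h l \<noteq> 0" for v
      unfolding h_def using cramer_vector(1,2)[of k cc R l u] u u0 l by auto
    have "(\<Sum>t<R. h t * row_fun B i t) = 0" if "i < n" for i
    proof (rule ccontr)
      assume "(\<Sum>t<R. h t * row_fun B i t) \<noteq> 0"
      moreover have "row_fun B i \<in> row_set B" using that Bc by auto
      ultimately have "has_minor {0} R (row_set B) (Suc k)"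
        unfolding h has_minor_def using u l
        by (intro exI[of _ "u(k := row_fun B i)"] exI[of _ "cc(k := l)"]) (simp add: less_Suc_eq)
      from k(2)[OF this] show False by simp
    qed
    then have "B *\<^sub>v vec R h = 0\<^sub>v n"
      using Bc by (auto intro!: eq_vecI simp: scalar_prod_def row_fun_def atLeast0LessThan mult.commute)
    moreover have "vec R h \<noteq> 0\<^sub>v R"
    proof
      assume "vec R h = 0\<^sub>v R"
      then have "vec R h $ l = 0\<^sub>v R $ l" by simp
      with l h(2) show False by simp
    qed
    ultimately have "lin_dep (set (cols B))"
      using Bc by (intro lin_depI[of B R "vec R h"]) (auto simp: cols vs)
    then show False using S'(2) by (simp add: cols vs)
  qed
  then have kR: "has_minor {0} R (row_set B) R" using k(1) by simp
  obtain u cc where u: "\<forall>i<R. u i \<in> row_set B" "\<forall>l<R. cc l < R" "gdet R u cc \<notin> {0}"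
    by (rule has_minorE[OF kR])
  have "\<forall>i. \<exists>a. i < R \<longrightarrow> a < n \<and> u i = row_fun B a"
    using u(1) Bc unfolding image_iff by auto
  then obtain a where a: "\<And>i. i < R \<Longrightarrow> a i < n \<and> u i = row_fun B (a i)" by metis
  have "gdet R u cc = gdet R (\<lambda>i. row_fun A (a i)) (c \<circ> cc)"
    by (rule gdet_cong) (use a u B_eq in auto)
  moreover have "\<forall>i<R. row_fun A (a i) \<in> row_set A" using a A by auto
  moreover have "\<forall>l<R. (c \<circ> cc) l < nc" using u(2) c by simp
  ultimately show ?thesis
    unfolding rank has_minor_def using u(3)
    by (intro exI[of _ "\<lambda>i. row_fun A (a i)"] exI[of _ "c \<circ> cc"]) simp
qed

text \<open>The embedding into the fraction field is injective and commutes with determinants. One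
  direction is then \<open>has_minor_rank\<close>, the other the lower bound of the rank by a
  nonzero minor.\<close>

lemma le_frac_rank_iff:
  fixes M :: "'a::idom mat"
  shows "k \<le> frac_rank M \<longleftrightarrow> has_minor {0} (dim_col M) (row_set M) k"
proof -
  let ?h = "\<lambda>a::'a. Fract a 1"
  interpret hom: inj_comm_ring_hom ?h
    by unfold_locales (auto simp: Zero_fract_def One_fract_def eq_fract)
  define A where "A = map_mat ?h M"
  have A: "A \<in> carrier_mat (dim_row M) (dim_col M)" by (simp add: A_def)
  have gdet: "gdet k (\<lambda>s. row_fun A (a s)) c = ?h (gdet k (\<lambda>s. row_fun M (a s)) c)"
    if "\<forall>s<k. a s < dim_row M" "\<forall>s<k. c s < dim_col M" for a c k
  proof -
    have "mat k k (\<lambda>(i, l). row_fun A (a i) (c l)) = map_mat ?h (mat k k (\<lambda>(i, l). row_fun M (a i) (c l)))"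
      using that by (auto intro!: eq_matI simp: A_def row_fun_def)
    then show ?thesis unfolding gdet_def by simp
  qed
  have eq: "has_minor {0} (dim_col A) (row_set A) k \<longleftrightarrow> has_minor {0} (dim_col M) (row_set M) k" for k
  proof -
    have "dim_row A = dim_row M" "dim_col A = dim_col M" using A by auto
    then show ?thesis
      unfolding has_minor_row_set
      by (intro ex_cong1 conj_cong refl) (simp_all add: gdet)
  qed
  have rank: "frac_rank M = vec_space.rank (dim_row M) A"
    by (simp add: frac_rank_def A_def)
  show ?thesis
  proof
    assume "k \<le> frac_rank M"
    moreover have "has_minor {0} (dim_col A) (row_set A) (frac_rank M)"
      using vec_space.has_minor_rank[OF A] A unfolding rank by simp
    ultimately show "has_minor {0} (dim_col M) (row_set M) k"
      unfolding eq using has_minor_le[OF is_prime_ideal[OF is_prime_zero]] by blast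
  next
    assume "has_minor {0} (dim_col M) (row_set M) k"
    then have "has_minor {0} (dim_col A) (row_set A) k" by (simp add: eq)
    from has_minor_row_set_minor[OF is_prime_ideal[OF is_prime_zero] this] obtain i j where
      ij: "i \<in> index_sets (dim_row A) k" "j \<in> index_sets (dim_col A) k" "minor A i j \<noteq> 0" by auto
    then have "card {b. b < dim_col A \<and> b \<in> j} \<le> vec_space.rank (dim_row M) A"
      using vec_space.rank_gt_minor[OF A, of i j] A by (auto simp: minor_def)
    then show "k \<le> frac_rank M"
      unfolding rank index_set_card[OF ij(2)] .
  qed
qed

section \<open>Polynomials and their gradients\<close>

lemma mpoly_induct [case_names single add]:
  fixes g :: "'k::comm_ring_1 mpoly"
  assumes "\<And>t c. P (Poly_Mapping.single t c)" "\<And>g h. P g \<Longrightarrow> P h \<Longrightarrow> P (g + h)"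
  shows "P g"
proof -
  have eq: "g = (\<Sum>t\<in>Poly_Mapping.keys g. Poly_Mapping.single t (Poly_Mapping.lookup g t))"
    by (rule poly_mapping_eqI) (auto simp: lookup_sum lookup_single when_def in_keys_iff sum.delta)
  have "P (\<Sum>t\<in>T. Poly_Mapping.single t (Poly_Mapping.lookup g t))" for T
    using assms(1)[of 0 0] by (induction T rule: infinite_finite_induct) (auto intro: assms)
  then show ?thesis by (subst eq)
qed

text \<open>Any set \<open>V\<close> of variables is allowed, so that the towers
  \<open>J \<union> {..<i}\<close> give subrings of a single type.\<close>

definition poly_vars :: "nat set \<Rightarrow> 'k::zero mpoly set" where
  "poly_vars V = {g. \<forall>t\<in>Poly_Mapping.keys g. Poly_Mapping.keys t \<subseteq> V}"

lemma poly_varsD: "g \<in> poly_vars V \<Longrightarrow> t \<in> Poly_Mapping.keys g \<Longrightarrow> i \<in> Poly_Mapping.keys t \<Longrightarrow> i \<in> V"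
  by (auto simp: poly_vars_def)

lemma carrier_poly_ring: "carrier (poly_ring n) = poly_vars {..<n}"
  by (simp add: poly_ring_def poly_vars_def)

lemma poly_vars_mono: "V \<subseteq> W \<Longrightarrow> g \<in> poly_vars V \<Longrightarrow> g \<in> poly_vars W"
  by (auto simp: poly_vars_def)

lemma poly_vars_0 [simp]: "0 \<in> poly_vars V"
  by (simp add: poly_vars_def)

lemma poly_vars_single:
  "Poly_Mapping.keys t \<subseteq> V \<Longrightarrow> Poly_Mapping.single t c \<in> poly_vars V"
  by (auto simp: poly_vars_def)

lemma poly_vars_pconst [simp]: "pconst c \<in> poly_vars V"
  unfolding pconst_def by (rule poly_vars_single) simp

lemma poly_vars_1 [simp]: "(1 :: 'k::comm_ring_1 mpoly) \<in> poly_vars V"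
  by (simp add: poly_vars_def)

lemma poly_vars_pvar: "i \<in> V \<Longrightarrow> pvar i \<in> poly_vars V"
  unfolding pvar_def by (rule poly_vars_single) auto

lemma poly_vars_add: "g \<in> poly_vars V \<Longrightarrow> h \<in> poly_vars V \<Longrightarrow> g + h \<in> poly_vars V"
  using keys_add[of g h] by (auto simp: poly_vars_def)

lemma poly_vars_uminus: "g \<in> poly_vars V \<Longrightarrow> - g \<in> poly_vars V" for g :: "'k::comm_ring_1 mpoly"
  by (auto simp: poly_vars_def in_keys_iff)

lemma poly_vars_diff: "g \<in> poly_vars V \<Longrightarrow> h \<in> poly_vars V \<Longrightarrow> g - h \<in> poly_vars V"
  for g :: "'k::comm_ring_1 mpoly"
  using poly_vars_add[of g V "- h"] poly_vars_uminus[of h V] by simp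

lemma poly_vars_mult: "g \<in> poly_vars V \<Longrightarrow> h \<in> poly_vars V \<Longrightarrow> g * h \<in> poly_vars V"
proof -
  assume g: "g \<in> poly_vars V" and h: "h \<in> poly_vars V"
  have "Poly_Mapping.keys t \<subseteq> V" if t: "t \<in> Poly_Mapping.keys (g * h)" for t
  proof -
    obtain a b where ab: "t = a + b" "a \<in> Poly_Mapping.keys g" "b \<in> Poly_Mapping.keys h"
      using t keys_mult[of g h] by auto
    then have "Poly_Mapping.keys t \<subseteq> Poly_Mapping.keys a \<union> Poly_Mapping.keys b"
      by (simp add: keys_add)
    then show ?thesis using ab poly_varsD[OF g] poly_varsD[OF h] by blast
  qed
  then show ?thesis by (simp add: poly_vars_def)
qed

lemma poly_vars_power: "g \<in> poly_vars V \<Longrightarrow> g ^ k \<in> poly_vars V" for g :: "'k::comm_ring_1 mpoly"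
  by (induction k) (auto intro: poly_vars_mult)

lemma poly_vars_sum: "(\<And>i. i \<in> X \<Longrightarrow> g i \<in> poly_vars V) \<Longrightarrow> sum g X \<in> poly_vars V"
  for g :: "'b \<Rightarrow> 'k::comm_ring_1 mpoly"
  by (induction X rule: infinite_finite_induct) (auto intro: poly_vars_add)

lemma pvar_power: "pvar i ^ k = Poly_Mapping.single (Poly_Mapping.single i k) (1 :: 'k::comm_ring_1)"
  by (induction k) (auto simp: pvar_def mult_single single_add[symmetric])

lemma poly_vars_poly:
  fixes P :: "'k::comm_ring_1 mpoly poly"
  assumes "\<And>e. coeff P e \<in> poly_vars V" "h \<in> poly_vars V"
  shows "poly P h \<in> poly_vars V"
  unfolding poly_altdef by (intro poly_vars_sum poly_vars_mult poly_vars_power assms)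

text \<open>Reading a polynomial as univariate in the variable \<open>i\<close> makes degrees and
  leading coefficients available for relations.\<close>

lemma poly_vars_insert:
  fixes g :: "'k::comm_ring_1 mpoly"
  assumes "g \<in> poly_vars (insert i V)"
  obtains P where "\<And>e. coeff P e \<in> poly_vars V" "g = poly P (pvar i)"
proof
  let ?c = "\<lambda>t. Poly_Mapping.single (t - Poly_Mapping.single i (Poly_Mapping.lookup t i)) (Poly_Mapping.lookup g t)"
  define P where "P = (\<Sum>t\<in>Poly_Mapping.keys g. Polynomial.monom (?c t) (Poly_Mapping.lookup t i))"
  have "?c t \<in> poly_vars V" if "t \<in> Poly_Mapping.keys g" for t
  proof (rule poly_vars_single, rule subsetI)
    fix l assume "l \<in> Poly_Mapping.keys (t - Poly_Mapping.single i (Poly_Mapping.lookup t i))"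
    then have "l \<noteq> i" "l \<in> Poly_Mapping.keys t"
      by (auto simp: in_keys_iff lookup_minus lookup_single when_def split: if_splits)
    then show "l \<in> V" using poly_varsD[OF assms that] by blast
  qed
  then show "coeff P e \<in> poly_vars V" for e
    unfolding P_def coeff_sum by (intro poly_vars_sum) auto
  have "(t - Poly_Mapping.single i (Poly_Mapping.lookup t i)) + Poly_Mapping.single i (Poly_Mapping.lookup t i) = t" for t :: "nat \<Rightarrow>\<^sub>0 nat"
    by (rule poly_mapping_eqI) (auto simp: lookup_add lookup_minus lookup_single when_def)
  then have "poly P (pvar i) = (\<Sum>t\<in>Poly_Mapping.keys g. Poly_Mapping.single t (Poly_Mapping.lookup g t))"
    by (simp add: P_def poly_sum poly_monom pvar_power mult_single)
  also have "\<dots> = g"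
    by (rule poly_mapping_eqI) (auto simp: lookup_sum lookup_single when_def in_keys_iff sum.delta)
  finally show "g = poly P (pvar i)" ..
qed

section \<open>Partial derivatives\<close>

lemma pdiff_superset:
  assumes "finite T" "Poly_Mapping.keys g \<subseteq> T"
  shows "pdiff j g = (\<Sum>t\<in>T. Poly_Mapping.single (t - Poly_Mapping.single j 1)
       (of_nat (Poly_Mapping.lookup t j) * Poly_Mapping.lookup g t))"
  unfolding pdiff_def by (rule sum.mono_neutral_left) (use assms in \<open>auto simp: in_keys_iff\<close>)

lemma pdiff_add: "pdiff j (g + h) = pdiff j g + pdiff j h"
proof -
  let ?T = "Poly_Mapping.keys g \<union> Poly_Mapping.keys h"
  have "pdiff j (g + h) = (\<Sum>t\<in>?T. Poly_Mapping.single (t - Poly_Mapping.single j 1)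
       (of_nat (Poly_Mapping.lookup t j) * Poly_Mapping.lookup (g + h) t))"
    by (rule pdiff_superset) (simp_all add: keys_add)
  then show ?thesis
    by (simp add: pdiff_superset[of ?T g] pdiff_superset[of ?T h] lookup_add distrib_left single_add
        sum.distrib)
qed

lemma pdiff_single: "pdiff j (Poly_Mapping.single t c) =
    Poly_Mapping.single (t - Poly_Mapping.single j 1) (of_nat (Poly_Mapping.lookup t j) * c)"
  by (subst pdiff_superset[of "{t}"]) auto

lemma pdiff_mult: "pdiff j (g * h) = pdiff j g * h + g * pdiff j h"
  for g h :: "'k::comm_ring_1 mpoly"
proof (induction g rule: mpoly_induct)
  case (single s c)
  show ?case
  proof (induction h rule: mpoly_induct)
    case (single t d)
    let ?e = "Poly_Mapping.single j (1::nat)"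
    \<comment> \<open>Subtraction of exponents is truncated, so these identities need a positive
      exponent; where the exponent is 0, the coefficient of the derivative vanishes.\<close>
    have 1: "s - ?e + t = s + t - ?e" if "Poly_Mapping.lookup s j > 0"
      using that by (intro poly_mapping_eqI) (auto simp: lookup_add lookup_minus lookup_single when_def)
    have 2: "s + (t - ?e) = s + t - ?e" if "Poly_Mapping.lookup t j > 0"
      using that by (intro poly_mapping_eqI) (auto simp: lookup_add lookup_minus lookup_single when_def)
    show ?case
      using 1 2
      by (cases "Poly_Mapping.lookup s j = 0"; cases "Poly_Mapping.lookup t j = 0")
        (auto simp: pdiff_single mult_single lookup_add algebra_simps simp flip: single_add)
  qed (simp add: pdiff_add algebra_simps)
qed (simp add: pdiff_add algebra_simps)

lemma pdiff_pconst [simp]: "pdiff j (pconst c) = 0"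
  by (simp add: pconst_def pdiff_single)

lemma pdiff_0 [simp]: "pdiff j 0 = 0"
  by (simp add: pdiff_def)

lemma pdiff_1 [simp]: "pdiff j (1 :: 'k::comm_ring_1 mpoly) = 0"
  using pdiff_pconst[of j "1::'k"] by (simp add: pconst_def)

lemma pdiff_pvar: "pdiff j (pvar i :: 'k::comm_ring_1 mpoly) = (if i = j then 1 else 0)"
  by (auto simp: pvar_def pdiff_single lookup_single when_def simp flip: single_diff)

lemma pdiff_eq_0: "g \<in> poly_vars V \<Longrightarrow> j \<notin> V \<Longrightarrow> pdiff j g = 0"
proof -
  assume "g \<in> poly_vars V" "j \<notin> V"
  then have "Poly_Mapping.lookup t j = 0" if "t \<in> Poly_Mapping.keys g" for t
    using poly_varsD[of g V t j] that by (auto simp: in_keys_iff)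
  then show ?thesis
    unfolding pdiff_def by (intro sum.neutral) simp
qed

lemma poly_vars_pdiff: "g \<in> poly_vars V \<Longrightarrow> pdiff j g \<in> poly_vars V" for g :: "'k::comm_ring_1 mpoly"
  unfolding pdiff_def
proof (intro poly_vars_sum poly_vars_single subsetI)
  fix t l assume g: "g \<in> poly_vars V" "t \<in> Poly_Mapping.keys g"
    and "l \<in> Poly_Mapping.keys (t - Poly_Mapping.single j 1)"
  then have "l \<in> Poly_Mapping.keys t" by (auto simp: in_keys_iff lookup_minus)
  with g show "l \<in> V" by (rule poly_varsD)
qed

lemma pdiff_poly_pvar:
  fixes P :: "'k::idom mpoly poly"
  assumes "\<And>e. coeff P e \<in> poly_vars V" "i \<notin> V"
  shows "pdiff i (poly P (pvar i)) = poly (pderiv P) (pvar i)"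
  using assms(1)
proof (induction P)
  case (pCons a P)
  have "a \<in> poly_vars V" using pCons.prems[of 0] by simp
  moreover have "coeff P e \<in> poly_vars V" for e using pCons.prems[of "Suc e"] by simp
  ultimately show ?case
    using pCons.IH pdiff_eq_0[OF _ assms(2)]
    by (simp add: pdiff_add pdiff_mult pdiff_pvar pderiv_pCons)
qed simp

text \<open>\<open>\<kappa>\<close> is the embedding of the scalars, later instantiated by
  \<open>\<lambda>c. scale c 1\<close>.\<close>

locale evaluation =
  fixes \<kappa> :: "'k::field_char_0 \<Rightarrow> 'a::comm_ring_1"
  assumes \<kappa>_add: "\<kappa> (a + b) = \<kappa> a + \<kappa> b"
    and \<kappa>_mult: "\<kappa> (a * b) = \<kappa> a * \<kappa> b"
    and \<kappa>_1: "\<kappa> 1 = 1"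
begin

lemma \<kappa>_0: "\<kappa> 0 = 0"
  using \<kappa>_add[of 0 0] by simp

lemma \<kappa>_of_nat: "\<kappa> (of_nat k) = of_nat k"
  by (induction k) (auto simp: \<kappa>_0 \<kappa>_1 \<kappa>_add)

definition mon :: "(nat \<Rightarrow> 'a) \<Rightarrow> (nat \<Rightarrow>\<^sub>0 nat) \<Rightarrow> 'a" where
  "mon x t = (\<Prod>i\<in>Poly_Mapping.keys t. x i ^ Poly_Mapping.lookup t i)"

lemma mon_add: "mon x (s + t) = mon x s * mon x t"
proof -
  have *: "mon x t = (\<Prod>i\<in>T. x i ^ Poly_Mapping.lookup t i)" if "finite T" "Poly_Mapping.keys t \<subseteq> T" for t T
    unfolding mon_def by (rule prod.mono_neutral_left) (use that in \<open>auto simp: in_keys_iff\<close>)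
  let ?T = "Poly_Mapping.keys s \<union> Poly_Mapping.keys t"
  have "mon x (s + t) = (\<Prod>i\<in>?T. x i ^ Poly_Mapping.lookup (s + t) i)"
    by (rule *) (simp_all add: keys_add)
  then show ?thesis
    by (simp add: *[of ?T s] *[of ?T t] lookup_add power_add prod.distrib)
qed

definition ev :: "(nat \<Rightarrow> 'a) \<Rightarrow> 'k mpoly \<Rightarrow> 'a" where
  "ev x g = (\<Sum>t\<in>Poly_Mapping.keys g. \<kappa> (Poly_Mapping.lookup g t) * mon x t)"

lemma ev_superset:
  "finite T \<Longrightarrow> Poly_Mapping.keys g \<subseteq> T \<Longrightarrow> ev x g = (\<Sum>t\<in>T. \<kappa> (Poly_Mapping.lookup g t) * mon x t)"
  unfolding ev_def by (rule sum.mono_neutral_left) (auto simp: in_keys_iff \<kappa>_0)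

lemma ev_add: "ev x (g + h) = ev x g + ev x h"
proof -
  let ?T = "Poly_Mapping.keys g \<union> Poly_Mapping.keys h"
  have "ev x (g + h) = (\<Sum>t\<in>?T. \<kappa> (Poly_Mapping.lookup (g + h) t) * mon x t)"
    by (rule ev_superset) (simp_all add: keys_add)
  then show ?thesis
    by (simp add: ev_superset[of ?T g] ev_superset[of ?T h] lookup_add \<kappa>_add distrib_right sum.distrib)
qed

lemma ev_single: "ev x (Poly_Mapping.single t c) = \<kappa> c * mon x t"
  by (subst ev_superset[of "{t}"]) auto

lemma ev_mult: "ev x (g * h) = ev x g * ev x h"
proof (induction g rule: mpoly_induct)
  case (single s c)
  show ?case
    by (induction h rule: mpoly_induct)
      (auto simp: mult_single ev_single \<kappa>_mult mon_add ev_add algebra_simps)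
qed (simp add: ev_add algebra_simps)

lemma ev_pconst [simp]: "ev x (pconst c) = \<kappa> c"
  by (simp add: pconst_def ev_single mon_def)

lemma ev_0 [simp]: "ev x 0 = 0"
  by (simp add: ev_def)

lemma ev_1 [simp]: "ev x 1 = 1"
  using ev_pconst[of x 1] by (simp add: pconst_def \<kappa>_1)

lemma ev_pvar [simp]: "ev x (pvar i) = x i"
  by (simp add: pvar_def ev_single mon_def \<kappa>_1)

lemma ev_uminus: "ev x (- g) = - ev x g"
  using ev_add[of x g "- g"] by (simp add: eq_neg_iff_add_eq_0 add.commute)

lemma ev_diff: "ev x (g - h) = ev x g - ev x h"
  using ev_add[of x g "- h"] by (simp add: ev_uminus)

lemma ev_power: "ev x (g ^ k) = ev x g ^ k"
  by (induction k) (auto simp: ev_mult)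

lemma ev_of_nat: "ev x (of_nat k) = of_nat k"
  by (induction k) (auto simp: ev_add)

lemma ev_cong:
  assumes "g \<in> poly_vars V" "\<And>i. i \<in> V \<Longrightarrow> x i = y i"
  shows "ev x g = ev y g"
  unfolding ev_def mon_def
proof (intro sum.cong refl arg_cong2[of _ _ _ _ "(*)"] prod.cong)
  fix t i assume "t \<in> Poly_Mapping.keys g" "i \<in> Poly_Mapping.keys t"
  then have "i \<in> V" by (rule poly_varsD[OF assms(1)])
  then show "x i ^ Poly_Mapping.lookup t i = y i ^ Poly_Mapping.lookup t i" by (simp add: assms(2))
qed

definition grad :: "(nat \<Rightarrow> 'a) \<Rightarrow> 'k mpoly \<Rightarrow> nat \<Rightarrow> 'a" where
  "grad x g = (\<lambda>j. ev x (pdiff j g))"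

lemma grad_add: "grad x (g + h) j = grad x g j + grad x h j"
  and grad_mult: "grad x (g * h) j = ev x g * grad x h j + ev x h * grad x g j"
  by (auto simp: grad_def pdiff_add pdiff_mult ev_add ev_mult)

end

section \<open>Transcendence bases modulo a prime ideal\<close>

lemma top_coeff_split:
  fixes P :: "'a::comm_ring_1 poly"
  assumes "\<And>e. Suc E \<le> e \<Longrightarrow> coeff P e = 0"
  shows "E \<le> e \<Longrightarrow> coeff (P - Polynomial.monom (coeff P E) E) e = 0"
  using assms[of e] by (cases "e = E") auto

lemma poly_vars_of_nat: "(of_nat k :: 'k::comm_ring_1 mpoly) \<in> poly_vars V"
  by (induction k) (auto intro: poly_vars_add)

context evaluation
begin

text \<open>Algebraic independence of the variables \<open>J\<close> modulo \<open>p\<close>, and algebraicity of \<open>x\<^sub>i\<close> over the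
  variables \<open>V\<close> modulo \<open>p\<close>.\<close>

definition free :: "'a set \<Rightarrow> (nat \<Rightarrow> 'a) \<Rightarrow> nat set \<Rightarrow> bool" where
  "free p x J \<longleftrightarrow> (\<forall>g\<in>poly_vars J. ev x g \<in> p \<longrightarrow> g = 0)"

definition alg_poly :: "'a set \<Rightarrow> (nat \<Rightarrow> 'a) \<Rightarrow> nat set \<Rightarrow> nat \<Rightarrow> 'k mpoly poly \<Rightarrow> bool" where
  "alg_poly p x V i P \<longleftrightarrow> (\<forall>e. coeff P e \<in> poly_vars V) \<and> ev x (lead_coeff P) \<notin> p \<and>
     ev x (poly P (pvar i)) \<in> p"

text \<open>Only algebraicity in the tower is required, which is easier to transfer than algebraicity
  over \<open>J\<close> itself.\<close>

definition tr_basis :: "nat \<Rightarrow> 'a set \<Rightarrow> (nat \<Rightarrow> 'a) \<Rightarrow> nat set \<Rightarrow> bool" where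
  "tr_basis n p x J \<longleftrightarrow> J \<subseteq> {..<n} \<and> free p x J \<and>
     (\<forall>i<n. i \<notin> J \<longrightarrow> (\<exists>P. alg_poly p x (J \<union> {..<i}) i P))"

text \<open>Modulo \<open>p\<close> these vectors are the linear relations between the Kaehler
  differentials of the coordinates.\<close>

definition grads :: "nat \<Rightarrow> 'a set \<Rightarrow> (nat \<Rightarrow> 'a) \<Rightarrow> (nat \<Rightarrow> 'a) set" where
  "grads n p x = {grad x g | g. g \<in> poly_vars {..<n} \<and> ev x g \<in> p}"

lemma ev_poly_monom: "ev x (poly (Polynomial.monom c e) (pvar i)) = ev x c * x i ^ e"
  by (simp add: poly_monom ev_mult ev_power)

text \<open>A top coefficient whose value lies in \<open>p\<close> can be cut off, as the value of
  the polynomial stays in \<open>p\<close>. Some coefficient has a value outside \<open>p\<close>,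
  so this stops at a valid leading coefficient.\<close>

lemma alg_poly_truncate:
  assumes p: "is_prime p" and "\<And>e. coeff P e \<in> poly_vars V" "ev x (poly P (pvar i)) \<in> p"
    "ev x (coeff P e) \<notin> p"
  shows "\<exists>P'. alg_poly p x V i P'"
proof -
  have "\<exists>P'. alg_poly p x V i P'"
    if "\<And>e. E \<le> e \<Longrightarrow> coeff P e = 0" "\<And>e. coeff P e \<in> poly_vars V"
      "ev x (poly P (pvar i)) \<in> p" "ev x (coeff P e) \<notin> p" for E P e
    using that
  proof (induction E arbitrary: P)
    case 0
    then have "coeff P e = 0" by simp
    then show ?case using 0(4) prime_zero[OF p] by simp
  next
    case (Suc E)
    show ?case
    proof (cases "ev x (coeff P E) \<in> p")
      case False
      then have "coeff P E \<noteq> 0" using prime_zero[OF p] by auto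
      then have "degree P = E"
        using Suc.prems(1) by (intro antisym degree_le le_degree) (auto simp: Suc_le_eq)
      then show ?thesis
        using Suc.prems False by (auto simp: alg_poly_def)
    next
      case True
      let ?P = "P - Polynomial.monom (coeff P E) E"
      have "e \<noteq> E" using Suc.prems(4) True by auto
      show ?thesis
      proof (rule Suc.IH[of ?P])
        show "coeff ?P e = 0" if "E \<le> e" for e
          by (rule top_coeff_split) (use Suc.prems(1) that in auto)
        show "coeff ?P e \<in> poly_vars V" for e
          using Suc.prems(2) by (auto intro: poly_vars_diff)
        show "ev x (poly ?P (pvar i)) \<in> p"
          using Suc.prems(3) True is_prime_ideal[OF p]
          by (auto simp: ev_diff ev_poly_monom intro: ideal_diff ideal_mult_right)
        show "ev x (coeff ?P e) \<notin> p"
          using Suc.prems(4) \<open>e \<noteq> E\<close> by simp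
      qed
    qed
  qed
  from this[of "Suc (degree P)" P e] show ?thesis
    using assms by (auto simp: coeff_eq_0 Suc_le_eq)
qed

text \<open>A constant relation would equal its leading coefficient, whose value is outside
  \<open>p\<close>.\<close>

lemma alg_poly_degree: "alg_poly p x V i P \<Longrightarrow> degree P > 0"
  unfolding alg_poly_def by (metis degree_eq_zeroE gr0I lead_coeff_pCons(2) poly_pCons poly_0
      mult_zero_right add_0_right lead_coeff_pCons(1) pCons_0_0 coeff_pCons_0 degree_pCons_0)

lemma alg_poly_mono: "alg_poly p x V i P \<Longrightarrow> V \<subseteq> W \<Longrightarrow> alg_poly p x W i P"
  unfolding alg_poly_def using poly_vars_mono by blast

text \<open>Characteristic zero enters here: a positive integer is invertible in the field, hence
  its image is a unit.\<close>

lemma of_nat_notin_prime: "is_prime (p :: 'a set) \<Longrightarrow> of_nat (Suc k) \<notin> p"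
proof
  assume p: "is_prime p" and "of_nat (Suc k) \<in> p"
  then have "\<kappa> (inverse (of_nat (Suc k))) * \<kappa> (of_nat (Suc k)) \<in> p"
    by (simp only: \<kappa>_of_nat ideal_mult_left[OF is_prime_ideal])
  then show False
    using prime_one[OF p] by (simp add: \<kappa>_mult[symmetric] \<kappa>_1 del: of_nat_Suc)
qed

text \<open>There are finitely many sets of variables, so a maximal free one above \<open>J\<close>
  exists; maximality supplies the relations.\<close>

lemma tr_basis_extend:
  assumes p: "is_prime p" and J: "free p x J" "J \<subseteq> {..<n}"
  obtains J' where "J \<subseteq> J'" "tr_basis n p x J'"
proof -
  let ?A = "{J'. J' \<subseteq> {..<n} \<and> free p x J'}"
  have "finite ?A" by (rule finite_subset[of _ "Pow {..<n}"]) auto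
  moreover have "J \<in> ?A" using J by simp
  ultimately obtain J' where max: "J' \<in> ?A" "J \<subseteq> J'" "\<forall>b\<in>?A. J' \<subseteq> b \<longrightarrow> J' = b"
    by (metis (no_types, lifting) finite_has_maximal2)
  then have J': "J \<subseteq> J'" "J' \<subseteq> {..<n}" "free p x J'" by simp_all
  have "\<exists>P. alg_poly p x (J' \<union> {..<i}) i P" if i: "i < n" "i \<notin> J'" for i
  proof -
    have "\<not> free p x (insert i J')"
    proof
      assume "free p x (insert i J')"
      with i J'(2) have "insert i J' \<in> ?A" by simp
      with max(3) have "J' = insert i J'" by blast
      with i show False by blast
    qed
    then obtain g where g: "g \<in> poly_vars (insert i J')" "ev x g \<in> p" "g \<noteq> 0"
      by (auto simp: free_def)
    obtain P where P: "\<And>e. coeff P e \<in> poly_vars J'" "g = poly P (pvar i)"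
      using poly_vars_insert[OF g(1)] by metis
    \<comment> \<open>The leading coefficient is a nonzero polynomial in free variables, so its
      value avoids \<open>p\<close>.\<close>
    have "P \<noteq> 0" using P g by auto
    then have "lead_coeff P \<noteq> 0" by simp
    then have "ev x (lead_coeff P) \<notin> p"
      using J'(3) P(1) by (auto simp: free_def)
    then obtain P' where "alg_poly p x J' i P'"
      using alg_poly_truncate[OF p P(1)] g(2) P(2) by blast
    then show ?thesis using alg_poly_mono by blast
  qed
  then show thesis
    using that[of J'] J' by (simp add: tr_basis_def)
qed

text \<open>In characteristic zero a derivative of a relation of minimal degree does not vanish.\<close>

lemma tr_basis_relations:
  assumes p: "is_prime p" and J: "tr_basis n p x J"
  obtains G where "\<And>i. i < n \<Longrightarrow> i \<notin> J \<Longrightarrow> alg_poly p x (J \<union> {..<i}) i (G i)"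
    "\<And>i P. i < n \<Longrightarrow> i \<notin> J \<Longrightarrow> alg_poly p x (J \<union> {..<i}) i P \<Longrightarrow> degree (G i) \<le> degree P"
    "\<And>i. i < n \<Longrightarrow> i \<notin> J \<Longrightarrow> grad x (poly (G i) (pvar i)) i \<notin> p"
proof -
  let ?A = "\<lambda>i P. alg_poly p x (J \<union> {..<i}) i P"
  define G where "G i = (ARG_MIN degree P. ?A i P)" for i
  have G: "?A i (G i)" "\<And>P. ?A i P \<Longrightarrow> degree (G i) \<le> degree P" if i: "i < n" "i \<notin> J" for i
  proof -
    obtain P where P: "?A i P" using J i unfolding tr_basis_def by blast
    show "?A i (G i)" unfolding G_def by (rule arg_min_natI[of "?A i", OF P])
    show "degree (G i) \<le> degree P" if "?A i P" for P
      unfolding G_def by (rule arg_min_nat_le[of "?A i", OF that])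
  qed
  \<comment> \<open>Otherwise \<open>pderiv (G i)\<close> would be a relation of smaller degree: its
    leading coefficient is that of \<open>G i\<close> times a positive integer, so its value stays
    outside \<open>p\<close>.\<close>
  have "grad x (poly (G i) (pvar i)) i \<notin> p" if i: "i < n" "i \<notin> J" for i
  proof
    assume "grad x (poly (G i) (pvar i)) i \<in> p"
    have cG: "coeff (G i) e \<in> poly_vars (J \<union> {..<i})" for e
      using G(1)[OF i] by (simp add: alg_poly_def)
    have "grad x (poly (G i) (pvar i)) i = ev x (poly (pderiv (G i)) (pvar i))"
      unfolding grad_def using i cG by (subst pdiff_poly_pvar[of "G i" "J \<union> {..<i}"]) auto
    with \<open>grad x (poly (G i) (pvar i)) i \<in> p\<close> have "ev x (poly (pderiv (G i)) (pvar i)) \<in> p" by simp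
    moreover obtain k where k: "degree (G i) = Suc k"
      using alg_poly_degree[OF G(1)[OF i]] by (cases "degree (G i)") auto
    have "lead_coeff (pderiv (G i)) = of_nat (Suc k) * lead_coeff (G i)"
      by (simp add: degree_pderiv coeff_pderiv k)
    then have "ev x (lead_coeff (pderiv (G i))) = of_nat (Suc k) * ev x (lead_coeff (G i))"
      by (simp only: ev_mult ev_of_nat)
    then have "ev x (lead_coeff (pderiv (G i))) \<notin> p"
      using G(1)[OF i] of_nat_notin_prime[OF p, of k]
      by (auto simp: prime_mult[OF p] alg_poly_def simp del: of_nat_Suc)
    moreover have "coeff (pderiv (G i)) e \<in> poly_vars (J \<union> {..<i})" for e
      unfolding coeff_pderiv using cG
      by (intro poly_vars_mult poly_vars_of_nat)
    ultimately have "?A i (pderiv (G i))"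
      by (simp add: alg_poly_def)
    from G(2)[OF i this] k show False by (simp add: degree_pderiv)
  qed
  with G that show thesis by blast
qed

text \<open>The relation for the variable \<open>i\<close> involves only \<open>J\<close> and the
  variables up to \<open>i\<close>, so on the columns outside \<open>J\<close> the gradients form a
  triangular matrix with diagonal outside \<open>p\<close>.\<close>

lemma has_minor_tr_basis:
  assumes p: "is_prime p" and J: "tr_basis n p x J"
  shows "has_minor p n (grads n p x) (n - card J)"
proof -
  obtain G where G: "\<And>i. i < n \<Longrightarrow> i \<notin> J \<Longrightarrow> alg_poly p x (J \<union> {..<i}) i (G i)"
    "\<And>i. i < n \<Longrightarrow> i \<notin> J \<Longrightarrow> grad x (poly (G i) (pvar i)) i \<notin> p"
    using tr_basis_relations[OF p J] by metis
  define I where "I = {..<n} - J"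
  have J': "J \<subseteq> {..<n}" using J by (simp add: tr_basis_def)
  then have card: "card I = n - card J"
    by (simp add: I_def card_Diff_subset finite_subset)
  have pick: "pick I s < n" "pick I s \<notin> J" if "s < n - card J" for s
    using pick_in_set_le[of s I] that card by (auto simp: I_def)
  let ?g = "\<lambda>i. poly (G i) (pvar i)"
  let ?u = "\<lambda>s. grad x (?g (pick I s))"
  have vars: "?g i \<in> poly_vars (insert i (J \<union> {..<i}))" if "i < n" "i \<notin> J" for i
    using G(1)[OF that] unfolding alg_poly_def
    by (intro poly_vars_poly poly_vars_pvar) (auto intro: poly_vars_mono[of "J \<union> {..<i}"])
  have "?u s (pick I s') = 0" if "s < s'" "s' < n - card J" for s s'
  proof -
    have "pick I s < pick I s'" using that card by (intro pick_mono_le) auto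
    moreover have "pick I s' \<notin> J" using pick that by simp
    ultimately have "pdiff (pick I s') (?g (pick I s)) = 0"
      using that pick[of s] by (intro pdiff_eq_0[OF vars]) auto
    then show ?thesis by (simp add: grad_def)
  qed
  then have "gdet (n - card J) ?u (pick I) = (\<Prod>s<n - card J. ?u s (pick I s))"
    by (intro gdet_lower_triangular) auto
  also have "\<dots> \<notin> p"
    using G(2) pick by (subst prime_prod[OF _ p]) auto
  finally have "gdet (n - card J) ?u (pick I) \<notin> p" .
  moreover have "?u s \<in> grads n p x" if "s < n - card J" for s
    unfolding grads_def
  proof (intro CollectI exI[of _ "?g (pick I s)"] conjI)
    show "?g (pick I s) \<in> poly_vars {..<n}"
      using vars[OF pick[OF that]] by (rule poly_vars_mono[rotated]) (use J' pick[OF that] in auto)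
    show "ev x (?g (pick I s)) \<in> p"
      using G(1)[OF pick[OF that]] by (simp add: alg_poly_def)
  qed simp
  ultimately show ?thesis
    unfolding has_minor_def using pick by (intro exI[of _ ?u] exI[of _ "pick I"]) auto
qed

text \<open>A linear form \<open>h\<close> that kills the gradients of the \<open>G i\<close> modulo
  \<open>p\<close> is tested on an arbitrary polynomial vanishing modulo \<open>p\<close>.
  Pseudo-division by \<open>G m\<close> lowers the degree in the variable \<open>m\<close>;
  variables are eliminated one at a time until only \<open>J\<close> is left, where freeness leaves
  just zero.\<close>

lemma grads_bipolar:
  assumes p: "is_prime p" and J: "tr_basis n p x J"
    and G: "\<And>i. i < n \<Longrightarrow> i \<notin> J \<Longrightarrow> alg_poly p x (J \<union> {..<i}) i (G i)"
    and min: "\<And>i P. i < n \<Longrightarrow> i \<notin> J \<Longrightarrow> alg_poly p x (J \<union> {..<i}) i P \<Longrightarrow> degree (G i) \<le> degree P"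
  shows "grads n p x \<subseteq> bipolar p n ((\<lambda>i. grad x (poly (G i) (pvar i))) ` ({..<n} - J))"
proof
  fix v assume "v \<in> grads n p x"
  then obtain f where f: "v = grad x f" "f \<in> poly_vars {..<n}" "ev x f \<in> p"
    by (auto simp: grads_def)
  show "v \<in> bipolar p n ((\<lambda>i. grad x (poly (G i) (pvar i))) ` ({..<n} - J))"
    unfolding bipolar_def
  proof (intro CollectI allI impI)
    fix h
    assume h: "\<forall>w\<in>(\<lambda>i. grad x (poly (G i) (pvar i))) ` ({..<n} - J). (\<Sum>t<n. h t * w t) \<in> p"
    \<comment> \<open>\<open>E\<close> is the directional derivative along \<open>h\<close>:
      additive, with the product rule over \<open>ev x\<close>.\<close>
    define E where "E g = (\<Sum>t<n. h t * grad x g t)" for g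
    have E_add: "E (g + g') = E g + E g'" for g g'
      by (simp add: E_def grad_add distrib_left sum.distrib)
    have E_mult: "E (g * g') = ev x g * E g' + ev x g' * E g" for g g'
      by (simp add: E_def grad_mult algebra_simps sum.distrib sum_distrib_left)
    have E_diff: "E (g - g') = E g - E g'" for g g'
      using E_add[of "g - g'" g'] by simp
    have E_0: "E 0 = 0" using E_diff[of 0 0] by simp
    have EG: "E (poly (G i) (pvar i)) \<in> p" if "i < n" "i \<notin> J" for i
      using h that by (auto simp: E_def)
    note pI = is_prime_ideal[OF p]
    have "E g \<in> p" if "m \<le> n" "g \<in> poly_vars (J \<union> {..<m})" "ev x g \<in> p" for m g
      using that
    proof (induction m arbitrary: g)
      case 0
      then have "g = 0" using J by (simp add: tr_basis_def free_def)
      then show ?case by (simp add: E_0 prime_zero[OF p])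
    next
      case (Suc m)
      show ?case
      proof (cases "m \<in> J")
        case True
        then have "J \<union> {..<Suc m} = J \<union> {..<m}" by (auto simp: less_Suc_eq)
        then show ?thesis using Suc by auto
      next
        case False
        have m: "m < n" using Suc.prems by simp
        let ?V = "J \<union> {..<m}" and ?X = "pvar m :: 'k mpoly"
        have "J \<union> {..<Suc m} = insert m ?V" by (auto simp: less_Suc_eq)
        then have "g \<in> poly_vars (insert m ?V)" using Suc.prems(2) by metis
        then obtain P where P: "\<And>e. coeff P e \<in> poly_vars ?V" "g = poly P ?X"
          using poly_vars_insert by metis
        have "E (poly P ?X) \<in> p"
          if "\<And>e. D \<le> e \<Longrightarrow> coeff P e = 0" "\<And>e. coeff P e \<in> poly_vars ?V" "ev x (poly P ?X) \<in> p" for D P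
          using that
        proof (induction D arbitrary: P)
          case 0
          then have "P = 0" by (auto simp: poly_eq_iff)
          then show ?case by (simp add: E_0 prime_zero[OF p])
        next
          case (Suc D P)
          let ?b = "coeff P D"
          show ?case
          proof (cases "ev x ?b \<in> p")
            case True
            let ?P = "P - Polynomial.monom ?b D"
            have "E (poly ?P ?X) \<in> p"
            proof (rule Suc.IH)
              show "coeff ?P e = 0" if "D \<le> e" for e
                by (rule top_coeff_split) (use Suc.prems(1) that in auto)
              show "coeff ?P e \<in> poly_vars ?V" for e
                using Suc.prems(2) by (auto intro: poly_vars_diff)
              show "ev x (poly ?P ?X) \<in> p"
                using Suc.prems(3) True pI
                by (auto simp: ev_diff ev_poly_monom intro: ideal_diff ideal_mult_right)
            qed
            \<comment> \<open>The coefficient vanishes modulo \<open>p\<close> and lies in the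
              smaller polynomial ring, so the outer induction applies to it.\<close>
            moreover have "E ?b \<in> p"
              using \<open>\<And>g. m \<le> n \<Longrightarrow> g \<in> poly_vars ?V \<Longrightarrow> ev x g \<in> p \<Longrightarrow> E g \<in> p\<close> m Suc.prems(2) True by simp
            moreover have "E (poly P ?X) = E (poly ?P ?X) + (ev x ?b * E (?X ^ D) + ev x (?X ^ D) * E ?b)"
              by (simp add: E_mult[symmetric] E_add[symmetric] poly_monom)
            ultimately show ?thesis
              using ideal_add[OF pI] ideal_mult_left[OF pI] ideal_mult_right[OF pI True] by metis
          next
            case False
            then have "?b \<noteq> 0" using prime_zero[OF p] by auto
            then have D: "degree P = D"
              using Suc.prems(1) by (intro antisym degree_le le_degree) (auto simp: Suc_le_eq)
            \<comment> \<open>\<open>P\<close> is itself a relation for the variable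
              \<open>m\<close>, so minimality of \<open>G m\<close> permits a step of
              pseudo-division.\<close>
            have "alg_poly p x ?V m P"
              using Suc.prems False by (simp add: alg_poly_def D)
            from min[OF m \<open>m \<notin> J\<close> this] have le: "degree (G m) \<le> D" by (simp add: D)
            have Gm: "alg_poly p x ?V m (G m)" by (rule G[OF m \<open>m \<notin> J\<close>])
            define c where "c = lead_coeff (G m)"
            define Q where "Q = Polynomial.monom ?b (D - degree (G m))"
            define P' where "P' = Polynomial.smult c P - Q * G m"
            have P'_poly: "poly P' ?X = c * poly P ?X - poly Q ?X * poly (G m) ?X"
              by (simp add: P'_def)
            have "E (poly P' ?X) \<in> p"
            proof (rule Suc.IH)
              show "coeff P' e = 0" if "D \<le> e" for e
              proof (cases "e = D")
                case True
                then show ?thesis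
                  using le by (simp add: P'_def Q_def coeff_monom_mult c_def)
              next
                case False
                then have "coeff P e = 0" "coeff (G m) (e - (D - degree (G m))) = 0"
                  using that le Suc.prems(1) by (auto intro!: coeff_eq_0)
                then show ?thesis
                  by (simp add: P'_def Q_def coeff_monom_mult)
              qed
              show "coeff P' e \<in> poly_vars ?V" for e
                using Gm Suc.prems(2) unfolding P'_def Q_def c_def alg_poly_def
                by (auto simp: coeff_monom_mult intro!: poly_vars_diff poly_vars_mult)
              show "ev x (poly P' ?X) \<in> p"
                using Gm Suc.prems(3) unfolding P'_poly alg_poly_def
                by (auto simp: ev_diff ev_mult intro!: ideal_diff[OF pI] ideal_mult_left[OF pI])
            qed
            moreover have "E (poly P' ?X) = ev x c * E (poly P ?X) +
                (ev x (poly P ?X) * E c - (ev x (poly Q ?X) * E (poly (G m) ?X) + ev x (poly (G m) ?X) * E (poly Q ?X)))"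
              by (simp add: P'_poly E_diff E_mult algebra_simps)
            \<comment> \<open>Each product has a factor in \<open>p\<close>: the value of
              \<open>P\<close> or of \<open>G m\<close>, or \<open>E\<close> of
              \<open>G m\<close>.\<close>
            moreover have "ev x (poly P ?X) * E c - (ev x (poly Q ?X) * E (poly (G m) ?X) + ev x (poly (G m) ?X) * E (poly Q ?X)) \<in> p"
              using EG[OF m \<open>m \<notin> J\<close>] Gm Suc.prems(3) unfolding alg_poly_def
              by (intro ideal_diff[OF pI] ideal_add[OF pI]; meson ideal_mult_left[OF pI] ideal_mult_right[OF pI])
            ultimately have "ev x c * E (poly P ?X) \<in> p"
              using ideal_add_iff[OF pI] by simp
            then show ?thesis
              using Gm by (simp add: prime_mult[OF p] alg_poly_def c_def)
          qed
        qed
        from this[of "Suc (degree P)" P] show ?thesis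
          using P Suc.prems(3) by (auto simp: coeff_eq_0 Suc_le_eq)
      qed
    qed
    from this[of n f] show "(\<Sum>t<n. h t * v t) \<in> p"
      using f J by (simp add: E_def tr_basis_def Un_absorb1)
  qed
qed

text \<open>The left side does not mention \<open>J\<close>, so comparing two bases shows that they
  are equinumerous, without an exchange argument.\<close>

theorem has_minor_grads_iff:
  assumes p: "is_prime p" and J: "tr_basis n p x J"
  shows "has_minor p n (grads n p x) k \<longleftrightarrow> k \<le> n - card J"
proof
  assume k: "has_minor p n (grads n p x) k"
  obtain G where G: "\<And>i. i < n \<Longrightarrow> i \<notin> J \<Longrightarrow> alg_poly p x (J \<union> {..<i}) i (G i)"
    "\<And>i P. i < n \<Longrightarrow> i \<notin> J \<Longrightarrow> alg_poly p x (J \<union> {..<i}) i P \<Longrightarrow> degree (G i) \<le> degree P"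
    using tr_basis_relations[OF p J] by metis
  let ?W = "(\<lambda>i. grad x (poly (G i) (pvar i))) ` ({..<n} - J)"
  have "has_minor p n ?W k"
    by (rule has_minor_bipolar[OF k grads_bipolar[OF p J G]])
  then have "k \<le> card ?W"
    by (intro has_minor_card_le[OF p]) auto
  also have "\<dots> \<le> card ({..<n} - J)" by (intro card_image_le) auto
  also have "\<dots> = n - card J"
    using J finite_subset[of J "{..<n}"] by (simp add: tr_basis_def card_Diff_subset)
  finally show "k \<le> n - card J" .
next
  assume "k \<le> n - card J"
  then show "has_minor p n (grads n p x) k"
    by (rule has_minor_le[OF is_prime_ideal[OF p] has_minor_tr_basis[OF p J]])
qed

lemma tr_basis_card_eq:
  assumes p: "is_prime p" and J: "tr_basis n p x J" "tr_basis n p x J'"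
  shows "card J = card J'"
proof -
  have "card J \<le> n" "card J' \<le> n"
    using J card_mono[of "{..<n}"] by (auto simp: tr_basis_def)
  moreover have "n - card J \<le> n - card J'" "n - card J' \<le> n - card J"
    using has_minor_grads_iff[OF p J(1)] has_minor_grads_iff[OF p J(2)] by blast+
  ultimately show ?thesis by linarith
qed

text \<open>An element of \<open>q - p\<close> is adjoined as a further variable. Modulo \<open>p\<close> it is
  transcendental over a transcendence basis modulo \<open>q\<close>, because the constant term of a relation
  would lie in \<open>q\<close>.\<close>

lemma tr_basis_card_less:
  assumes p: "is_prime p" and q: "is_prime q" and "p \<subseteq> q"
    and g: "g \<in> poly_vars {..<n}" "ev x g \<in> q" "ev x g \<notin> p"
    and Jp: "tr_basis n p x Jp" and Jq: "tr_basis n q x Jq"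
  shows "card Jq < card Jp"
proof -
  define y where "y = x(n := ev x g)"
  have yn: "y n = ev x g" by (simp add: y_def)
  have ev_y: "ev y f = ev x f" if "f \<in> poly_vars {..<n}" for f
    by (rule ev_cong[OF that]) (simp add: y_def)
  have "Jp \<subseteq> {..<n}" "Jq \<subseteq> {..<n}" using Jp Jq by (auto simp: tr_basis_def)
  have ev_p: "ev y f = ev x f" if "f \<in> poly_vars Jp" for f
    by (rule ev_y[OF poly_vars_mono[OF \<open>Jp \<subseteq> {..<n}\<close> that]])
  have ev_q: "ev y f = ev x f" if "f \<in> poly_vars Jq" for f
    by (rule ev_y[OF poly_vars_mono[OF \<open>Jq \<subseteq> {..<n}\<close> that]])
  have "tr_basis (Suc n) p y Jp"
    unfolding tr_basis_def
  proof (intro conjI allI impI)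
    show "Jp \<subseteq> {..<Suc n}" using \<open>Jp \<subseteq> {..<n}\<close> by auto
    show "free p y Jp" using Jp ev_p by (auto simp: tr_basis_def free_def)
    fix i assume i: "i < Suc n" "i \<notin> Jp"
    show "\<exists>P. alg_poly p y (Jp \<union> {..<i}) i P"
    proof (cases "i = n")
      case True
      \<comment> \<open>The new variable satisfies the linear relation X - g, so \<open>Jp\<close>
        remains a transcendence basis.\<close>
      have "coeff [:-g, 1:] e \<in> poly_vars {..<n}" for e
        using g(1) by (cases e) (auto simp: coeff_pCons split: nat.splits intro: poly_vars_uminus)
      moreover have "ev y (- g) = - ev x g"
        using ev_y[OF g(1)] by (simp add: ev_uminus)
      ultimately have "alg_poly p y (Jp \<union> {..<n}) n [:-g, 1:]"
        using \<open>Jp \<subseteq> {..<n}\<close> p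
        by (simp add: alg_poly_def prime_one prime_zero Un_absorb1 ev_diff ev_y[OF g(1)] yn)
      then show ?thesis using True by auto
    next
      case False
      then obtain P where P: "alg_poly p x (Jp \<union> {..<i}) i P"
        using Jp i unfolding tr_basis_def by (metis less_Suc_eq)
      have "Jp \<union> {..<i} \<subseteq> {..<n}" "i < n" using \<open>Jp \<subseteq> {..<n}\<close> i False by auto
      then have c: "coeff P e \<in> poly_vars {..<n}" for e
        using P poly_vars_mono unfolding alg_poly_def by blast
      then have "poly P (pvar i) \<in> poly_vars {..<n}"
        using \<open>i < n\<close> by (intro poly_vars_poly poly_vars_pvar) auto
      then have "alg_poly p y (Jp \<union> {..<i}) i P"
        using P c ev_y by (simp add: alg_poly_def)
      then show ?thesis by blast
    qed
  qed
  moreover have "free p y (insert n Jq)"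
    unfolding free_def
  proof (intro ballI impI)
    fix f assume f: "f \<in> poly_vars (insert n Jq)" "ev y f \<in> p"
    obtain P where P: "\<And>e. coeff P e \<in> poly_vars Jq" "f = poly P (pvar n)"
      using poly_vars_insert[OF f(1)] by metis
    have "P = 0" if "\<And>e. coeff P e \<in> poly_vars Jq" "ev y (poly P (pvar n)) \<in> p" for P
      using that
    proof (induction P)
      case (pCons a P)
      have a: "a \<in> poly_vars Jq" using pCons.prems(1)[of 0] by simp
      have cP: "coeff P e \<in> poly_vars Jq" for e using pCons.prems(1)[of "Suc e"] by simp
      have eq: "ev y (poly (pCons a P) (pvar n)) = ev x a + ev x g * ev y (poly P (pvar n))"
        using ev_q[OF a] by (simp add: ev_add ev_mult y_def)
      have "ev x a + ev x g * ev y (poly P (pvar n)) \<in> q"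
        using pCons.prems(2) \<open>p \<subseteq> q\<close> unfolding eq by auto
      then have "ev x a \<in> q"
        using ideal_add_iff[OF is_prime_ideal[OF q] ideal_mult_right[OF is_prime_ideal[OF q] g(2)]] by blast
      then have "a = 0" using Jq a by (auto simp: tr_basis_def free_def)
      then have "ev y (poly P (pvar n)) \<in> p"
        using pCons.prems(2) g(3) unfolding eq by (simp add: prime_mult[OF p])
      then have "P = 0" using pCons.IH cP by blast
      then show ?case using \<open>a = 0\<close> by simp
    qed simp
    from this[OF P(1)] f(2) have "P = 0" unfolding P(2) .
    then show "f = 0" using P(2) by simp
  qed
  moreover have "insert n Jq \<subseteq> {..<Suc n}" using \<open>Jq \<subseteq> {..<n}\<close> by auto
  \<comment> \<open>A basis modulo \<open>p\<close> above \<open>insert n Jq\<close> has the size of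
    \<open>Jp\<close>, because both are bases for the enlarged set of variables.\<close>
  ultimately obtain K where K: "insert n Jq \<subseteq> K" "tr_basis (Suc n) p y K" "card K = card Jp"
    using tr_basis_extend[OF p, of y "insert n Jq" "Suc n"] tr_basis_card_eq[OF p] by metis
  have "finite K" using K(2) finite_subset by (auto simp: tr_basis_def)
  have "n \<notin> Jq" "finite Jq" using \<open>Jq \<subseteq> {..<n}\<close> finite_subset by auto
  then have "Suc (card Jq) = card (insert n Jq)" by simp
  also have "\<dots> \<le> card K" by (rule card_mono[OF \<open>finite K\<close> K(1)])
  finally show ?thesis using K(3) by simp
qed

text \<open>A polynomial without variables is a constant, and a nonzero constant is a unit.\<close>

lemma free_empty: "is_prime p \<Longrightarrow> free p x {}"
  unfolding free_def
proof (intro ballI impI)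
  fix g assume p: "is_prime p" and g: "g \<in> poly_vars {}" "ev x g \<in> p"
  define c where "c = Poly_Mapping.lookup g 0"
  have "Poly_Mapping.lookup g t = Poly_Mapping.lookup (pconst c) t" for t
  proof (cases "t = 0")
    case False
    then have "t \<notin> Poly_Mapping.keys g" using g(1) by (auto simp: poly_vars_def)
    then show ?thesis using False by (simp add: in_keys_iff pconst_def lookup_single)
  qed (simp add: pconst_def c_def)
  then have gc: "g = pconst c" by (rule poly_mapping_eqI)
  have "c = 0"
  proof (rule ccontr)
    assume "c \<noteq> 0"
    then have "\<kappa> (inverse c) * \<kappa> c = 1" by (simp add: \<kappa>_mult[symmetric] \<kappa>_1)
    then show False
      using g(2) prime_one[OF p] ideal_mult_left[OF is_prime_ideal[OF p], of "\<kappa> c" "\<kappa> (inverse c)"]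
      by (simp add: gc)
  qed
  then show "g = 0" by (simp add: gc pconst_def)
qed

end

section \<open>The Jacobian criterion\<close>

text \<open>Evaluation at \<open>x\<close> takes the place of cosets, \<open>I\<close>,
  \<open>S\<close> and \<open>\<phi>\<close>: its kernel is generated by the \<open>f i\<close>, and
  every element is a value divided by a unit value. The \<open>a i\<close> in \<open>kernel\<close>
  may involve further variables, since only their values at \<open>x\<close> matter.\<close>

locale presentation = evaluation \<kappa>
  for \<kappa> :: "'k::field_char_0 \<Rightarrow> 'a::idom" +
  fixes n m :: nat and f :: "nat \<Rightarrow> 'k mpoly" and x :: "nat \<Rightarrow> 'a"
  assumes f_vars: "i < m \<Longrightarrow> f i \<in> poly_vars {..<n}"
    and ev_f: "i < m \<Longrightarrow> ev x (f i) = 0"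
    and kernel: "g \<in> poly_vars {..<n} \<Longrightarrow> ev x g = 0 \<Longrightarrow> \<exists>a. g = (\<Sum>i<m. a i * f i)"
    and fraction: "\<exists>g\<in>poly_vars {..<n}. \<exists>s\<in>poly_vars {..<n}. ev x s dvd 1 \<and> b * ev x s = ev x g"
begin

definition Jac :: "'a mat" where
  "Jac = mat m n (\<lambda>(i, j). grad x (f i) j)"

lemma Jac_dim [simp]: "dim_row Jac = m" "dim_col Jac = n"
  by (simp_all add: Jac_def)

lemma row_fun_Jac: "i < m \<Longrightarrow> j < n \<Longrightarrow> row_fun Jac i j = grad x (f i) j"
  by (simp add: Jac_def row_fun_def)

text \<open>\<open>w\<close> is a vector of partial derivatives of \<open>b\<close>, computed from some representation of \<open>b\<close> as a
  fraction. It is determined only up to the row space of the Jacobian matrix.\<close>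

definition has_grad :: "'a \<Rightarrow> (nat \<Rightarrow> 'a) \<Rightarrow> bool" where
  "has_grad b w \<longleftrightarrow> (\<exists>g\<in>poly_vars {..<n}. \<exists>s\<in>poly_vars {..<n}. ev x s dvd 1 \<and> b * ev x s = ev x g \<and>
     (\<forall>j. ev x s * w j = grad x g j - b * grad x s j))"

lemma has_grad_ev: "g \<in> poly_vars {..<n} \<Longrightarrow> has_grad (ev x g) (grad x g)"
  unfolding has_grad_def by (intro bexI[of _ g] bexI[of _ 1]) (auto simp: grad_def)

lemma has_grad_total: "\<exists>w. has_grad b w"
proof -
  obtain g s where gs: "g \<in> poly_vars {..<n}" "s \<in> poly_vars {..<n}" "ev x s dvd 1" "b * ev x s = ev x g"
    using fraction by blast
  then obtain u where u: "1 = ev x s * u" by (auto elim: dvdE)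
  have "ev x s * (u * c) = c" for c
    by (simp add: mult.assoc[symmetric] u[symmetric])
  then have "\<forall>j. ev x s * (u * (grad x g j - b * grad x s j)) = grad x g j - b * grad x s j"
    by blast
  then show ?thesis
    unfolding has_grad_def using gs
    by (intro exI[of _ "\<lambda>j. u * (grad x g j - b * grad x s j)"] bexI[of _ g] bexI[of _ s] conjI)
qed

lemma has_grad_add:
  assumes "has_grad b w" "has_grad b' w'"
  shows "has_grad (b + b') (\<lambda>j. w j + w' j)"
proof -
  obtain g s where 1: "g \<in> poly_vars {..<n}" "s \<in> poly_vars {..<n}" "ev x s dvd 1" "ev x g = b * ev x s"
    "\<And>j. grad x g j = ev x s * w j + b * grad x s j"
    using assms(1) by (auto simp: has_grad_def)
  obtain g' s' where 2: "g' \<in> poly_vars {..<n}" "s' \<in> poly_vars {..<n}" "ev x s' dvd 1" "ev x g' = b' * ev x s'"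
    "\<And>j. grad x g' j = ev x s' * w' j + b' * grad x s' j"
    using assms(2) by (auto simp: has_grad_def)
  have "ev x (s * s') dvd 1"
    using mult_dvd_mono[OF 1(3) 2(3)] by (simp add: ev_mult)
  then show ?thesis
    unfolding has_grad_def
    by (intro bexI[of _ "g * s' + g' * s"] bexI[of _ "s * s'"] conjI allI poly_vars_add poly_vars_mult)
      (simp_all add: 1 2 ev_add ev_mult grad_add grad_mult algebra_simps)
qed

lemma has_grad_mult:
  assumes "has_grad b w" "has_grad b' w'"
  shows "has_grad (b * b') (\<lambda>j. b * w' j + b' * w j)"
proof -
  obtain g s where 1: "g \<in> poly_vars {..<n}" "s \<in> poly_vars {..<n}" "ev x s dvd 1" "ev x g = b * ev x s"
    "\<And>j. grad x g j = ev x s * w j + b * grad x s j"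
    using assms(1) by (auto simp: has_grad_def)
  obtain g' s' where 2: "g' \<in> poly_vars {..<n}" "s' \<in> poly_vars {..<n}" "ev x s' dvd 1" "ev x g' = b' * ev x s'"
    "\<And>j. grad x g' j = ev x s' * w' j + b' * grad x s' j"
    using assms(2) by (auto simp: has_grad_def)
  have "ev x (s * s') dvd 1"
    using mult_dvd_mono[OF 1(3) 2(3)] by (simp add: ev_mult)
  then show ?thesis
    unfolding has_grad_def
    by (intro bexI[of _ "g * g'"] bexI[of _ "s * s'"] conjI allI poly_vars_mult)
      (simp_all add: 1 2 ev_mult grad_mult algebra_simps)
qed

lemma has_grad_0: "has_grad 0 (\<lambda>j. 0)"
  using has_grad_ev[of 0] by (simp add: grad_def)

lemma has_grad_const: "has_grad (\<kappa> c) (\<lambda>j. 0)"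
  using has_grad_ev[of "pconst c"] by (simp add: grad_def)

lemma has_grad_diff:
  assumes "has_grad b w" "has_grad b' w'"
  shows "has_grad (b - b') (\<lambda>j. w j - w' j)"
proof -
  have "\<kappa> (-1) = -1"
    using \<kappa>_add[of 1 "-1"] by (simp add: \<kappa>_1 \<kappa>_0 eq_neg_iff_add_eq_0 add.commute)
  then show ?thesis
    using has_grad_add[OF assms(1) has_grad_mult[OF has_grad_const[of "-1"] assms(2)]] by simp
qed

lemma has_grad_sum:
  "(\<And>z. z \<in> X \<Longrightarrow> has_grad (b z) (w z)) \<Longrightarrow> has_grad (\<Sum>z\<in>X. b z) (\<lambda>j. \<Sum>z\<in>X. w z j)"
  by (induction X rule: infinite_finite_induct) (auto intro: has_grad_0 has_grad_add)

text \<open>The numerator of a fraction that represents 0 is a combination of the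
  \<open>f i\<close>, and as these vanish at \<open>x\<close> the product rule leaves only the terms
  in which they are differentiated.\<close>

lemma has_grad_0_row_span:
  assumes "has_grad 0 w"
  shows "\<exists>a. \<forall>j<n. w j = (\<Sum>i<m. a i * row_fun Jac i j)"
proof -
  obtain g s where g: "g \<in> poly_vars {..<n}" "ev x s dvd 1" "ev x g = 0"
    "\<And>j. ev x s * w j = grad x g j"
    using assms by (auto simp: has_grad_def)
  obtain a where a: "g = (\<Sum>i<m. a i * f i)" using kernel[OF g(1,3)] by blast
  obtain u where u: "1 = ev x s * u" using g(2) by (auto elim: dvdE)
  have "w j = (\<Sum>i<m. (u * ev x (a i)) * row_fun Jac i j)" if "j < n" for j
  proof -
    have "grad x (\<Sum>i\<in>T. a i * f i) j = (\<Sum>i\<in>T. grad x (a i * f i) j)" for T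
    proof (induction T rule: infinite_finite_induct)
      case (insert i T)
      then show ?case by (simp add: grad_add)
    qed (simp_all add: grad_def)
    then have "grad x g j = (\<Sum>i<m. ev x (a i) * row_fun Jac i j)"
      unfolding a by (auto simp: grad_mult ev_f row_fun_Jac that intro!: sum.cong)
    moreover have "w j = u * (ev x s * w j)"
      by (metis u mult.assoc mult.commute mult_1)
    ultimately show ?thesis
      by (simp add: g(4) sum_distrib_left mult.assoc)
  qed
  then show ?thesis by (intro exI[of _ "\<lambda>i. u * ev x (a i)"]) simp
qed

lemma has_grad_0_orthogonal:
  assumes "has_grad 0 w" and Q: "is_ideal Q" and "\<And>i. i < m \<Longrightarrow> (\<Sum>t<n. h t * row_fun Jac i t) \<in> Q"
  shows "(\<Sum>t<n. h t * w t) \<in> Q"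
proof -
  obtain a where "\<And>j. j < n \<Longrightarrow> w j = (\<Sum>i<m. a i * row_fun Jac i j)"
    using has_grad_0_row_span[OF assms(1)] by blast
  then have "(\<Sum>t<n. h t * w t) = (\<Sum>t<n. \<Sum>i<m. a i * (h t * row_fun Jac i t))"
    by (intro sum.cong refl) (simp add: sum_distrib_left algebra_simps)
  also have "\<dots> = (\<Sum>i<m. a i * (\<Sum>t<n. h t * row_fun Jac i t))"
    by (subst sum.swap) (simp add: sum_distrib_left)
  also have "\<dots> \<in> Q"
    by (intro ideal_sum ideal_mult_left Q assms(3)) auto
  finally show ?thesis .
qed

section \<open>Rank of the Jacobian matrix and transcendence bases\<close>

definition r :: nat where "r = frac_rank Jac"

lemma le_r_iff: "k \<le> r \<longleftrightarrow> has_minor {0} n (row_set Jac) k"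
  unfolding r_def using le_frac_rank_iff[of k Jac] by simp

lemma r_le_n: "r \<le> n"
proof -
  have "has_minor {0} n (row_set Jac) r" using le_r_iff by blast
  then obtain u c where u: "\<forall>i<r. u i \<in> row_set Jac" "\<forall>l<r. c l < n" "gdet r u c \<notin> {0}"
    by (rule has_minorE)
  then have "inj_on c {..<r}" using gdet_not_inj_columns[of c r u] by auto
  then show ?thesis using card_inj_on_le[of c "{..<r}" "{..<n}"] u(2) by auto
qed

text \<open>Over the zero ideal the gradients of all relations and the rows of the Jacobian matrix
  have the same saturated span, hence the same rank. So \<open>n - r\<close> is the transcendence
  degree of the ring.\<close>

lemma tr_basis_zero_card:
  assumes J: "tr_basis n {0} x J"
  shows "card J = n - r"
proof -
  have p: "is_prime ({0} :: 'a set)" by (rule is_prime_zero)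
  have grads: "grads n {0} x \<subseteq> bipolar {0} n (row_set Jac)"
  proof
    fix v assume "v \<in> grads n {0} x"
    then obtain g where g: "v = grad x g" "g \<in> poly_vars {..<n}" "ev x g = 0" by (auto simp: grads_def)
    then have "has_grad 0 v" using has_grad_ev by metis
    then show "v \<in> bipolar {0} n (row_set Jac)"
      using has_grad_0_orthogonal[OF _ is_prime_ideal[OF p]] by (auto simp: bipolar_def)
  qed
  have rows: "row_set Jac \<subseteq> bipolar {0} n (grads n {0} x)"
  proof
    fix v assume "v \<in> row_set Jac"
    then obtain i where i: "i < m" "v = row_fun Jac i" by auto
    then have "grad x (f i) \<in> grads n {0} x" using f_vars ev_f by (auto simp: grads_def)
    moreover have "(\<Sum>t<n. h t * v t) = (\<Sum>t<n. h t * grad x (f i) t)" for h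
      by (intro sum.cong) (auto simp: i row_fun_Jac)
    ultimately show "v \<in> bipolar {0} n (grads n {0} x)" by (auto simp: bipolar_def)
  qed
  have "k \<le> r \<longleftrightarrow> k \<le> n - card J" for k
    unfolding has_minor_grads_iff[OF p J, symmetric] le_r_iff
    using has_minor_bipolar[OF _ grads] has_minor_bipolar[OF _ rows] by blast
  then have "r = n - card J" by (metis order_antisym order_refl)
  moreover have "card J \<le> n"
    using J card_mono[of "{..<n}"] by (auto simp: tr_basis_def)
  ultimately show ?thesis by simp
qed

text \<open>If \<open>q\<close> is generated, up to denominators outside \<open>q\<close>, by few elements,
  then the gradients of its elements are combinations modulo \<open>q\<close> of few gradients and of the rows of
  the Jacobian matrix.\<close>

lemma jacobian_criterion:
  assumes q: "is_prime q" and X: "finite X"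
    and gen: "\<And>b. b \<in> q \<Longrightarrow> \<exists>s c. s \<notin> q \<and> s * b = (\<Sum>z\<in>X. c z * \<zeta> z)"
    and \<zeta>: "\<And>z. z \<in> X \<Longrightarrow> \<zeta> z \<in> q"
    and Jq: "tr_basis n q x Jq" and card: "card X + card Jq \<le> n - r"
  shows "has_minor q n (row_set Jac) r"
proof -
  note qI = is_prime_ideal[OF q]
  obtain W where W: "\<And>b. has_grad b (W b)" using has_grad_total by metis
  have "grads n q x \<subseteq> bipolar q n ((\<lambda>z. W (\<zeta> z)) ` X \<union> row_set Jac)"
  proof
    fix v assume "v \<in> grads n q x"
    then obtain g where g: "v = grad x g" "g \<in> poly_vars {..<n}" "ev x g \<in> q"
      by (auto simp: grads_def)
    obtain s c where s: "s \<notin> q" "s * ev x g = (\<Sum>z\<in>X. c z * \<zeta> z)"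
      using gen[OF g(3)] by blast
    show "v \<in> bipolar q n ((\<lambda>z. W (\<zeta> z)) ` X \<union> row_set Jac)"
      unfolding bipolar_def
    proof (intro CollectI allI impI)
      fix h assume h: "\<forall>w\<in>(\<lambda>z. W (\<zeta> z)) ` X \<union> row_set Jac. (\<Sum>t<n. h t * w t) \<in> q"
      define H where "H w = (\<Sum>t<n. h t * w t)" for w
      \<comment> \<open>The product rule on both sides of
        \<open>s * ev x g = (\<Sum>z\<in>X. c z * \<zeta> z)\<close>; the difference is a gradient
        of 0, hence a combination of rows.\<close>
      define w where "w j = (s * v j + ev x g * W s j) - (\<Sum>z\<in>X. c z * W (\<zeta> z) j + \<zeta> z * W (c z) j)" for j
      have "has_grad (s * ev x g) (\<lambda>j. s * v j + ev x g * W s j)"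
        unfolding g(1) by (rule has_grad_mult[OF W has_grad_ev[OF g(2)]])
      moreover have "has_grad (\<Sum>z\<in>X. c z * \<zeta> z) (\<lambda>j. \<Sum>z\<in>X. c z * W (\<zeta> z) j + \<zeta> z * W (c z) j)"
        by (intro has_grad_sum has_grad_mult W)
      ultimately have "has_grad 0 w"
        unfolding w_def using has_grad_diff s(2) by fastforce
      then have "H w \<in> q"
        unfolding H_def by (rule has_grad_0_orthogonal[OF _ qI]) (use h in auto)
      moreover have "H w = s * H v + (ev x g * H (W s) - (\<Sum>z\<in>X. c z * H (W (\<zeta> z)) + \<zeta> z * H (W (c z))))"
      proof -
        have "H (\<lambda>j. \<Sum>z\<in>X. c z * W (\<zeta> z) j + \<zeta> z * W (c z) j) = (\<Sum>z\<in>X. c z * H (W (\<zeta> z)) + \<zeta> z * H (W (c z)))"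
          unfolding H_def sum_distrib_left
          by (subst sum.swap) (simp add: sum_distrib_left sum.distrib algebra_simps)
        moreover have "H w = s * H v + ev x g * H (W s) - H (\<lambda>j. \<Sum>z\<in>X. c z * W (\<zeta> z) j + \<zeta> z * W (c z) j)"
          unfolding H_def w_def right_diff_distrib sum_subtractf
          by (simp add: distrib_left sum.distrib sum_distrib_left mult.left_commute)
        ultimately show ?thesis by simp
      qed
      moreover have "ev x g * H (W s) - (\<Sum>z\<in>X. c z * H (W (\<zeta> z)) + \<zeta> z * H (W (c z))) \<in> q"
      proof (intro ideal_diff[OF qI] ideal_sum[OF qI] ideal_add[OF qI])
        show "ev x g * H (W s) \<in> q" by (rule ideal_mult_right[OF qI g(3)])
        fix z assume z: "z \<in> X"
        then show "\<zeta> z * H (W (c z)) \<in> q" by (intro ideal_mult_right[OF qI] \<zeta>)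
        show "c z * H (W (\<zeta> z)) \<in> q"
          unfolding H_def using h z by (intro ideal_mult_left[OF qI]) auto
      qed
      ultimately have "s * H v \<in> q" using ideal_add_iff[OF qI] by metis
      then show "(\<Sum>t<n. h t * v t) \<in> q"
        using s(1) by (simp add: prime_mult[OF q] H_def)
    qed
  qed
  \<comment> \<open>Of the rank \<open>n - card Jq\<close> the generators account for at most
    \<open>card X\<close>, and the hypothesis leaves at least \<open>r\<close>.\<close>
  from has_minor_bipolar[OF has_minor_tr_basis[OF q Jq] this]
  have "has_minor q n (row_set Jac) (n - card Jq - card ((\<lambda>z. W (\<zeta> z)) ` X))"
    by (intro has_minor_drop[OF qI]) (use X in auto)
  then show ?thesis
    by (rule has_minor_le[OF qI]) (use card card_image_le[OF X, of "\<lambda>z. W (\<zeta> z)"] r_le_n in linarith)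
qed

lemma tr_basis_exists:
  assumes "is_prime p"
  shows "\<exists>J. tr_basis n p x J"
  using tr_basis_extend[OF assms free_empty[OF assms], of n x] by auto

text \<open>Up to units the elements of the ring are values of polynomials, so the element
  separating the two primes may be taken to be such a value.\<close>

lemma tr_basis_card_less':
  assumes p: "is_prime p" and q: "is_prime q" and "p \<subset> q"
    and J: "tr_basis n p x Jp" "tr_basis n q x Jq"
  shows "card Jq < card Jp"
proof -
  obtain b where b: "b \<in> q" "b \<notin> p" using \<open>p \<subset> q\<close> by auto
  obtain g s where g: "g \<in> poly_vars {..<n}" "ev x s dvd 1" "b * ev x s = ev x g"
    using fraction by blast
  have "ev x s \<notin> p"
  proof
    assume "ev x s \<in> p"
    moreover obtain u where "1 = ev x s * u" using g(2) by (auto elim: dvdE)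
    ultimately have "1 \<in> p" using ideal_mult_right[OF is_prime_ideal[OF p]] by metis
    then show False using prime_one[OF p] by simp
  qed
  then have "ev x g \<notin> p" "ev x g \<in> q"
    unfolding g(3)[symmetric] using b by (auto simp: prime_mult[OF p] prime_mult[OF q])
  then show ?thesis
    using tr_basis_card_less[OF p q _ g(1) _ _ J] \<open>p \<subset> q\<close> by blast
qed

end

section \<open>Localization at a prime ideal\<close>

context
  fixes q :: "'a::idom set"
  assumes q: "is_prime q"
begin

private lemma q0: "s \<notin> q \<Longrightarrow> s \<noteq> 0"
  using prime_zero[OF q] by auto

private lemma q1: "1 \<notin> q"
  using prime_one[OF q] .

lemma localization_at_simps:
  "carrier (localization_at q) = {Fract a s | a s. s \<notin> q}"
  "mult (localization_at q) = (*)" "add (localization_at q) = (+)"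
  "\<one>\<^bsub>localization_at q\<^esub> = 1" "\<zero>\<^bsub>localization_at q\<^esub> = 0"
  by (simp_all add: localization_at_def)

lemma Fract_in_localization: "s \<notin> q \<Longrightarrow> Fract a s \<in> carrier (localization_at q)"
  by (auto simp: localization_at_simps)

lemma localization_at_ideal_closed:
  assumes "ideal P (localization_at q)"
  shows "F \<in> P \<Longrightarrow> G \<in> P \<Longrightarrow> F + G \<in> P"
    and "F \<in> P \<Longrightarrow> s \<notin> q \<Longrightarrow> Fract a s * F \<in> P" and "0 \<in> P"
proof -
  interpret ideal P "localization_at q" by fact
  show "F + G \<in> P" if "F \<in> P" "G \<in> P" using subgroup.m_closed[OF a_subgroup that] by (simp add: localization_at_simps)
  show "Fract a s * F \<in> P" if "F \<in> P" "s \<notin> q"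
    using I_l_closed[OF that(1) Fract_in_localization[OF that(2), of a]] by (simp add: localization_at_simps)
  show "0 \<in> P" using subgroup.one_closed[OF a_subgroup] by (simp add: localization_at_simps)
qed

lemma localization_at_idealI:
  assumes R: "ring (localization_at q)" and sub: "P \<subseteq> carrier (localization_at q)" and "0 \<in> P"
    and add: "\<And>F G. F \<in> P \<Longrightarrow> G \<in> P \<Longrightarrow> F + G \<in> P"
    and mult: "\<And>F a s. F \<in> P \<Longrightarrow> s \<notin> q \<Longrightarrow> Fract a s * F \<in> P"
  shows "ideal P (localization_at q)"
proof (rule idealI[OF R])
  interpret ring "localization_at q" by (rule R)
  show "subgroup P (add_monoid (localization_at q))"
  proof (rule subgroup.intro)
    fix F assume F: "F \<in> P"
    have "Fract (-1) 1 * F = - F" by (cases F) simp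
    then have *: "- F \<in> P" using mult[OF F q1, of "-1"] by simp
    then have "\<ominus>\<^bsub>localization_at q\<^esub> F = - F"
      using sub F by (intro minus_equality) (auto simp: localization_at_simps)
    then show "inv\<^bsub>add_monoid (localization_at q)\<^esub> F \<in> P"
      unfolding a_inv_def[symmetric] using * by simp
  qed (use assms in \<open>auto simp: localization_at_simps\<close>)
  show "G \<otimes>\<^bsub>localization_at q\<^esub> F \<in> P" "F \<otimes>\<^bsub>localization_at q\<^esub> G \<in> P"
    if "F \<in> P" "G \<in> carrier (localization_at q)" for F G
    using mult[OF that(1)] that(2) by (auto simp: localization_at_simps mult.commute)
qed

definition contraction :: "'a fract set \<Rightarrow> 'a set" where
  "contraction P = {a. Fract a 1 \<in> P}"

lemma contraction_prime:
  assumes "primeideal P (localization_at q)"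
  shows "is_prime (contraction P)" "contraction P \<subseteq> q"
proof -
  interpret primeideal P "localization_at q" by fact
  note cl = localization_at_ideal_closed[OF is_ideal]
  have one: "1 \<notin> P"
  proof
    assume "1 \<in> P"
    then have "carrier (localization_at q) \<subseteq> P"
      using cl(2)[of 1] by (auto simp: localization_at_simps)
    then show False using I_notcarr a_subset by auto
  qed
  have "Fract (a + b) 1 = Fract a 1 + Fract b 1" "Fract (a * b) 1 = Fract a 1 * Fract b 1" for a b :: 'a
    by simp_all
  moreover have "Fract a 1 \<in> P \<or> Fract b 1 \<in> P" if "Fract a 1 * Fract b 1 \<in> P" for a b
    using I_prime[OF Fract_in_localization[OF q1, of a] Fract_in_localization[OF q1, of b]] that
    by (simp add: localization_at_simps)
  ultimately show "is_prime (contraction P)"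
    unfolding is_prime_def is_ideal_def contraction_def
    using cl(1,3) cl(2)[OF _ q1] one by (auto simp: Zero_fract_def One_fract_def simp del: add_fract mult_fract)
  show "contraction P \<subseteq> q"
  proof
    fix a assume a: "a \<in> contraction P"
    show "a \<in> q"
    proof (rule ccontr)
      assume "a \<notin> q"
      then have "Fract 1 a * Fract a 1 \<in> P" using a cl(2) by (simp add: contraction_def del: mult_fract)
      moreover have "Fract 1 a * Fract a 1 = 1" using q0[OF \<open>a \<notin> q\<close>] by (simp add: One_fract_def eq_fract)
      ultimately show False using one by simp
    qed
  qed
qed

text \<open>In the localization \<open>Fract a s\<close> and \<open>Fract a 1\<close> differ by a
  unit, so an ideal is determined by its contraction.\<close>

lemma contraction_strict_mono:
  assumes P: "ideal P (localization_at q)" and P': "ideal P' (localization_at q)" and "P \<subset> P'"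
  shows "contraction P \<subset> contraction P'"
proof -
  obtain F where F: "F \<in> P'" "F \<notin> P" using \<open>P \<subset> P'\<close> by auto
  have "F \<in> carrier (localization_at q)"
    using F(1) ideal.axioms(1)[OF P'] additive_subgroup.a_subset by blast
  then obtain a s where s: "s \<notin> q" "F = Fract a s" by (auto simp: localization_at_simps)
  have "Fract a 1 = Fract s 1 * F" using q0[OF s(1)] by (simp add: s(2) eq_fract)
  then have "a \<in> contraction P'"
    using localization_at_ideal_closed(2)[OF P' F(1) q1] by (simp add: contraction_def)
  moreover have "F = Fract 1 s * Fract a 1" using q0[OF s(1)] by (simp add: s(2))
  then have "a \<notin> contraction P"
    using localization_at_ideal_closed(2)[OF P _ s(1), of "Fract a 1" 1] F(2) by (auto simp: contraction_def)
  ultimately show ?thesis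
    using \<open>P \<subset> P'\<close> by (auto simp: contraction_def)
qed

text \<open>\<open>regular_local_ring\<close> asserts a single maximal ideal without naming it; this
  identifies it. Elements outside are invertible, so no proper ideal is larger.\<close>

lemma localization_at_maximal:
  assumes R: "ring (localization_at q)"
  shows "maximalideal {Fract a s | a s. a \<in> q \<and> s \<notin> q} (localization_at q)" (is "maximalideal ?M _")
proof (rule maximalidealI)
  note qI = is_prime_ideal[OF q]
  show "ideal ?M (localization_at q)"
  proof (rule localization_at_idealI[OF R])
    show "0 \<in> ?M" using ideal_zero[OF qI] q1 by (auto simp: Zero_fract_def)
    show "F + G \<in> ?M" if "F \<in> ?M" "G \<in> ?M" for F G
    proof -
      obtain a s b t where "F = Fract a s" "G = Fract b t" "a \<in> q" "b \<in> q" "s \<notin> q" "t \<notin> q"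
        using \<open>F \<in> ?M\<close> \<open>G \<in> ?M\<close> by auto
      moreover from this have "a * t + b * s \<in> q" "s * t \<notin> q"
        by (auto simp: prime_mult[OF q] intro!: ideal_add[OF qI] ideal_mult_right[OF qI])
      ultimately show ?thesis using q0 by auto
    qed
    show "Fract a s * F \<in> ?M" if "F \<in> ?M" "s \<notin> q" for F a s
      using that by (force simp: prime_mult[OF q])
  qed (auto simp: localization_at_simps)
  have one: "1 \<notin> ?M"
  proof
    assume "1 \<in> ?M"
    then obtain a s where "Fract 1 1 = Fract a s" "a \<in> q" "s \<notin> q" by (auto simp: One_fract_def)
    then show False using q0[of s] by (simp add: eq_fract)
  qed
  moreover have "1 \<in> carrier (localization_at q)"
    using Fract_in_localization[OF q1, of 1] by (simp add: One_fract_def)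
  ultimately show "carrier (localization_at q) \<noteq> ?M" by auto
  fix J assume J: "ideal J (localization_at q)" "?M \<subseteq> J" "J \<subseteq> carrier (localization_at q)"
  show "J = ?M \<or> J = carrier (localization_at q)"
  proof (cases "J \<subseteq> ?M")
    case False
    then obtain F where F: "F \<in> J" "F \<notin> ?M" by blast
    then obtain a s where as: "F = Fract a s" "s \<notin> q" using J(3) by (auto simp: localization_at_simps)
    then have "a \<notin> q" using F(2) by auto
    have "G \<in> J" if G: "G \<in> carrier (localization_at q)" for G
    proof -
      obtain b t where "G = Fract b t" "t \<notin> q" using G by (auto simp: localization_at_simps)
      moreover from this have "Fract (b * s) (t * a) * F \<in> J"
        using \<open>a \<notin> q\<close> by (intro localization_at_ideal_closed(2)[OF J(1) F(1)]) (simp add: prime_mult[OF q])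
      moreover have "Fract (b * s) (t * a) * F = Fract b t"
        using q0[OF as(2)] q0[OF \<open>a \<notin> q\<close>] q0[OF \<open>t \<notin> q\<close>] by (simp add: as(1) eq_fract)
      ultimately show ?thesis by simp
    qed
    then show ?thesis using J(3) by auto
  qed (use J(2) in auto)
qed

text \<open>Clearing denominators of the generators brings them into the form that
  \<open>jacobian_criterion\<close> expects.\<close>

lemma localization_at_generators:
  assumes R: "ring (localization_at q)" and X: "X \<subseteq> carrier (localization_at q)" "finite X"
    and max: "{Fract a s | a s. a \<in> q \<and> s \<notin> q} = Idl\<^bsub>localization_at q\<^esub> X"
  obtains \<zeta> where "\<And>z. z \<in> X \<Longrightarrow> \<zeta> z \<in> q"
    "\<And>b. b \<in> q \<Longrightarrow> \<exists>s c. s \<notin> q \<and> s * b = (\<Sum>z\<in>X. c z * \<zeta> z)"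
proof -
  have "\<forall>z\<in>X. \<exists>a s. z = Fract a s \<and> a \<in> q \<and> s \<notin> q"
    using ring.genideal_self[OF R X(1)] unfolding max[symmetric] by blast
  then obtain \<zeta> \<sigma> where \<zeta>: "\<And>z. z \<in> X \<Longrightarrow> z = Fract (\<zeta> z) (\<sigma> z) \<and> \<zeta> z \<in> q \<and> \<sigma> z \<notin> q"
    by metis
  \<comment> \<open>The elements that become combinations of the numerators after multiplication by
    some \<open>s\<close> outside \<open>q\<close> form an ideal; it contains \<open>X\<close>,
    hence the maximal ideal.\<close>
  define N where "N = {F \<in> carrier (localization_at q). \<exists>s c. s \<notin> q \<and> Fract s 1 * F = Fract (\<Sum>z\<in>X. c z * \<zeta> z) 1}"
  have "ideal N (localization_at q)"
  proof (rule localization_at_idealI[OF R])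
    show "N \<subseteq> carrier (localization_at q)" by (auto simp: N_def)
    show "0 \<in> N"
      using Fract_in_localization[OF q1, of 0] q1
      by (auto simp: N_def Zero_fract_def intro!: exI[of _ 1] exI[of _ "\<lambda>_. 0"])
  next
    fix F G assume "F \<in> N" "G \<in> N"
    then obtain s c s' c' where s: "s \<notin> q" "Fract s 1 * F = Fract (\<Sum>z\<in>X. c z * \<zeta> z) 1"
      and s': "s' \<notin> q" "Fract s' 1 * G = Fract (\<Sum>z\<in>X. c' z * \<zeta> z) 1"
      by (auto simp: N_def)
    have "Fract (s * s') 1 * (F + G) = Fract s' 1 * (Fract s 1 * F) + Fract s 1 * (Fract s' 1 * G)"
      by (simp only: distrib_left mult.assoc[symmetric] mult_fract mult.commute[of s'] mult_1)
    also have "\<dots> = Fract (\<Sum>z\<in>X. (s' * c z + s * c' z) * \<zeta> z) 1"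
      unfolding s s' by (simp add: sum_distrib_left sum.distrib algebra_simps)
    finally have eq: "Fract (s * s') 1 * (F + G) = \<dots>" .
    have "s * s' \<notin> q" using s(1) s'(1) by (simp add: prime_mult[OF q])
    with eq have "\<exists>s c. s \<notin> q \<and> Fract s 1 * (F + G) = Fract (\<Sum>z\<in>X. c z * \<zeta> z) 1"
      by (intro exI[of _ "s * s'"] exI[of _ "\<lambda>z. s' * c z + s * c' z"] conjI)
    moreover have "F + G \<in> carrier (localization_at q)"
      using ring.ring_simprules(1)[OF R, of F G] \<open>F \<in> N\<close> \<open>G \<in> N\<close> by (simp add: N_def localization_at_simps(3))
    ultimately show "F + G \<in> N" by (simp add: N_def)
  next
    fix F a t assume "F \<in> N" "t \<notin> q"
    then obtain s c where s: "s \<notin> q" "Fract s 1 * F = Fract (\<Sum>z\<in>X. c z * \<zeta> z) 1"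
      by (auto simp: N_def)
    have "Fract t 1 * Fract a t = Fract a 1" using q0[OF \<open>t \<notin> q\<close>] by (simp add: eq_fract)
    moreover have "Fract (s * t) 1 * (Fract a t * F) = (Fract t 1 * Fract a t) * (Fract s 1 * F)"
    proof -
      have "Fract (s * t) 1 = Fract t 1 * Fract s 1" by (simp add: mult.commute)
      then show ?thesis by (simp only: mult_ac)
    qed
    ultimately have eq: "Fract (s * t) 1 * (Fract a t * F) = Fract (\<Sum>z\<in>X. (a * c z) * \<zeta> z) 1"
      by (simp add: s sum_distrib_left mult.assoc)
    have "s * t \<notin> q" using s(1) \<open>t \<notin> q\<close> by (simp add: prime_mult[OF q])
    with eq have "\<exists>s c. s \<notin> q \<and> Fract s 1 * (Fract a t * F) = Fract (\<Sum>z\<in>X. c z * \<zeta> z) 1"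
      by (intro exI[of _ "s * t"] exI[of _ "\<lambda>z. a * c z"] conjI)
    moreover have "Fract a t * F \<in> carrier (localization_at q)"
      using ring.ring_simprules(5)[OF R, of "Fract a t" F] \<open>F \<in> N\<close> Fract_in_localization[OF \<open>t \<notin> q\<close>]
      by (simp add: N_def localization_at_simps(2))
    ultimately show "Fract a t * F \<in> N" by (simp add: N_def)
  qed
  moreover have "X \<subseteq> N"
  proof
    fix z assume z: "z \<in> X"
    have "Fract (\<sigma> z) 1 * z = Fract (\<zeta> z) 1"
      using \<zeta>[OF z] q0[of "\<sigma> z"] by (metis eq_fract(1) mult_fract mult.commute mult_1 one_neq_zero)
    also have "\<zeta> z = (\<Sum>z'\<in>X. (if z' = z then 1 else 0) * \<zeta> z')"
      using X(2) z by (simp add: if_distrib if_distribR sum.delta cong: if_cong)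
    finally have eq: "Fract (\<sigma> z) 1 * z = Fract (\<Sum>z'\<in>X. (if z' = z then 1 else 0) * \<zeta> z') 1" .
    have "\<sigma> z \<notin> q" using \<zeta>[OF z] by simp
    with eq have "\<exists>s c. s \<notin> q \<and> Fract s 1 * z = Fract (\<Sum>z\<in>X. c z * \<zeta> z) 1"
      by (intro exI[of _ "\<sigma> z"] exI[of _ "\<lambda>z'. if z' = z then 1 else 0"] conjI)
    then show "z \<in> N" using z X(1) unfolding N_def by blast
  qed
  ultimately have "Idl\<^bsub>localization_at q\<^esub> X \<subseteq> N"
    by (rule ring.genideal_minimal[OF R])
  then have N: "Fract b 1 \<in> N" if "b \<in> q" for b
    using that q1 unfolding max[symmetric] by auto
  have "\<exists>s c. s \<notin> q \<and> s * b = (\<Sum>z\<in>X. c z * \<zeta> z)" if "b \<in> q" for b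
    using N[OF that] by (auto simp: N_def eq_fract)
  then show thesis using that \<zeta> by blast
qed

end

section \<open>Dimension bound and minors at a prime of a regular domain\<close>

context presentation
begin

text \<open>Contracting a chain of primes of the localization gives a strict chain inside
  \<open>q\<close>. The sizes of transcendence bases fall strictly along it and lie between
  \<open>card Jq\<close> and \<open>n - r\<close>.\<close>

lemma krull_dim_localization_at:
  assumes q: "is_prime q" and Jq: "tr_basis n q x Jq"
  shows "krull_dim (localization_at q) \<le> enat (n - r - card Jq)"
  unfolding krull_dim_def
proof (rule SUP_least, clarify)
  fix ps :: "'a fract set list"
  assume ps: "ps \<noteq> []" "\<forall>p\<in>set ps. primeideal p (localization_at q)" "sorted_wrt (\<subset>) ps"
  define B where "B P = (SOME J. tr_basis n (contraction P) x J)" for P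
  have B: "tr_basis n (contraction P) x (B P)" if "P \<in> set ps" for P
    unfolding B_def
    using tr_basis_exists[OF contraction_prime(1)[OF q]] ps(2) that by (metis someI_ex)
  have le: "card Jp' \<le> card Jp"
    if "is_prime p" "is_prime p'" "p \<subseteq> p'" "tr_basis n p x Jp" "tr_basis n p' x Jp'" for p p' Jp Jp'
    using tr_basis_card_less'[OF that(1,2) _ that(4,5)] tr_basis_card_eq[OF that(1,4)] that(3,5)
    by (metis less_imp_le_nat order_refl psubsetI)
  have "sorted_wrt (>) (map (\<lambda>P. card (B P)) ps)"
    unfolding sorted_wrt_map
  proof (rule sorted_wrt_mono_rel[OF _ ps(3)])
    fix P P' assume P: "P \<in> set ps" "P' \<in> set ps" "P \<subset> P'"
    have "contraction P \<subset> contraction P'"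
      using contraction_strict_mono[OF q _ _ P(3)] P ps(2) primeideal.axioms(1) by blast
    then show "card (B P) > card (B P')"
      using tr_basis_card_less'[OF _ _ _ B[OF P(1)] B[OF P(2)]] contraction_prime(1)[OF q] P ps(2) by blast
  qed
  then have "distinct (map (\<lambda>P. card (B P)) ps)"
  proof -
    have "sorted_wrt (>) ks \<Longrightarrow> distinct ks" for ks :: "nat list"
      by (induction ks) auto
    then show "sorted_wrt (>) (map (\<lambda>P. card (B P)) ps) \<Longrightarrow> ?thesis" .
  qed
  then have "length ps = card (set (map (\<lambda>P. card (B P)) ps))"
    using distinct_card[of "map (\<lambda>P. card (B P)) ps"] by simp
  \<comment> \<open>The interval has one element more than the bound claimed, which matches the
    dimension being one less than the number of primes in a chain.\<close>
  also have "\<dots> \<le> card {card Jq..n - r}"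
  proof (rule card_mono)
    obtain J0 where J0: "tr_basis n {0} x J0" using tr_basis_exists[OF is_prime_zero] by blast
    show "set (map (\<lambda>P. card (B P)) ps) \<subseteq> {card Jq..n - r}"
    proof
      fix k assume "k \<in> set (map (\<lambda>P. card (B P)) ps)"
      then obtain P where P: "P \<in> set ps" "k = card (B P)" by auto
      have pr: "is_prime (contraction P)" "contraction P \<subseteq> q"
        using contraction_prime[OF q] P ps(2) by auto
      have "card Jq \<le> card (B P)" by (rule le[OF pr(1) q pr(2) B[OF P(1)] Jq])
      moreover have "card (B P) \<le> card J0"
        by (rule le[OF is_prime_zero pr(1) _ J0 B[OF P(1)]]) (simp add: prime_zero[OF pr(1)])
      ultimately show "k \<in> {card Jq..n - r}"
        using P tr_basis_zero_card[OF J0] by simp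
    qed
  qed simp
  finally show "enat (length ps - 1) \<le> enat (n - r - card Jq)" by simp
qed

text \<open>Regularity gives as many generators of the maximal ideal as the dimension, and the
  dimension bound makes them few enough for \<open>jacobian_criterion\<close>.\<close>

theorem regular_minor_notin:
  assumes "regular_domain TYPE('a)" and q: "is_prime q"
  obtains i j where "i \<in> index_sets m r" "j \<in> index_sets n r" "minor Jac i j \<notin> q"
proof -
  have "primeideal q (class_ring :: 'a ring)"
  proof (rule primeidealI)
    show "ideal q (class_ring :: 'a ring)" using is_prime_ideal[OF q] by (simp add: class_ring_ideal_iff)
    show "carrier class_ring \<noteq> q" using prime_one[OF q] by auto
  qed (use prime_mult[OF q] class_cring.cring_axioms in auto)
  then have reg: "regular_local_ring (localization_at q)"
    using assms(1) by (simp add: regular_domain_def)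
  then have R: "ring (localization_at q)"
    by (simp add: regular_local_ring_def cring_def)
  obtain M X where M: "{M. maximalideal M (localization_at q)} = {M}"
    and X: "X \<subseteq> carrier (localization_at q)" "finite X" "M = Idl\<^bsub>localization_at q\<^esub> X"
      "enat (card X) = krull_dim (localization_at q)"
    using reg by (auto simp: regular_local_ring_def)
  have "{Fract a s | a s. a \<in> q \<and> s \<notin> q} = Idl\<^bsub>localization_at q\<^esub> X"
  proof -
    have "{Fract a s | a s. a \<in> q \<and> s \<notin> q} \<in> {M. maximalideal M (localization_at q)}"
      using localization_at_maximal[OF q R] by (rule CollectI)
    then show ?thesis unfolding M X(3) by (rule singletonD)
  qed
  from localization_at_generators[OF q R X(1,2) this]
  obtain \<zeta> where \<zeta>: "\<And>z. z \<in> X \<Longrightarrow> \<zeta> z \<in> q"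
    "\<And>b. b \<in> q \<Longrightarrow> \<exists>s c. s \<notin> q \<and> s * b = (\<Sum>z\<in>X. c z * \<zeta> z)" by blast
  obtain Jq where Jq: "tr_basis n q x Jq" using tr_basis_exists[OF q] by blast
  obtain J0 where J0: "tr_basis n {0} x J0" using tr_basis_exists[OF is_prime_zero] by blast
  \<comment> \<open>Subtraction is truncated, so \<open>card X \<le> n - r - card Jq\<close> gives
    the required sum only together with this bound.\<close>
  have "card Jq \<le> n - r"
  proof (cases "q = {0}")
    case True
    then show ?thesis using tr_basis_zero_card Jq by simp
  next
    case False
    then have "{0} \<subset> q" using prime_zero[OF q] by auto
    then show ?thesis
      using tr_basis_card_less'[OF is_prime_zero q _ J0 Jq] tr_basis_zero_card[OF J0] by simp
  qed
  moreover have "card X \<le> n - r - card Jq"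
    using krull_dim_localization_at[OF q Jq] unfolding X(4)[symmetric] by simp
  ultimately have "card X + card Jq \<le> n - r" by simp
  from jacobian_criterion[OF q X(2) \<zeta>(2,1) Jq this]
  have "has_minor q (dim_col Jac) (row_set Jac) r" by simp
  then obtain i j where "i \<in> index_sets (dim_row Jac) r" "j \<in> index_sets (dim_col Jac) r" "minor Jac i j \<notin> q"
    by (rule has_minor_row_set_minor[OF is_prime_ideal[OF q]])
  then show thesis using that by simp
qed

end

section \<open>Presentations of localized quotients\<close>

text \<open>Cosets and \<open>\<phi>\<close> respect the operations on the carrier of
  \<open>poly_ring n\<close>, so the induction has to stay inside
  \<open>poly_vars V\<close>.\<close>

lemma poly_vars_induct [consumes 1, case_names const var add mult]:
  fixes g :: "'k::comm_ring_1 mpoly"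
  assumes g: "g \<in> poly_vars V" and const: "\<And>c. P (pconst c)" and var: "\<And>i. i \<in> V \<Longrightarrow> P (pvar i)"
    and add: "\<And>g h. g \<in> poly_vars V \<Longrightarrow> h \<in> poly_vars V \<Longrightarrow> P g \<Longrightarrow> P h \<Longrightarrow> P (g + h)"
    and mult: "\<And>g h. g \<in> poly_vars V \<Longrightarrow> h \<in> poly_vars V \<Longrightarrow> P g \<Longrightarrow> P h \<Longrightarrow> P (g * h)"
  shows "P g"
proof -
  let ?S = "{g \<in> poly_vars V. P g}"
  have S_const: "pconst c \<in> ?S" for c using const by simp
  have S_mult: "g * h \<in> ?S" if "g \<in> ?S" "h \<in> ?S" for g h using that mult by (simp add: poly_vars_mult)
  have S_add: "g + h \<in> ?S" if "g \<in> ?S" "h \<in> ?S" for g h using that add by (simp add: poly_vars_add)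
  have one: "(1 :: 'k mpoly) \<in> ?S" using S_const[of 1] by (simp add: pconst_def)
  have pow: "h ^ k \<in> ?S" if "h \<in> ?S" for h k
  proof (induction k)
    case (Suc k)
    show ?case unfolding power_Suc by (rule S_mult[OF that Suc])
  qed (use one in simp)
  have mon: "Poly_Mapping.single (\<Sum>i\<in>T. Poly_Mapping.single i (k i)) 1 \<in> ?S" if "finite T" "T \<subseteq> V" for T k
    using that
  proof (induction T rule: finite_induct)
    case (insert i T)
    have "Poly_Mapping.single (\<Sum>i\<in>insert i T. Poly_Mapping.single i (k i)) 1 =
        pvar i ^ k i * Poly_Mapping.single (\<Sum>i\<in>T. Poly_Mapping.single i (k i)) (1::'k)"
      using insert by (simp add: pvar_power mult_single)
    moreover have "pvar i \<in> ?S" using insert.prems var by (auto intro: poly_vars_pvar)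
    ultimately show ?case using S_mult pow insert by simp
  qed (use one in simp)
  have single: "Poly_Mapping.single t (Poly_Mapping.lookup g t) \<in> ?S" if t: "t \<in> Poly_Mapping.keys g" for t
  proof -
    have "t = (\<Sum>i\<in>Poly_Mapping.keys t. Poly_Mapping.single i (Poly_Mapping.lookup t i))"
      by (rule poly_mapping_eqI) (auto simp: lookup_sum lookup_single when_def in_keys_iff sum.delta)
    then have "Poly_Mapping.single t (Poly_Mapping.lookup g t) = pconst (Poly_Mapping.lookup g t) *
        Poly_Mapping.single (\<Sum>i\<in>Poly_Mapping.keys t. Poly_Mapping.single i (Poly_Mapping.lookup t i)) 1"
      by (simp add: pconst_def mult_single)
    moreover have "Poly_Mapping.keys t \<subseteq> V" using g t by (auto simp: poly_vars_def)
    ultimately show ?thesis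
      using S_mult[OF S_const mon[OF finite_keys, of t], of "Poly_Mapping.lookup g t" "Poly_Mapping.lookup t"]
      by (simp only:)
  qed
  have "(\<Sum>t\<in>T. Poly_Mapping.single t (Poly_Mapping.lookup g t)) \<in> ?S" if "finite T" "T \<subseteq> Poly_Mapping.keys g" for T
    using that
  proof (induction T rule: finite_induct)
    case empty
    show ?case using S_const[of 0] by (simp add: pconst_def)
  next
    case (insert t T)
    then show ?case using S_add[OF single[of t]] by simp
  qed
  from this[of "Poly_Mapping.keys g"]
  have "(\<Sum>t\<in>Poly_Mapping.keys g. Poly_Mapping.single t (Poly_Mapping.lookup g t)) \<in> ?S" by simp
  moreover have "(\<Sum>t\<in>Poly_Mapping.keys g. Poly_Mapping.single t (Poly_Mapping.lookup g t)) = g"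
    by (rule poly_mapping_eqI) (auto simp: lookup_sum lookup_single when_def in_keys_iff sum.delta)
  ultimately show ?thesis by simp
qed

lemma poly_ring_simps:
  "mult (poly_ring n) = (*)" "add (poly_ring n) = (+)" "\<one>\<^bsub>poly_ring n\<^esub> = 1" "\<zero>\<^bsub>poly_ring n\<^esub> = 0"
  by (simp_all add: poly_ring_def)

lemma genideal_poly_ring_combination:
  fixes f :: "nat \<Rightarrow> 'k::comm_ring_1 mpoly"
  assumes R: "ring (poly_ring n :: 'k mpoly ring)" and f: "\<And>i. i < m \<Longrightarrow> f i \<in> carrier (poly_ring n)"
    and g: "g \<in> Idl\<^bsub>poly_ring n\<^esub> (f ` {..<m})"
  shows "\<exists>a. g = (\<Sum>i<m. a i * f i)"
proof -
  interpret ring "poly_ring n :: 'k mpoly ring" by (rule R)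
  define N where "N = {g \<in> carrier (poly_ring n). \<exists>a. g = (\<Sum>i<m. a i * f i)}"
  have minus: "\<ominus>\<^bsub>poly_ring n\<^esub> g = - g" if "g \<in> carrier (poly_ring n)" for g :: "'k mpoly"
    using that by (intro minus_equality) (auto simp: poly_ring_simps carrier_poly_ring poly_vars_uminus)
  have N_mult: "h * g \<in> N" if gN: "g \<in> N" "h \<in> carrier (poly_ring n)" for g h
  proof -
    obtain a where a: "g = (\<Sum>i<m. a i * f i)" using gN(1) by (auto simp: N_def)
    have "h * g = (\<Sum>i<m. (h * a i) * f i)"
      by (simp add: a sum_distrib_left mult.assoc)
    then have "\<exists>a. h * g = (\<Sum>i<m. a i * f i)" by (rule exI[of _ "\<lambda>i. h * a i"])
    then show ?thesis using gN by (simp add: N_def carrier_poly_ring poly_vars_mult)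
  qed
  have "ideal N (poly_ring n)"
  proof (rule idealI[OF R])
    show "subgroup N (add_monoid (poly_ring n))"
    proof (rule subgroup.intro)
      fix g h assume "g \<in> N" "h \<in> N"
      then obtain a b where ab: "g = (\<Sum>i<m. a i * f i)" "h = (\<Sum>i<m. b i * f i)" by (auto simp: N_def)
      have "g + h = (\<Sum>i<m. (a i + b i) * f i)"
        unfolding ab by (simp add: distrib_right sum.distrib)
      then have "\<exists>a. g + h = (\<Sum>i<m. a i * f i)" by (rule exI[of _ "\<lambda>i. a i + b i"])
      then show "g \<otimes>\<^bsub>add_monoid (poly_ring n)\<^esub> h \<in> N"
        using \<open>g \<in> N\<close> \<open>h \<in> N\<close> by (simp add: N_def poly_ring_simps carrier_poly_ring poly_vars_add)
    next
      fix g assume "g \<in> N"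
      then have "- 1 * g \<in> N"
        by (rule N_mult) (simp add: carrier_poly_ring poly_vars_uminus)
      then show "inv\<^bsub>add_monoid (poly_ring n)\<^esub> g \<in> N"
        using \<open>g \<in> N\<close> minus[of g] unfolding a_inv_def[symmetric] by (simp add: N_def)
    next
      have "\<exists>a. 0 = (\<Sum>i<m. a i * f i)" by (rule exI[of _ "\<lambda>_. 0"]) simp
      then show "\<one>\<^bsub>add_monoid (poly_ring n)\<^esub> \<in> N"
        by (simp add: N_def poly_ring_simps carrier_poly_ring)
    qed (auto simp: N_def)
  qed (use N_mult in \<open>auto simp: poly_ring_simps mult.commute\<close>)
  moreover have "f ` {..<m} \<subseteq> N"
  proof
    fix g assume "g \<in> f ` {..<m}"
    then obtain i where i: "i < m" "g = f i" by auto
    have "g = (\<Sum>j<m. (if j = i then 1 else 0) * f j)"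
      using i by (simp add: if_distrib if_distribR sum.delta cong: if_cong)
    then have "\<exists>a. g = (\<Sum>i<m. a i * f i)" by (rule exI[of _ "\<lambda>j. if j = i then 1 else 0"])
    then show "g \<in> N" using f i by (simp add: N_def)
  qed
  ultimately have "Idl\<^bsub>poly_ring n\<^esub> (f ` {..<m}) \<subseteq> N"
    by (rule genideal_minimal)
  then show ?thesis using g by (auto simp: N_def)
qed

lemma (in K_algebra) scale_one_mult: "scale a 1 * b = scale a b"
  using scale_mult_left[of a 1 b] by simp

text \<open>Elements of \<open>S\<close> become units, so none of them is zero, and in the domain
  P_n/I they are not zero divisors. Hence \<open>\<phi>\<close> is injective on the quotient, and a
  polynomial in \<open>n\<close> variables evaluates to 0 exactly if it lies in
  \<open>I\<close>.\<close>

lemma localization_presentation: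
  fixes scale :: "'k::field_char_0 \<Rightarrow> 'a::idom \<Rightarrow> 'a"
  assumes alg: "K_algebra scale"
    and f: "\<And>i. i < m \<Longrightarrow> f i \<in> carrier (poly_ring n)"
    and I: "I = Idl\<^bsub>poly_ring n\<^esub> (f ` {..<m})"
    and prime: "primeideal I (poly_ring n)"
    and loc: "is_localization (poly_ring n Quot I) S (class_ring :: 'a ring) \<phi>"
    and K_linear: "\<And>c. \<phi> (I +>\<^bsub>poly_ring n\<^esub> pconst c) = scale c 1"
    and x: "x = (\<lambda>j. \<phi> (I +>\<^bsub>poly_ring n\<^esub> pvar j))"
  shows "presentation (\<lambda>c. scale c 1) n m f x"
    and "\<And>g. g \<in> poly_vars {..<n} \<Longrightarrow> \<phi> (I +>\<^bsub>poly_ring n\<^esub> g) = evaluation.ev (\<lambda>c. scale c 1) x g"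
proof -
  interpret K_algebra scale by (rule alg)
  interpret evaluation "\<lambda>c. scale c 1"
  proof
    show "scale (a * b) 1 = scale a 1 * scale b 1" for a b
      by (simp add: scale_one_mult)
  qed (simp_all add: scale_left_distrib)
  interpret I: primeideal I "poly_ring n" by (rule prime)
  let ?R = "poly_ring n :: 'k mpoly ring"
  let ?Q = "?R Quot I"
  define \<psi> where "\<psi> g = \<phi> (I +>\<^bsub>?R\<^esub> g)" for g
  have R: "ring ?R" by (rule I.ring_axioms)
  interpret Q: domain ?Q by (rule I.quotient_is_domain)
  have \<phi>: "\<phi> \<in> Ring.ring_hom ?Q (class_ring :: 'a ring)" and S: "submonoid S ?Q"
    and S_unit: "\<And>s. s \<in> S \<Longrightarrow> \<phi> s \<in> Units (class_ring :: 'a ring)"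
    and frac: "\<And>a. \<exists>p\<in>carrier ?Q. \<exists>s\<in>S. a * \<phi> s = \<phi> p"
    and ker: "\<And>p. p \<in> carrier ?Q \<Longrightarrow> \<phi> p = 0 \<longleftrightarrow> (\<exists>s\<in>S. s \<otimes>\<^bsub>?Q\<^esub> p = \<zero>\<^bsub>?Q\<^esub>)"
    using loc by (auto simp: is_localization_def)
  have coset: "I +>\<^bsub>?R\<^esub> g \<in> carrier ?Q" if "g \<in> carrier ?R" for g
    using ring_hom_closed[OF I.rcos_ring_hom that] .
  have \<psi>: "\<psi> (g + h) = \<psi> g + \<psi> h" "\<psi> (g * h) = \<psi> g * \<psi> h" if "g \<in> carrier ?R" "h \<in> carrier ?R" for g h
    using ring_hom_add[OF I.rcos_ring_hom that] ring_hom_mult[OF I.rcos_ring_hom that]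
      ring_hom_add[OF \<phi> coset coset, OF that] ring_hom_mult[OF \<phi> coset coset, OF that]
    by (simp_all add: \<psi>_def poly_ring_simps)
  have \<psi>_ev: "\<psi> g = ev x g" if "g \<in> poly_vars {..<n}" for g
    using that
  proof (induction g rule: poly_vars_induct)
    case (const c)
    show ?case by (simp add: \<psi>_def K_linear)
  next
    case (var i)
    show ?case by (simp add: \<psi>_def x)
  qed (simp_all add: \<psi> carrier_poly_ring ev_add ev_mult)
  then show "\<And>g. g \<in> poly_vars {..<n} \<Longrightarrow> \<phi> (I +>\<^bsub>?R\<^esub> g) = ev x g"
    by (simp add: \<psi>_def)
  have zero: "\<phi> \<zero>\<^bsub>?Q\<^esub> = 0"
    using ring_hom_zero[OF \<phi> Q.ring_axioms class_ring_ring] by simp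
  have S_carrier: "S \<subseteq> carrier ?Q" using S by (simp add: submonoid_def)
  have S_nz: "s \<noteq> \<zero>\<^bsub>?Q\<^esub>" if "s \<in> S" for s
  proof
    assume "s = \<zero>\<^bsub>?Q\<^esub>"
    then have "0 \<in> Units (class_ring :: 'a ring)" using S_unit[OF that] zero by simp
    then show False by (auto simp: Units_def)
  qed
  have \<psi>_0: "\<psi> g = 0 \<longleftrightarrow> g \<in> I" if g: "g \<in> carrier ?R" for g
  proof
    assume "\<psi> g = 0"
    then obtain s where s: "s \<in> S" "s \<otimes>\<^bsub>?Q\<^esub> (I +>\<^bsub>?R\<^esub> g) = \<zero>\<^bsub>?Q\<^esub>"
      using ker[OF coset[OF g]] by (auto simp: \<psi>_def)
    then have "I +>\<^bsub>?R\<^esub> g = \<zero>\<^bsub>?Q\<^esub>"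
      using Q.integral[OF s(2) _ coset[OF that]] S_carrier S_nz[OF s(1)] by blast
    then have "I +>\<^bsub>?R\<^esub> g = I" by (simp add: FactRing_def)
    then show "g \<in> I" using I.rcos_const_imp_mem[OF that] by blast
  next
    assume "g \<in> I"
    then have "I +>\<^bsub>?R\<^esub> g = \<zero>\<^bsub>?Q\<^esub>"
      using ring.a_rcos_zero[OF R I.is_ideal] by (simp add: FactRing_def)
    then show "\<psi> g = 0" using zero by (simp add: \<psi>_def)
  qed
  show "presentation (\<lambda>c. scale c 1) n m f x"
  proof unfold_locales
    show f_vars: "f i \<in> poly_vars {..<n}" if "i < m" for i
      using f[OF that] by (simp add: carrier_poly_ring)
    show "ev x (f i) = 0" if "i < m" for i
    proof -
      have "f ` {..<m} \<subseteq> I"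
        unfolding I by (rule ring.genideal_self[OF R]) (use f in auto)
      then have "\<psi> (f i) = 0" using \<psi>_0[OF f[OF that]] that by auto
      then show ?thesis using \<psi>_ev[OF f_vars[OF that]] by simp
    qed
    show "\<exists>a. g = (\<Sum>i<m. a i * f i)" if "g \<in> poly_vars {..<n}" "ev x g = 0" for g
    proof -
      have "g \<in> I" using \<psi>_0[of g] \<psi>_ev[of g] that by (simp add: carrier_poly_ring)
      then have "g \<in> Idl\<^bsub>poly_ring n\<^esub> (f ` {..<m})" unfolding I .
      from genideal_poly_ring_combination[OF R _ this] f show ?thesis by blast
    qed
    show "\<exists>g\<in>poly_vars {..<n}. \<exists>s\<in>poly_vars {..<n}. ev x s dvd 1 \<and> b * ev x s = ev x g" for b
    proof -
      obtain P s where Ps: "P \<in> carrier ?Q" "s \<in> S" "b * \<phi> s = \<phi> P" using frac by blast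
      obtain g where g: "g \<in> carrier ?R" "P = I +>\<^bsub>?R\<^esub> g"
        using Ps(1) by (auto simp: FactRing_def A_RCOSETS_def')
      obtain t where t: "t \<in> carrier ?R" "s = I +>\<^bsub>?R\<^esub> t"
        using Ps(2) S_carrier by (auto simp: FactRing_def A_RCOSETS_def')
      have "\<psi> t dvd 1"
        using S_unit[OF Ps(2)] by (auto simp: Units_def t \<psi>_def dvd_def mult.commute)
      moreover have "b * \<psi> t = \<psi> g" using Ps(3) by (simp add: \<psi>_def g t)
      ultimately show ?thesis
        using g(1) t(1) \<psi>_ev by (auto simp: carrier_poly_ring)
    qed
  qed
qed

section \<open>The kernel of the Jacobian matrix\<close>

text \<open>By Zorn there is a maximal ideal among those that contain \<open>Q\<close> but not 1.
  Together with any \<open>a\<close> outside it generates 1, which yields primality.\<close>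

lemma prime_containing_ideal:
  fixes Q :: "'a::comm_ring_1 set"
  assumes "is_ideal Q" "Q \<noteq> UNIV"
  obtains p where "is_prime p" "Q \<subseteq> p"
proof -
  let ?A = "{P. is_ideal P \<and> Q \<subseteq> P \<and> 1 \<notin> P}"
  have "1 \<notin> Q"
  proof
    assume "1 \<in> Q"
    then have "a \<in> Q" for a using ideal_mult_left[OF assms(1), of 1 a] by simp
    then show False using assms(2) by blast
  qed
  then have "?A \<noteq> {}" using assms(1) by blast
  moreover have "\<Union>\<C> \<in> ?A" if C: "\<C> \<noteq> {}" "subset.chain ?A \<C>" for \<C>
  proof -
    have mem: "is_ideal P" "Q \<subseteq> P" "1 \<notin> P" if "P \<in> \<C>" for P
      using C(2) that by (auto simp: subset.chain_def)
    have "a + b \<in> \<Union>\<C>" if ab: "a \<in> \<Union>\<C>" "b \<in> \<Union>\<C>" for a b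
    proof -
      obtain P P' where P: "P \<in> \<C>" "a \<in> P" "P' \<in> \<C>" "b \<in> P'" using ab by blast
      then have "P \<subseteq> P' \<or> P' \<subseteq> P" using C(2) by (meson subset_chain_def)
      then show ?thesis using P mem(1) ideal_add by blast
    qed
    moreover have "a * b \<in> \<Union>\<C>" if "b \<in> \<Union>\<C>" for a b
      using that mem(1) ideal_mult_left by blast
    moreover have "0 \<in> \<Union>\<C>" using C(1) mem(1) ideal_zero by blast
    ultimately have "is_ideal (\<Union>\<C>)" by (simp add: is_ideal_def)
    then show ?thesis using C(1) mem by blast
  qed
  ultimately obtain p where p: "p \<in> ?A" "\<And>P. P \<in> ?A \<Longrightarrow> p \<subseteq> P \<Longrightarrow> P = p"
    using subset_Zorn_nonempty[of ?A] by (metis (no_types, lifting))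
  have pI: "is_ideal p" using p(1) by simp
  have unit: "\<exists>s t. t \<in> p \<and> s * a + t = 1" if "a \<notin> p" for a
  proof -
    let ?P = "{s * a + t | s t. t \<in> p}"
    have "is_ideal ?P"
      unfolding is_ideal_def
    proof (intro conjI ballI allI)
      show "0 \<in> ?P" using ideal_zero[OF pI] by (intro CollectI exI[of _ 0]) simp
    next
      fix u v assume "u \<in> ?P" "v \<in> ?P"
      then obtain s t s' t' where "u = s * a + t" "v = s' * a + t'" "t \<in> p" "t' \<in> p" by blast
      then have "u + v = (s + s') * a + (t + t')" "t + t' \<in> p"
        using ideal_add[OF pI] by (auto simp: algebra_simps)
      then show "u + v \<in> ?P" by blast
    next
      fix c v assume "v \<in> ?P"
      then obtain s t where "v = s * a + t" "t \<in> p" by blast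
      then have "c * v = (c * s) * a + c * t" "c * t \<in> p"
        using ideal_mult_left[OF pI] by (simp_all add: distrib_left mult.assoc)
      then show "c * v \<in> ?P" by blast
    qed
    moreover have sub: "p \<subseteq> ?P"
    proof
      fix t assume "t \<in> p"
      then show "t \<in> ?P" by (intro CollectI exI[of _ 0] exI[of _ t]) simp
    qed
    moreover have "a \<in> ?P" using ideal_zero[OF pI] by (intro CollectI exI[of _ 1] exI[of _ 0]) simp
    ultimately have "1 \<in> ?P"
      using p(2)[of ?P] p(1) that by blast
    then obtain s t where "1 = s * a + t" "t \<in> p" by blast
    then show ?thesis by metis
  qed
  have "is_prime p"
    unfolding is_prime_def
  proof (intro conjI allI impI)
    fix a b assume "a * b \<in> p"
    show "a \<in> p \<or> b \<in> p"
    proof (rule ccontr)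
      assume "\<not> (a \<in> p \<or> b \<in> p)"
      then obtain s t where st: "t \<in> p" "s * a + t = 1" using unit by blast
      have "b = (s * a + t) * b" by (simp add: st(2))
      also have "\<dots> = s * (a * b) + b * t" by (simp add: algebra_simps)
      also have "\<dots> \<in> p"
        by (rule ideal_add[OF pI ideal_mult_left[OF pI \<open>a * b \<in> p\<close>] ideal_mult_left[OF pI st(1)]])
      finally show False using \<open>\<not> (a \<in> p \<or> b \<in> p)\<close> by simp
    qed
  qed (use p(1) in auto)
  then show thesis using that p(1) by blast
qed

section \<open>Kernel vectors and their rank\<close>

context presentation
begin

text \<open>Coordinates from \<open>n\<close> on are left free, here as in
  \<open>row_span\<close>.\<close>

definition ker :: "(nat \<Rightarrow> 'a) set" where
  "ker = {v. \<forall>i<m. (\<Sum>t<n. row_fun Jac i t * v t) = 0}"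

lemma ker_add: "v \<in> ker \<Longrightarrow> w \<in> ker \<Longrightarrow> (\<lambda>t. v t + w t) \<in> ker"
  by (simp add: ker_def distrib_left sum.distrib)

lemma ker_mult: "v \<in> ker \<Longrightarrow> (\<lambda>t. b * v t) \<in> ker"
  by (simp add: ker_def mult.left_commute[of _ b] flip: sum_distrib_left)

lemma ker_sum: "(\<And>l. l \<in> X \<Longrightarrow> v l \<in> ker) \<Longrightarrow> (\<lambda>t. \<Sum>l\<in>X. v l t) \<in> ker"
  by (induction X rule: infinite_finite_induct) (auto intro: ker_add, auto simp: ker_def)

text \<open>Bordering an \<open>r\<close>-minor by a further row of the Jacobian matrix gives a
  minor of size \<open>Suc r\<close>, which vanishes because \<open>r\<close> is the rank; so the
  Cramer vector lies in the kernel.\<close>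

lemma ker_cramer:
  assumes a: "\<And>s. s < r \<Longrightarrow> a s < m" and c: "\<And>s. s < r \<Longrightarrow> c s < n"
    and l: "l < n" "l \<notin> c ` {..<r}"
  shows "\<exists>h\<in>ker. h l = gdet r (\<lambda>s. row_fun Jac (a s)) c \<and> (\<forall>t. t \<noteq> l \<longrightarrow> t \<notin> c ` {..<r} \<longrightarrow> h t = 0)"
proof -
  let ?u = "\<lambda>s. row_fun Jac (a s)"
  define h where "h = row_lin r ?u (c(r := l)) r"
  note cr = cramer_vector[where k = r and c = c and n = n and l = l and u = ?u, OF c l, folded h_def]
  have "(\<Sum>t<n. row_fun Jac i t * h t) = 0" if i: "i < m" for i
  proof (rule ccontr)
    assume "(\<Sum>t<n. row_fun Jac i t * h t) \<noteq> 0"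
    then have "gdet (Suc r) (?u(r := row_fun Jac i)) (c(r := l)) \<notin> {0}"
      using cr(1)[of "row_fun Jac i"] by (simp add: mult.commute)
    moreover have "\<forall>s<Suc r. (?u(r := row_fun Jac i)) s \<in> row_set Jac"
      using a i by (auto simp: less_Suc_eq)
    moreover have "\<forall>s<Suc r. (c(r := l)) s < n"
      using c l by (auto simp: less_Suc_eq)
    ultimately have "has_minor {0} n (row_set Jac) (Suc r)"
      unfolding has_minor_def by blast
    then show False using le_r_iff[of "Suc r"] by simp
  qed
  then have "h \<in> ker" by (simp add: ker_def)
  then show ?thesis using cr(2,3) by blast
qed

text \<open>Up to the factor \<open>\<Delta>\<close>, a nonzero \<open>r\<close>-minor, every kernel
  vector is a combination of the \<open>n - r\<close> Cramer vectors at the columns outside the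
  minor.\<close>

lemma ker_rank:
  assumes "has_minor {0} n ker k"
  shows "k \<le> n - r"
proof -
  have p: "is_prime ({0} :: 'a set)" by (rule is_prime_zero)
  have "has_minor {0} n (row_set Jac) r" using le_r_iff by blast
  then have "has_minor {0} (dim_col Jac) (row_set Jac) r" by simp
  then obtain a c where a: "\<forall>s<r. a s < m" and c: "\<forall>s<r. c s < n"
    and nz: "gdet r (\<lambda>s. row_fun Jac (a s)) c \<noteq> 0"
    unfolding has_minor_row_set by auto
  define \<Delta> where "\<Delta> = gdet r (\<lambda>s. row_fun Jac (a s)) c"
  define K where "K = {..<n} - c ` {..<r}"
  have inj: "inj_on c {..<r}" using nz gdet_not_inj_columns by blast
  have "c ` {..<r} \<subseteq> {..<n}" using c by auto
  then have cardK: "card K = n - r"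
    unfolding K_def by (subst card_Diff_subset) (auto simp: card_image[OF inj])
  have "\<forall>l. \<exists>h. l \<in> K \<longrightarrow> h \<in> ker \<and> h l = \<Delta> \<and> (\<forall>t. t \<noteq> l \<longrightarrow> t \<notin> c ` {..<r} \<longrightarrow> h t = 0)"
  proof
    fix l
    show "\<exists>h. l \<in> K \<longrightarrow> h \<in> ker \<and> h l = \<Delta> \<and> (\<forall>t. t \<noteq> l \<longrightarrow> t \<notin> c ` {..<r} \<longrightarrow> h t = 0)"
    proof (cases "l \<in> K")
      case True
      then have "l < n" "l \<notin> c ` {..<r}" by (auto simp: K_def)
      from ker_cramer[OF _ _ this, of a] a c show ?thesis unfolding \<Delta>_def by fast
    qed simp
  qed
  then obtain h where h: "\<And>l. l \<in> K \<Longrightarrow> h l \<in> ker \<and> h l l = \<Delta> \<and> (\<forall>t. t \<noteq> l \<longrightarrow> t \<notin> c ` {..<r} \<longrightarrow> h l t = 0)"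
    by metis
  have "ker \<subseteq> bipolar {0} n (h ` K)"
  proof
    fix v assume v: "v \<in> ker"
    \<comment> \<open>\<open>w\<close> vanishes outside the columns of the minor, and on these
      columns the block with nonzero determinant annihilates it, so it is zero below
      \<open>n\<close>.\<close>
    define w where "w t = \<Delta> * v t + (\<Sum>l\<in>K. (- v l) * h l t)" for t
    have "w \<in> ker"
      unfolding w_def by (intro ker_add ker_sum ker_mult v) (use h in auto)
    have w0: "w t = 0" if t: "t \<in> K" for t
    proof -
      have "(\<Sum>l\<in>K. (- v l) * h l t) = (\<Sum>l\<in>K. if l = t then - (v t * \<Delta>) else 0)"
        using h t by (intro sum.cong refl) (auto simp: K_def)
      then show ?thesis using t by (simp add: w_def K_def)
    qed
    have "w t = 0" if t: "t < n" for t
    proof (rule ccontr)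
      assume "w t \<noteq> 0"
      with w0 t have "t \<in> c ` {..<r}" by (auto simp: K_def)
      then obtain s0 where s0: "s0 < r" "t = c s0" by auto
      let ?A = "mat r r (\<lambda>(i, l). row_fun Jac (a i) (c l))"
      have "?A *\<^sub>v vec r (\<lambda>s. w (c s)) = 0\<^sub>v r"
      proof (rule eq_vecI)
        fix i assume i: "i < dim_vec (0\<^sub>v r :: 'a vec)"
        have "(?A *\<^sub>v vec r (\<lambda>s. w (c s))) $ i = (\<Sum>s<r. row_fun Jac (a i) (c s) * w (c s))"
          using i by (simp add: scalar_prod_def atLeast0LessThan)
        also have "\<dots> = (\<Sum>t\<in>c ` {..<r}. row_fun Jac (a i) t * w t)"
          by (simp add: sum.reindex[OF inj])
        also have "\<dots> = (\<Sum>t<n. row_fun Jac (a i) t * w t)"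
          by (rule sum.mono_neutral_left) (use c w0 in \<open>auto simp: K_def\<close>)
        also have "\<dots> = 0" using \<open>w \<in> ker\<close> a i by (simp add: ker_def)
        finally show "(?A *\<^sub>v vec r (\<lambda>s. w (c s))) $ i = 0\<^sub>v r $ i" using i by simp
      qed simp
      moreover have "vec r (\<lambda>s. w (c s)) \<noteq> 0\<^sub>v r"
      proof
        assume "vec r (\<lambda>s. w (c s)) = 0\<^sub>v r"
        then have "vec r (\<lambda>s. w (c s)) $ s0 = 0\<^sub>v r $ s0" by simp
        then show False using s0 \<open>w t \<noteq> 0\<close> by simp
      qed
      ultimately have "det ?A = 0"
        by (subst det_0_iff_vec_prod_zero[of _ r]) (auto intro!: exI[of _ "vec r (\<lambda>s. w (c s))"])
      then show False using nz by (simp add: gdet_def)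
    qed
    then have eq: "\<Delta> * v t = (\<Sum>l\<in>K. v l * h l t)" if "t < n" for t
      using that by (simp add: w_def sum_negf)
    show "v \<in> bipolar {0} n (h ` K)"
      unfolding bipolar_def
    proof (intro CollectI allI impI)
      fix g assume g: "\<forall>w\<in>h ` K. (\<Sum>t<n. g t * w t) \<in> {0}"
      have "\<Delta> * (\<Sum>t<n. g t * v t) = (\<Sum>t<n. g t * (\<Delta> * v t))"
        by (simp add: sum_distrib_left mult.left_commute)
      also have "\<dots> = (\<Sum>t<n. \<Sum>l\<in>K. v l * (g t * h l t))"
        by (intro sum.cong refl) (simp add: eq sum_distrib_left mult.left_commute)
      also have "\<dots> = (\<Sum>l\<in>K. v l * (\<Sum>t<n. g t * h l t))"
        by (subst sum.swap) (simp add: sum_distrib_left)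
      also have "\<dots> = 0" using g by (intro sum.neutral) auto
      finally show "(\<Sum>t<n. g t * v t) \<in> {0}" using nz by (simp add: \<Delta>_def)
    qed
  qed
  then have "has_minor {0} n (h ` K) k" by (rule has_minor_bipolar[OF assms])
  then have "k \<le> card (h ` K)"
    by (intro has_minor_card_le[OF p]) (auto simp: K_def)
  also have "\<dots> \<le> n - r" using card_image_le[of K h] cardK by (simp add: K_def)
  finally show ?thesis .
qed

text \<open>The span over the ring itself, without the division that \<open>bipolar\<close> allows
  over a prime.\<close>

definition row_span :: "'a mat \<Rightarrow> (nat \<Rightarrow> 'a) set" where
  "row_span C = {v. \<exists>u. \<forall>t<n. v t = (\<Sum>i<dim_row C. u i * row_fun C i t)}"

lemma row_span_add:
  assumes "v \<in> row_span C" "w \<in> row_span C"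
  shows "(\<lambda>t. v t + w t) \<in> row_span C"
proof -
  obtain a b where "\<forall>t<n. v t = (\<Sum>i<dim_row C. a i * row_fun C i t)"
    "\<forall>t<n. w t = (\<Sum>i<dim_row C. b i * row_fun C i t)"
    using assms unfolding row_span_def by blast
  then show ?thesis
    unfolding row_span_def
    by (intro CollectI exI[of _ "\<lambda>i. a i + b i"]) (simp add: distrib_right sum.distrib)
qed

lemma row_span_mult:
  assumes "v \<in> row_span C"
  shows "(\<lambda>t. b * v t) \<in> row_span C"
proof -
  obtain a where "\<forall>t<n. v t = (\<Sum>i<dim_row C. a i * row_fun C i t)"
    using assms unfolding row_span_def by blast
  then show ?thesis
    unfolding row_span_def
    by (intro CollectI exI[of _ "\<lambda>i. b * a i"]) (simp add: sum_distrib_left mult.assoc)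
qed

lemma row_span_0: "(\<lambda>t. 0) \<in> row_span C"
  unfolding row_span_def by (intro CollectI exI[of _ "\<lambda>_. 0"]) simp

lemma row_span_sum: "(\<And>l. l \<in> X \<Longrightarrow> v l \<in> row_span C) \<Longrightarrow> (\<lambda>t. \<Sum>l\<in>X. v l t) \<in> row_span C"
  by (induction X rule: infinite_finite_induct) (auto intro: row_span_add row_span_0)

lemma row_span_row:
  assumes "i < dim_row C"
  shows "row_fun C i \<in> row_span C"
proof -
  have "row_fun C i t = (\<Sum>j<dim_row C. (if j = i then 1 else 0) * row_fun C j t)" for t
    using assms by (simp add: if_distrib if_distribR sum.delta cong: if_cong)
  then show ?thesis
    unfolding row_span_def by (intro CollectI exI[of _ "\<lambda>j. if j = i then 1 else 0"]) blast
qed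

lemma row_span_bipolar:
  assumes "is_ideal Q"
  shows "row_span C \<subseteq> bipolar Q n (row_set C)"
proof
  fix v assume "v \<in> row_span C"
  then obtain u where u: "\<forall>t<n. v t = (\<Sum>i<dim_row C. u i * row_fun C i t)"
    unfolding row_span_def by blast
  show "v \<in> bipolar Q n (row_set C)"
    unfolding bipolar_def
  proof (intro CollectI allI impI)
    fix h assume h: "\<forall>w\<in>row_set C. (\<Sum>t<n. h t * w t) \<in> Q"
    have "(\<Sum>t<n. h t * v t) = (\<Sum>t<n. \<Sum>i<dim_row C. u i * (h t * row_fun C i t))"
      by (intro sum.cong refl) (simp add: u sum_distrib_left mult.left_commute)
    also have "\<dots> = (\<Sum>i<dim_row C. u i * (\<Sum>t<n. h t * row_fun C i t))"
      by (subst sum.swap) (simp add: sum_distrib_left)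
    also have "\<dots> \<in> Q"
      by (rule ideal_sum[OF assms], rule ideal_mult_left[OF assms]) (use h in auto)
    finally show "(\<Sum>t<n. h t * v t) \<in> Q" .
  qed
qed

lemma index_set_complement:
  assumes "j \<in> index_sets n r"
  shows "card ({..<n} - j) = n - r" "t < n - r \<Longrightarrow> pick ({..<n} - j) t < n \<and> pick ({..<n} - j) t \<notin> j"
proof -
  show card: "card ({..<n} - j) = n - r"
    using assms finite_subset[of j "{..<n}"] by (auto simp: index_sets_def card_Diff_subset)
  show "t < n - r \<Longrightarrow> pick ({..<n} - j) t < n \<and> pick ({..<n} - j) t \<notin> j"
    using pick_in_set_le[of t "{..<n} - j"] by (simp add: card)
qed

section \<open>Square matrices whose rows lie in the kernel\<close>

context
  fixes C :: "'a mat"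
  assumes C: "C \<in> carrier_mat n n" and C_ker: "row_set C \<subseteq> ker"
begin

lemma frac_rank_le: "frac_rank C \<le> n - r"
proof -
  have "has_minor {0} n (row_set C) (frac_rank C)"
    using le_frac_rank_iff[of "frac_rank C" C] C by simp
  from ker_rank[OF has_minor_mono[OF this C_ker]] show ?thesis .
qed

text \<open>If \<open>\<delta>\<close> is a minor of size \<open>n - r\<close>, then \<open>\<delta> v\<close> lies in the row space for every \<open>v\<close> in the
  kernel, because bordering the minor by \<open>v\<close> gives zero.\<close>

lemma ker_subset_row_span:
  assumes one: "minor_ideal (n - r) C = UNIV"
  shows "ker \<subseteq> row_span C"
proof
  fix v assume v: "v \<in> ker"
  let ?d = "n - r"
  \<comment> \<open>The multipliers that carry \<open>v\<close> into the row space form an ideal;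
    once it contains the minors, it contains 1.\<close>
  let ?Q = "{b. (\<lambda>t. b * v t) \<in> row_span C}"
  have "is_ideal ?Q"
    unfolding is_ideal_def
  proof (intro conjI ballI allI; clarsimp)
    show "(\<lambda>t. 0) \<in> row_span C" by (rule row_span_0)
  next
    fix a b assume "(\<lambda>t. a * v t) \<in> row_span C" "(\<lambda>t. b * v t) \<in> row_span C"
    from row_span_add[OF this] show "(\<lambda>t. (a + b) * v t) \<in> row_span C" by (simp add: distrib_right)
  next
    fix a b assume "(\<lambda>t. b * v t) \<in> row_span C"
    from row_span_mult[OF this, of a] show "(\<lambda>t. a * b * v t) \<in> row_span C" by (simp add: mult.assoc)
  qed
  moreover have "gdet ?d (\<lambda>s. row_fun C (a s)) c \<in> ?Q"
    if a: "\<And>s. s < ?d \<Longrightarrow> a s < dim_row C" and c: "\<And>s. s < ?d \<Longrightarrow> c s < dim_col C" for a c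
  proof -
    let ?u = "(\<lambda>s. row_fun C (a s))(?d := v)"
    \<comment> \<open>Cofactors along the bordering column: that column is deleted in them, so they
      do not depend on \<open>l\<close> and serve as coefficients for all coordinates at
      once.\<close>
    define k where "k i = (-1)^(i + ?d) * gdet ?d (?u \<circ> insert_index i) c" for i
    have "gdet ?d (\<lambda>s. row_fun C (a s)) c * v l = (\<Sum>i<?d. (- k i) * row_fun C (a i) l)" if l: "l < n" for l
    proof -
      let ?c = "c(?d := l)"
      have "gdet (Suc ?d) ?u ?c = 0"
      proof (rule ccontr)
        assume "gdet (Suc ?d) ?u ?c \<noteq> 0"
        moreover have "\<forall>s<Suc ?d. ?u s \<in> ker"
        proof (intro allI impI)
          fix s assume "s < Suc ?d"
          then show "?u s \<in> ker"
            using v a[of s] C_ker by (cases "s = ?d") auto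
        qed
        moreover have "\<forall>s<Suc ?d. ?c s < n" using c l C by (auto simp: less_Suc_eq)
        ultimately have "has_minor {0} n ker (Suc ?d)" unfolding has_minor_def by blast
        from ker_rank[OF this] show False by simp
      qed
      moreover have "gdet (Suc ?d) ?u ?c = (\<Sum>i<Suc ?d. ?u i l * k i)"
      proof -
        have "gdet ?d (?u \<circ> insert_index i) (?c \<circ> insert_index ?d) = gdet ?d (?u \<circ> insert_index i) c" for i
          by (rule gdet_cong) (simp add: insert_index_def)
        then show ?thesis
          by (subst gdet_expand_column[of ?d]) (simp_all add: k_def del: sum.lessThan_Suc)
      qed
      moreover have "k ?d = gdet ?d (\<lambda>s. row_fun C (a s)) c"
      proof -
        have "gdet ?d (?u \<circ> insert_index ?d) c = gdet ?d (\<lambda>s. row_fun C (a s)) c"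
          by (rule gdet_cong) (simp add: insert_index_def)
        then show ?thesis by (simp add: k_def mult_2[symmetric])
      qed
      ultimately have "v l * gdet ?d (\<lambda>s. row_fun C (a s)) c + (\<Sum>i<?d. row_fun C (a i) l * k i) = 0"
        by (simp add: add.commute)
      then show ?thesis
        by (simp add: sum_negf eq_neg_iff_add_eq_0 mult.commute)
    qed
    moreover have "(\<lambda>l. \<Sum>i<?d. (- k i) * row_fun C (a i) l) \<in> row_span C"
      by (intro row_span_sum row_span_mult row_span_row) (use a in auto)
    ultimately show ?thesis
      by (simp add: row_span_def)
  qed
  ultimately have "minor_ideal ?d C \<subseteq> ?Q" by (rule minor_ideal_subset)
  then have "1 \<in> ?Q" unfolding one by blast
  then show "v \<in> row_span C" by simp
qed

lemma delete_cols_row_fun: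
  assumes j: "j \<in> index_sets n r"
  shows "dim_row (delete_cols C j) = n" "dim_col (delete_cols C j) = n - r"
    and "\<And>i t. i < n \<Longrightarrow> t < n - r \<Longrightarrow> row_fun (delete_cols C j) i t = row_fun C i (pick ({..<n} - j) t)"
proof -
  have set: "{a. a < n \<and> a \<in> - j} = {..<n} - j" "{a. a < n \<and> a \<notin> j} = {..<n} - j" by auto
  note card = index_set_complement(1)[OF j]
  show "dim_row (delete_cols C j) = n" "dim_col (delete_cols C j) = n - r"
    using C by (simp_all add: delete_cols_def dim_submatrix set card)
  fix i t assume it: "i < n" "t < n - r"
  \<comment> \<open>\<open>delete_cols\<close> picks from the infinite set \<open>- j\<close>; at
    positions below \<open>n - r\<close> this agrees with the complement within
    \<open>{..<n}\<close>.\<close>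
  have "pick (- j) t = pick ({..<n} - j) t"
    using pick_reduce_set[of t n "- j"] it(2) unfolding set card by simp
  then show "row_fun (delete_cols C j) i t = row_fun C i (pick ({..<n} - j) t)"
    using C it unfolding row_fun_def delete_cols_def
    by (subst submatrix_index) (simp_all add: set card pick_UNIV)
qed

text \<open>The Cramer vectors at the columns outside \<open>j\<close> form \<open>\<Delta>\<close> times an identity matrix there, so
  \<open>\<Delta>\<^sup>n\<^sup>-\<^sup>r\<close> is a determinant of combinations of rows of \<open>C\<close>.\<close>

lemma minor_power_in_minor_ideal:
  assumes span: "ker \<subseteq> row_span C" and i: "i \<in> index_sets m r" and j: "j \<in> index_sets n r"
  shows "minor Jac i j ^ (n - r) \<in> minor_ideal (n - r) (delete_cols C j)"
proof -
  define \<Delta> where "\<Delta> = minor Jac i j"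
  have \<Delta>: "\<Delta> = gdet r (\<lambda>s. row_fun Jac (pick i s)) (pick j)"
    unfolding \<Delta>_def by (rule minor_eq_gdet) (use i j in simp_all)
  define K where "K = {..<n} - j"
  note K = index_set_complement[OF j, folded K_def]
  have "finite j" "card j = r"
    using j finite_subset[of j "{..<n}"] by (auto simp: index_sets_def)
  then have pj: "pick j ` {..<r} = j" using pick_image by metis
  have "\<exists>h\<in>ker. h l = \<Delta> \<and> (\<forall>t. t \<noteq> l \<longrightarrow> t \<notin> j \<longrightarrow> h t = 0)" if "l < n" "l \<notin> j" for l
    using ker_cramer[of "pick i" "pick j" l] pick_index_set[OF i] pick_index_set[OF j] that
    unfolding pj \<Delta> by auto
  then have "\<forall>l. \<exists>h. l < n \<and> l \<notin> j \<longrightarrow> h \<in> ker \<and> h l = \<Delta> \<and> (\<forall>t. t \<noteq> l \<longrightarrow> t \<notin> j \<longrightarrow> h t = 0)"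
    by blast
  then obtain h where h: "\<And>l. l < n \<and> l \<notin> j \<Longrightarrow> h l \<in> ker \<and> h l l = \<Delta> \<and> (\<forall>t. t \<noteq> l \<longrightarrow> t \<notin> j \<longrightarrow> h l t = 0)"
    by metis
  let ?Q = "minor_ideal (n - r) (delete_cols C j)"
  have "gdet (n - r) (\<lambda>s. h (pick K s)) (pick K) = (\<Prod>s<n - r. h (pick K s) (pick K s))"
  proof (rule gdet_lower_triangular)
    fix s s' assume s: "s < s'" "s' < n - r"
    then have "pick K s < pick K s'" using K(1) by (intro pick_mono_le) auto
    then show "h (pick K s) (pick K s') = 0"
      using h[OF K(2)[of s]] K(2)[of s'] s by auto
  qed
  also have "\<dots> = \<Delta> ^ (n - r)"
    using h[OF K(2)] by simp
  finally have "\<Delta> ^ (n - r) = gdet (n - r) (\<lambda>s. h (pick K s)) (pick K)" ..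
  also have "\<dots> \<in> ?Q"
  \<comment> \<open>On the columns outside \<open>j\<close>, determinants of rows of
    \<open>C\<close> are minors of \<open>delete_cols C j\<close> up to sign or zero; multilinearity
    passes this on to combinations of rows.\<close>
  proof (rule gdet_bipolar)
    show "pick K s < n" if "s < n - r" for s using K(2)[OF that] by simp
    show "h (pick K s) \<in> bipolar ?Q n (row_set C)" if "s < n - r" for s
      using h[OF K(2)[OF that]] span row_span_bipolar[OF is_ideal_minor_ideal] by blast
    fix u assume "\<And>s. s < n - r \<Longrightarrow> u s \<in> row_set C"
    then have "\<forall>s. \<exists>a. s < n - r \<longrightarrow> a < n \<and> u s = row_fun C a" using C by fastforce
    then obtain a where a: "\<And>s. s < n - r \<Longrightarrow> a s < n \<and> u s = row_fun C (a s)" by metis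
    have "gdet (n - r) u (pick K) = gdet (n - r) (\<lambda>s. row_fun (delete_cols C j) (a s)) id"
      by (rule gdet_cong) (use a in \<open>simp add: delete_cols_row_fun[OF j] K_def\<close>)
    also have "\<dots> \<in> ?Q"
      by (rule gdet_in_minor_ideal) (use a in \<open>simp_all add: delete_cols_row_fun[OF j]\<close>)
    finally show "gdet (n - r) u (pick K) \<in> ?Q" .
  qed
  finally show ?thesis by (simp add: \<Delta>_def)
qed

lemma minor_ideal_delete_cols:
  assumes j: "j \<in> index_sets n r"
  shows "minor_ideal (n - r) (delete_cols C j) \<subseteq> minor_ideal (n - r) C"
proof (rule minor_ideal_subset[OF is_ideal_minor_ideal])
  fix a c
  assume a: "\<And>s. s < n - r \<Longrightarrow> a s < dim_row (delete_cols C j)"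
    and c: "\<And>s. s < n - r \<Longrightarrow> c s < dim_col (delete_cols C j)"
  note dc = delete_cols_row_fun[OF j]
  have "gdet (n - r) (\<lambda>s. row_fun (delete_cols C j) (a s)) c =
      gdet (n - r) (\<lambda>s. row_fun C (a s)) (pick ({..<n} - j) \<circ> c)"
    by (rule gdet_cong) (use a c in \<open>simp add: dc\<close>)
  also have "\<dots> \<in> minor_ideal (n - r) C"
    by (rule gdet_in_minor_ideal) (use a c C index_set_complement(2)[OF j] in \<open>simp_all add: dc\<close>)
  finally show "gdet (n - r) (\<lambda>s. row_fun (delete_cols C j) (a s)) c \<in> minor_ideal (n - r) C" .
qed

lemma frac_rank_eq:
  assumes "minor_ideal (n - r) C = UNIV"
  shows "frac_rank C = n - r"
proof (rule antisym[OF frac_rank_le])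
  have "\<not> minor_ideal (n - r) C \<subseteq> {0}" using assms by auto
  then obtain a c where "\<forall>s<n - r. a s < dim_row C" "\<forall>s<n - r. c s < dim_col C"
    "gdet (n - r) (\<lambda>s. row_fun C (a s)) c \<notin> {0}"
    using minor_ideal_subset[OF is_prime_ideal[OF is_prime_zero], of "n - r" C] by blast
  then show "n - r \<le> frac_rank C"
    unfolding le_frac_rank_iff has_minor_row_set by blast
qed

text \<open>If the ideal were proper, some prime \<open>q\<close> would contain it. An
  \<open>r\<close>-minor outside \<open>q\<close> is nonzero, so its index sets are among those
  covered by \<open>rad\<close>, and a power of it would lie in \<open>q\<close>.\<close>

lemma minor_ideal_eq_UNIV:
  assumes reg: "regular_domain TYPE('a)"
    and rad: "\<And>i j. i \<in> nonzero_minor_rows r Jac \<Longrightarrow> j \<in> nonzero_minor_cols r Jac \<Longrightarrow>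
      \<exists>k. minor Jac i j ^ k \<in> minor_ideal (n - r) C"
  shows "minor_ideal (n - r) C = UNIV"
proof (rule ccontr)
  assume "minor_ideal (n - r) C \<noteq> UNIV"
  then obtain q where q: "is_prime q" "minor_ideal (n - r) C \<subseteq> q"
    using prime_containing_ideal[OF is_ideal_minor_ideal] by metis
  obtain i j where ij: "i \<in> index_sets m r" "j \<in> index_sets n r" "minor Jac i j \<notin> q"
    by (rule regular_minor_notin[OF reg q(1)])
  then have "minor Jac i j \<noteq> 0" using prime_zero[OF q(1)] by auto
  then have "i \<in> nonzero_minor_rows r Jac" "j \<in> nonzero_minor_cols r Jac"
    using ij by (auto simp: nonzero_minor_rows_def nonzero_minor_cols_def)
  from rad[OF this] obtain k where "minor Jac i j ^ k \<in> q" using q(2) by blast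
  then show False using prime_power[OF q(1)] ij(3) by blast
qed

text \<open>With \<open>ker \<subseteq> row_span C\<close> in the role of (1), the cycle is (1),
  (3), (4), (2), (1); regularity enters from (4) to (2).\<close>

theorem minor_conditions:
  assumes reg: "regular_domain TYPE('a)"
  defines "d \<equiv> frac_rank C"
  shows "(ker \<subseteq> row_span C) \<longleftrightarrow> (d = n - r \<and> minor_ideal d C = UNIV)" (is "?A \<longleftrightarrow> ?B")
    and "(d = n - r \<and> minor_ideal d C = UNIV)
        \<longleftrightarrow> (\<forall>i\<in>nonzero_minor_rows r Jac. \<forall>j\<in>nonzero_minor_cols r Jac.
               minor Jac i j ^ (n - r) \<in> minor_ideal (n - r) (delete_cols C j))" (is "_ \<longleftrightarrow> ?C")
    and "(\<forall>i\<in>nonzero_minor_rows r Jac. \<forall>j\<in>nonzero_minor_cols r Jac.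
               minor Jac i j ^ (n - r) \<in> minor_ideal (n - r) (delete_cols C j))
        \<longleftrightarrow> (\<forall>i\<in>nonzero_minor_rows r Jac. \<forall>j\<in>nonzero_minor_cols r Jac.
               \<exists>k\<ge>1. minor Jac i j ^ k \<in> minor_ideal (n - r) C)" (is "_ \<longleftrightarrow> ?D")
proof -
  have sets: "i \<in> index_sets m r" "j \<in> index_sets n r"
    if "i \<in> nonzero_minor_rows r Jac" "j \<in> nonzero_minor_cols r Jac" for i j
    using that by (auto simp: nonzero_minor_rows_def nonzero_minor_cols_def)
  have AC: "?A \<Longrightarrow> ?C"
    using minor_power_in_minor_ideal sets by blast
  have CD: "?C \<Longrightarrow> ?D"
  proof (intro ballI)
    fix i j assume c: ?C and ij: "i \<in> nonzero_minor_rows r Jac" "j \<in> nonzero_minor_cols r Jac"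
    then have "minor Jac i j ^ (n - r) \<in> minor_ideal (n - r) C"
      using minor_ideal_delete_cols[OF sets(2)[OF ij]] by blast
    \<comment> \<open>For \<open>n = r\<close> the exponent \<open>n - r\<close> is 0, while an
      exponent of at least 1 is wanted.\<close>
    then have "minor Jac i j ^ Suc (n - r) \<in> minor_ideal (n - r) C"
      unfolding power_Suc by (rule ideal_mult_left[OF is_ideal_minor_ideal])
    then show "\<exists>k\<ge>1. minor Jac i j ^ k \<in> minor_ideal (n - r) C"
      by (intro exI[of _ "Suc (n - r)"]) simp
  qed
  have DB: "?D \<Longrightarrow> ?B"
  proof -
    assume ?D
    then have "minor_ideal (n - r) C = UNIV"
      by (intro minor_ideal_eq_UNIV[OF reg]) blast
    then show ?B using frac_rank_eq by (simp add: d_def)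
  qed
  have BA: "?B \<Longrightarrow> ?A"
    using ker_subset_row_span by auto
  show "?A \<longleftrightarrow> ?B" "?B \<longleftrightarrow> ?C" "?C \<longleftrightarrow> ?D"
    using AC CD DB BA by blast+
qed

end

end

section \<open>Derivations\<close>

locale poisson_presentation = poisson_algebra scale br + presentation "\<lambda>c. scale c 1" n m f x
  for scale :: "'k::field_char_0 \<Rightarrow> 'a::idom \<Rightarrow> 'a" and br :: "'a \<Rightarrow> 'a \<Rightarrow> 'a"
    and n m :: nat and f :: "nat \<Rightarrow> 'k mpoly" and x :: "nat \<Rightarrow> 'a"
begin

lemma derivationsD:
  assumes "D \<in> derivations scale"
  shows "D (a + b) = D a + D b" "D (scale c a) = scale c (D a)" "D (a * b) = D a * b + a * D b"
proof -
  have "Vector_Spaces.linear scale scale D" using assms by (simp add: derivations_def)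
  then interpret D: Vector_Spaces.linear scale scale D .
  show "D (a + b) = D a + D b" "D (scale c a) = scale c (D a)"
    by (rule D.add D.scale)+
  show "D (a * b) = D a * b + a * D b" using assms by (simp add: derivations_def)
qed

lemma derivationsI:
  assumes "\<And>a b. D (a + b) = D a + D b" "\<And>c a. D (scale c a) = scale c (D a)"
    "\<And>a b. D (a * b) = D a * b + a * D b"
  shows "D \<in> derivations scale"
proof -
  have "Vector_Spaces.linear scale scale D"
    by unfold_locales (use assms in auto)
  then show ?thesis using assms(3) by (simp add: derivations_def)
qed

lemma derivation_1:
  assumes "D \<in> derivations scale"
  shows "D 1 = 0"
  using derivationsD(3)[OF assms, of 1 1] by (metis add_cancel_left_right mult_1 mult_1_right)

lemma derivation_const:
  assumes "D \<in> derivations scale"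
  shows "D (scale c 1) = 0"
  using derivationsD(2)[OF assms, of c 1] derivation_1[OF assms] by simp

lemma derivation_ev:
  assumes D: "D \<in> derivations scale" and "g \<in> poly_vars {..<n}"
  shows "D (ev x g) = (\<Sum>t<n. grad x g t * D (x t))"
  using assms(2)
proof (induction g rule: poly_vars_induct)
  case (const c)
  show ?case using derivation_const[OF D] by (simp add: grad_def)
next
  case (var i)
  have "(\<Sum>t<n. grad x (pvar i) t * D (x t)) = (\<Sum>t<n. if t = i then D (x t) else 0)"
    by (intro sum.cong refl) (simp add: grad_def pdiff_pvar)
  then show ?case using var by simp
next
  case (add g h)
  then show ?case
    by (simp add: ev_add derivationsD(1)[OF D] grad_add distrib_right sum.distrib)
next
  case (mult g h)
  then show ?case
    by (simp add: ev_mult derivationsD(3)[OF D] grad_mult sum_distrib_left sum.distrib algebra_simps)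
qed

text \<open>Differentiating \<open>b * ev x s = ev x g\<close> extends the chain rule to fractions.
  So a derivation is determined by its values on the coordinates.\<close>

lemma derivation_has_grad:
  assumes D: "D \<in> derivations scale" and w: "has_grad b w"
  shows "D b = (\<Sum>t<n. w t * D (x t))"
proof -
  obtain g s where gs: "g \<in> poly_vars {..<n}" "s \<in> poly_vars {..<n}" "ev x s dvd 1" "b * ev x s = ev x g"
    "\<And>j. ev x s * w j = grad x g j - b * grad x s j"
    using w by (auto simp: has_grad_def)
  have "D b * ev x s + b * D (ev x s) = D (ev x g)"
    by (simp add: gs(4)[symmetric] derivationsD(3)[OF D])
  then have "ev x s * D b = (\<Sum>t<n. (grad x g t - b * grad x s t) * D (x t))"
    by (simp add: derivation_ev[OF D] gs left_diff_distrib sum_subtractf sum_distrib_left algebra_simps)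
  also have "\<dots> = ev x s * (\<Sum>t<n. w t * D (x t))"
    by (simp add: gs(5)[symmetric] sum_distrib_left mult.assoc)
  finally show ?thesis using gs(3) by auto
qed

lemma derivation_ker: "D \<in> derivations scale \<Longrightarrow> (\<lambda>t. D (x t)) \<in> ker"
proof -
  assume D: "D \<in> derivations scale"
  have "(\<Sum>t<n. row_fun Jac i t * D (x t)) = 0" if "i < m" for i
  proof -
    have "(\<Sum>t<n. row_fun Jac i t * D (x t)) = (\<Sum>t<n. grad x (f i) t * D (x t))"
      by (intro sum.cong refl) (simp add: row_fun_Jac that)
    also have "\<dots> = D (ev x (f i))" by (rule derivation_ev[OF D f_vars[OF that], symmetric])
    also have "\<dots> = 0" using derivationsD(2)[OF D, of 0 0] by (simp add: ev_f that)
    finally show ?thesis .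
  qed
  then show ?thesis by (simp add: ker_def)
qed

text \<open>The value at \<open>b\<close> may be computed from any gradient of \<open>b\<close>: two
  gradients differ by one of 0, which lies in the row space and is orthogonal to
  \<open>v\<close>.\<close>

lemma derivation_of_ker:
  assumes v: "v \<in> ker"
  shows "\<exists>D\<in>derivations scale. \<forall>t<n. D (x t) = v t"
proof -
  have zero: "(\<Sum>t<n. v t * w t) = 0" if "has_grad 0 w" for w
  proof -
    have "(\<Sum>t<n. v t * w t) \<in> {0}"
      by (rule has_grad_0_orthogonal[OF that is_prime_ideal[OF is_prime_zero]])
        (use v in \<open>simp add: ker_def mult.commute\<close>)
    then show ?thesis by simp
  qed
  obtain W where W: "\<And>b. has_grad b (W b)" using has_grad_total by metis
  define D where "D b = (\<Sum>t<n. v t * W b t)" for b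
  have D: "D b = (\<Sum>t<n. v t * w t)" if w: "has_grad b w" for b w
  proof -
    have "has_grad 0 (\<lambda>j. W b j - w j)" using has_grad_diff[OF W[of b] w] by simp
    from zero[OF this] show ?thesis by (simp add: D_def right_diff_distrib sum_subtractf)
  qed
  have mult: "D (a * b) = D a * b + a * D b" for a b
    using D[OF has_grad_mult[OF W W, of a b]]
    by (simp add: D_def distrib_left sum.distrib sum_distrib_left algebra_simps)
  have "D \<in> derivations scale"
  proof (rule derivationsI)
    show "D (a + b) = D a + D b" for a b
      using D[OF has_grad_add[OF W W, of a b]] by (simp add: D_def distrib_left sum.distrib)
    have "D (scale c 1) = 0" for c using D[OF has_grad_const[of c]] by simp
    then show "D (scale c a) = scale c (D a)" for c a
      using mult[of "scale c 1" a] by (simp add: scale_one_mult)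
  qed (rule mult)
  moreover have "D (x t) = v t" if t: "t < n" for t
  proof -
    have "has_grad (x t) (grad x (pvar t))"
      using has_grad_ev[of "pvar t"] t by (simp add: poly_vars_pvar)
    then have "D (x t) = (\<Sum>s<n. v s * grad x (pvar t) s)" by (rule D)
    also have "\<dots> = (\<Sum>s<n. if s = t then v s else 0)"
      by (intro sum.cong refl) (simp add: grad_def pdiff_pvar)
    also have "\<dots> = v t" using t by simp
    finally show ?thesis .
  qed
  ultimately show ?thesis by blast
qed

lemma derivations_eqI:
  assumes "D \<in> derivations scale" "D' \<in> derivations scale" "\<And>t. t < n \<Longrightarrow> D (x t) = D' (x t)"
  shows "D = D'"
proof
  fix b
  obtain w where "has_grad b w" using has_grad_total by blast
  then show "D b = D' b"
    using derivation_has_grad[OF assms(1)] derivation_has_grad[OF assms(2)] assms(3) by simp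
qed

section \<open>Hamiltonian derivations and the row space of the matrix of brackets\<close>

lemma br_derivation: "br a \<in> derivations scale"
  using linear_right leibniz by (simp add: derivations_def)

lemma br_add_left: "br (a + b) c = br a c + br b c"
proof -
  interpret L: Vector_Spaces.linear scale scale "\<lambda>a. br a c" by (rule linear_left)
  show ?thesis by (rule L.add)
qed

lemma br_antisym: "br a b = - br b a"
proof -
  have "0 = br (a + b) (a + b)" by (simp add: alternating)
  also have "\<dots> = br a b + br b a"
    unfolding derivationsD(1)[OF br_derivation] br_add_left by (simp add: alternating)
  finally show ?thesis by (simp add: eq_neg_iff_add_eq_0)
qed

abbreviation C :: "'a mat" where
  "C \<equiv> poisson_matrix n br x"

lemma C_carrier: "C \<in> carrier_mat n n"
  by (simp add: poisson_matrix_def)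

lemma row_fun_C: "i < n \<Longrightarrow> t < n \<Longrightarrow> row_fun C i t = br (x i) (x t)"
  by (simp add: poisson_matrix_def row_fun_def)

lemma ker_cong: "v \<in> ker \<Longrightarrow> (\<And>t. t < n \<Longrightarrow> w t = v t) \<Longrightarrow> w \<in> ker"
  by (simp add: ker_def)

lemma row_set_C_ker: "row_set C \<subseteq> ker"
proof
  fix v assume "v \<in> row_set C"
  then obtain i where i: "i < n" "v = row_fun C i" using C_carrier by auto
  then show "v \<in> ker"
    using ker_cong[OF derivation_ker[OF br_derivation[of "x i"]], of v] row_fun_C by simp
qed

lemma fun_scale_derivation: "D \<in> derivations scale \<Longrightarrow> fun_scale b D \<in> derivations scale"
proof (rule derivationsI)
  assume D: "D \<in> derivations scale"
  show "fun_scale b D (scale c a) = scale c (fun_scale b D a)" for c a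
    unfolding fun_scale_def derivationsD(2)[OF D] by (metis scale_mult_left mult.commute)
qed (simp_all add: fun_scale_def derivationsD algebra_simps)

lemma derivations_span_iff:
  "derivations scale = Modules.module.span fun_scale (hamiltonian_derivations br) \<longleftrightarrow> ker \<subseteq> row_span C"
proof -
  interpret fs: Modules.module fun_scale by (rule module_fun_scale)
  have "fs.subspace (derivations scale)"
  proof (rule fs.subspaceI)
    show "0 \<in> derivations scale" by (rule derivationsI) auto
    show "D + E \<in> derivations scale" if "D \<in> derivations scale" "E \<in> derivations scale" for D E
      by (rule derivationsI) (simp_all add: derivationsD[OF that(1)] derivationsD[OF that(2)] scale_right_distrib algebra_simps)
  qed (rule fun_scale_derivation)
  then have sub: "fs.span (hamiltonian_derivations br) \<subseteq> derivations scale"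
    by (intro fs.span_minimal) (auto simp: hamiltonian_derivations_def br_derivation)
  have span_C: "(\<lambda>t. D (x t)) \<in> row_span C" if "D \<in> fs.span (hamiltonian_derivations br)" for D
    using that
  proof (induction rule: fs.span_induct_alt)
    case base
    show ?case using row_span_0 by simp
  next
    case (step c D E)
    then obtain b where b: "D = br b" by (auto simp: hamiltonian_derivations_def)
    obtain w where w: "has_grad b w" using has_grad_total by blast
    \<comment> \<open>Antisymmetry makes the bracket a derivation in its first argument, so
      \<open>b\<close> enters only through a gradient.\<close>
    have "br b (x t) = (\<Sum>i<n. w i * row_fun C i t)" if "t < n" for t
    proof -
      have "br b (x t) = - br (x t) b" by (rule br_antisym)
      also have "\<dots> = (\<Sum>i<n. w i * - br (x t) (x i))"
        by (simp add: derivation_has_grad[OF br_derivation w] sum_negf)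
      also have "\<dots> = (\<Sum>i<n. w i * row_fun C i t)"
        using that by (intro sum.cong refl) (simp add: row_fun_C br_antisym[of "x t", symmetric] br_antisym[of _ "x t"])
      finally show ?thesis .
    qed
    then have "(\<lambda>t. br b (x t)) \<in> row_span C"
      using C_carrier unfolding row_span_def by auto
    from row_span_add[OF row_span_mult[OF this] step(2)] show ?case
      by (simp add: b fun_scale_def)
  qed
  show ?thesis
  proof
    assume eq: "derivations scale = fs.span (hamiltonian_derivations br)"
    show "ker \<subseteq> row_span C"
    proof
      fix v assume "v \<in> ker"
      then obtain D where D: "D \<in> derivations scale" "\<forall>t<n. D (x t) = v t" using derivation_of_ker by blast
      then have "(\<lambda>t. D (x t)) \<in> row_span C" using span_C eq by blast
      then show "v \<in> row_span C" using D(2) by (simp add: row_span_def)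
    qed
  next
    assume span: "ker \<subseteq> row_span C"
    have "D \<in> fs.span (hamiltonian_derivations br)" if D: "D \<in> derivations scale" for D
    proof -
      have "(\<lambda>t. D (x t)) \<in> row_span C" using span derivation_ker[OF D] by blast
      then obtain u where u: "\<And>t. t < n \<Longrightarrow> D (x t) = (\<Sum>i<n. u i * row_fun C i t)"
        using C_carrier by (auto simp: row_span_def)
      \<comment> \<open>The coefficients of the row combination give a combination of Hamiltonian
        derivations with the same values on the coordinates as \<open>D\<close>.\<close>
      define E where "E = (\<Sum>i<n. fun_scale (u i) (br (x i)))"
      have E: "E \<in> fs.span (hamiltonian_derivations br)"
        unfolding E_def
        by (intro fs.span_sum fs.span_scale fs.span_base) (simp add: hamiltonian_derivations_def)
      have "E b = (\<Sum>i<n. u i * br (x i) b)" for b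
      proof -
        have "(\<Sum>i\<in>T. fun_scale (u i) (br (x i))) b = (\<Sum>i\<in>T. u i * br (x i) b)" if "finite T" for T
          using that by (induction T rule: finite_induct) (simp_all add: fun_scale_def)
        then show ?thesis by (simp add: E_def)
      qed
      then have "D = E"
        using u E sub by (intro derivations_eqI[OF D]) (auto simp: row_fun_C)
      with E show ?thesis by simp
    qed
    with sub show "derivations scale = fs.span (hamiltonian_derivations br)" by blast
  qed
qed

end

theorem theorem1p8:
  fixes scale :: "'k::field_char_0 \<Rightarrow> 'a::idom \<Rightarrow> 'a"
    and br :: "'a \<Rightarrow> 'a \<Rightarrow> 'a"
    and m n r d :: nat
    and f :: "nat \<Rightarrow> 'k mpoly"
    and I :: "'k mpoly set"
    and S :: "'k mpoly set set"
    and \<phi> :: "'k mpoly set \<Rightarrow> 'a"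
    and x :: "nat \<Rightarrow> 'a"
    and Jac C :: "'a mat"
  assumes poisson: "poisson_algebra scale br"
    and f: "\<And>i. i < m \<Longrightarrow> f i \<in> carrier (poly_ring n)"
    and I: "I = Idl\<^bsub>poly_ring n\<^esub> (f ` {..<m})"
    and prime: "primeideal I (poly_ring n)"
    and not_maximal: "\<not> maximalideal I (poly_ring n)"
    and localization: "is_localization (poly_ring n Quot I) S (class_ring :: 'a ring) \<phi>"
    and K_linear: "\<And>c. \<phi> (I +>\<^bsub>poly_ring n\<^esub> pconst c) = scale c 1"
    and regular: "regular_domain TYPE('a)"
    and x: "x = (\<lambda>j. \<phi> (I +>\<^bsub>poly_ring n\<^esub> pvar j))"
    and Jac: "Jac = jacobian_matrix m n I \<phi> f"
    and C: "C = poisson_matrix n br x"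
    and r: "r = frac_rank Jac"
    and d: "d = frac_rank C"
  shows
    "((derivations scale = Modules.module.span fun_scale (hamiltonian_derivations br))
        \<longleftrightarrow> (d = n - r \<and> minor_ideal d C = UNIV))
     \<and> ((d = n - r \<and> minor_ideal d C = UNIV)
        \<longleftrightarrow> (\<forall>i\<in>nonzero_minor_rows r Jac. \<forall>j\<in>nonzero_minor_cols r Jac.
               minor Jac i j ^ (n - r) \<in> minor_ideal (n - r) (delete_cols C j)))
     \<and> ((\<forall>i\<in>nonzero_minor_rows r Jac. \<forall>j\<in>nonzero_minor_cols r Jac.
               minor Jac i j ^ (n - r) \<in> minor_ideal (n - r) (delete_cols C j))
        \<longleftrightarrow> (\<forall>i\<in>nonzero_minor_rows r Jac. \<forall>j\<in>nonzero_minor_cols r Jac.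
               \<exists>k\<ge>1. minor Jac i j ^ k \<in> minor_ideal (n - r) C))"
proof -
  have alg: "K_algebra scale" using poisson by (simp add: poisson_algebra_def)
  note pres = localization_presentation[OF alg f I prime localization K_linear x]
  interpret P: poisson_presentation scale br n m f x
    using poisson pres(1) by (rule poisson_presentation.intro)
  have "jacobian_matrix m n I \<phi> f = P.Jac"
    unfolding jacobian_matrix_def P.Jac_def P.grad_def
    by (rule eq_matI) (auto simp: pres(2) P.f_vars poly_vars_pdiff)
  then have Jac': "Jac = P.Jac" and r': "r = P.r"
    by (simp_all add: Jac r P.r_def)
  note mc = P.minor_conditions[OF P.C_carrier P.row_set_C_ker regular]
  show ?thesis
    unfolding d C Jac' r' P.derivations_span_iff using mc by blast
qed

end
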